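(* Let $n\ge 1$ and let $(M,\mathcal A)$ be an N-manifold of degree $n$. Then there is a graded vector bundle $E=\bigoplus_{i=1}^n E_{-i}$ over $M$, concentrated in degrees $-1,\ldots,-n$, such that $(M,\mathcal A)$ is (noncanonically) diffeomorphic, i.e. isomorphic as an N-manifold, to the split N-manifold $E[\cdot]=\bigoplus_{i=1}^nE_{-i}[i]$.
   Context: An N-manifold of degree $n$ (and dimension $p|q_1|\ldots|q_n$) is a smooth Hausdorff second-countable manifold $M$ of dimension $p$ endowed with a sheaf $\mathcal A=\bigoplus_{k\in\mathbb N}\mathcal A^k$ of $\mathbb N$-graded commutative (i.e. $ab=(-1)^{|a||b|}ba$) associative unital $\mathbb R$-algebras, whose degree $0$ term is $\mathcal A^0=C^\infty_M$ and which is locally freely generated, over $C^\infty_M$, by $q_1,\ldots,q_n$ graded commutative generators $\xi_1^{j_1},\ldots,\xi_n^{j_n}$ of degree $1,\ldots,n$, respectively. One may assume $M$ connected. Morphisms of N-manifolds are morphisms of ringed spaces that respect the $\mathbb N$-grading; diffeomorphic means isomorphic. Given smooth finite rank vector bundles $E_{-1},\ldots,E_{-n}$ over $M$, let $E=\bigoplus_{i=1}^nE_{-i}$, with dual $E^*=\bigoplus_i E_{-i}^*$, the vectors of $E_{-i}^*$ having degree $i$. The split N-manifold $E[\cdot]=\bigoplus_{i=1}^n E_{-i}[i]$ is the manifold $M$ endowed with the sheaf $\Gamma(\odot E^* )$ of sections of the graded symmetric tensor algebra bundle $\odot E^*\simeq \wedge E_{-1}^*\otimes\vee E_{-2}^*\otimes\wedge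 E_{-3}^*\otimes\cdots$, where $\wedge$ (resp. $\vee$) is the antisymmetric (resp. symmetric) tensor algebra. *)

theory Defs
  imports "HOL-Analysis.Analysis" "HOL-Analysis.Finite_Function_Topology" "HOL-Algebra.Module"
begin

section \<open>Smooth functions on open subsets of Euclidean space\<close>

text \<open>Points of \<open>p\<close>-dimensional space are the points of the library's \<open>Euclidean_space p\<close>,
  i.e. functions \<open>nat \<Rightarrow> real\<close> that vanish from index \<open>p\<close> on; this allows the dimension to be an
  arbitrary natural number, including \<open>0\<close>.\<close>

definition partial :: "nat \<Rightarrow> ((nat \<Rightarrow> real) \<Rightarrow> real) \<Rightarrow> (nat \<Rightarrow> real) \<Rightarrow> real" where
  "partial i f x = deriv (\<lambda>t. f (x(i := t))) (x i)"

fun Ck_on :: "nat \<Rightarrow> nat \<Rightarrow> (nat \<Rightarrow> real) set \<Rightarrow> ((nat \<Rightarrow> real) \<Rightarrow> real) \<Rightarrow> bool" where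
  "Ck_on 0 p \<Omega> f \<longleftrightarrow> continuous_map (subtopology (Euclidean_space p) \<Omega>) euclideanreal f"
| "Ck_on (Suc k) p \<Omega> f \<longleftrightarrow>
     continuous_map (subtopology (Euclidean_space p) \<Omega>) euclideanreal f \<and>
     (\<forall>i<p. (\<forall>x\<in>\<Omega>. (\<lambda>t. f (x(i := t))) field_differentiable at (x i)) \<and>
            Ck_on k p \<Omega> (partial i f))"

definition smooth_on :: "nat \<Rightarrow> (nat \<Rightarrow> real) set \<Rightarrow> ((nat \<Rightarrow> real) \<Rightarrow> real) \<Rightarrow> bool" where
  "smooth_on p \<Omega> f \<longleftrightarrow> (\<forall>k. Ck_on k p \<Omega> f)"


section \<open>Smooth manifolds\<close>

record 'a mfd =
  mdim :: nat
  mtop :: "'a topology"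
  charts :: "('a set \<times> ('a \<Rightarrow> nat \<Rightarrow> real)) set"

text \<open>The atlas is not required to be maximal.\<close>

definition smooth_manifold :: "'a mfd \<Rightarrow> bool" where
  "smooth_manifold M \<longleftrightarrow>
     Hausdorff_space (mtop M) \<and> second_countable (mtop M) \<and>
     (\<forall>x\<in>topspace (mtop M). \<exists>(U, \<phi>)\<in>charts M. x \<in> U) \<and>
     (\<forall>(U, \<phi>)\<in>charts M. openin (mtop M) U \<and>
        (\<exists>\<Omega>. openin (Euclidean_space (mdim M)) \<Omega> \<and>
             homeomorphic_map (subtopology (mtop M) U)
               (subtopology (Euclidean_space (mdim M)) \<Omega>) \<phi>)) \<and>
     (\<forall>(U, \<phi>)\<in>charts M. \<forall>(V, \<psi>)\<in>charts M. \<forall>j<mdim M.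
        smooth_on (mdim M) (\<phi> ` (U \<inter> V)) (\<lambda>y. \<psi> (inv_into U \<phi> y) j))"

definition smooth_fun :: "'a mfd \<Rightarrow> 'a set \<Rightarrow> ('a \<Rightarrow> real) \<Rightarrow> bool" where
  "smooth_fun M U f \<longleftrightarrow>
     (\<forall>(W, \<phi>)\<in>charts M. smooth_on (mdim M) (\<phi> ` (U \<inter> W)) (\<lambda>y. f (inv_into W \<phi> y)))"

definition C_inf :: "'a mfd \<Rightarrow> 'a set \<Rightarrow> ('a \<Rightarrow> real) set" where
  "C_inf M U = {f \<in> extensional U. smooth_fun M U f}"


section \<open>Sheaves of graded commutative algebras\<close>

definition real_ring :: "real ring" where
  "real_ring = \<lparr>carrier = UNIV, mult = (*), one = 1, zero = 0, add = (+)\<rparr>"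

text \<open>A sheaf of graded algebras \<open>\<Oplus>\<^sub>k \<A>\<^sup>k\<close> is given by its homogeneous components: \<open>sec A k U\<close> is the
  real vector space \<open>\<A>\<^sup>k(U)\<close>, \<open>res A k U V\<close> the restriction from \<open>U\<close> to \<open>V \<subseteq> U\<close>, \<open>gmul A k l U\<close> the
  product \<open>\<A>\<^sup>k(U) \<times> \<A>\<^sup>l(U) \<rightarrow> \<A>\<^sup>k\<^sup>+\<^sup>l(U)\<close> and \<open>gone A U\<close> the unit. The fields \<open>mult\<close> and \<open>one\<close> of the
  module record \<open>sec A k U\<close> carry no information.\<close>

record ('a, 's) gsheaf =
  sec :: "nat \<Rightarrow> 'a set \<Rightarrow> (real, 's) module"
  res :: "nat \<Rightarrow> 'a set \<Rightarrow> 'a set \<Rightarrow> 's \<Rightarrow> 's"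
  gmul :: "nat \<Rightarrow> nat \<Rightarrow> 'a set \<Rightarrow> 's \<Rightarrow> 's \<Rightarrow> 's"
  gone :: "'a set \<Rightarrow> 's"

definition linear_between :: "(real, 's) module \<Rightarrow> (real, 't) module \<Rightarrow> ('s \<Rightarrow> 't) \<Rightarrow> bool" where
  "linear_between P Q h \<longleftrightarrow>
     h \<in> carrier P \<rightarrow> carrier Q \<and>
     (\<forall>a\<in>carrier P. \<forall>b\<in>carrier P. h (a \<oplus>\<^bsub>P\<^esub> b) = h a \<oplus>\<^bsub>Q\<^esub> h b) \<and>
     (\<forall>c. \<forall>a\<in>carrier P. h (c \<odot>\<^bsub>P\<^esub> a) = c \<odot>\<^bsub>Q\<^esub> h a)"

locale graded_comm_sheaf =
  fixes X :: "'a topology" and A :: "('a, 's) gsheaf"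
  assumes sec_module: "openin X U \<Longrightarrow> Module.module real_ring (sec A k U)"
    and mul_left_linear: "\<lbrakk>openin X U; b \<in> carrier (sec A l U)\<rbrakk>
      \<Longrightarrow> linear_between (sec A k U) (sec A (k + l) U) (\<lambda>a. gmul A k l U a b)"
    and mul_right_linear: "\<lbrakk>openin X U; a \<in> carrier (sec A k U)\<rbrakk>
      \<Longrightarrow> linear_between (sec A l U) (sec A (k + l) U) (gmul A k l U a)"
    and mul_assoc: "\<lbrakk>openin X U; a \<in> carrier (sec A k U); b \<in> carrier (sec A l U);
        c \<in> carrier (sec A m U)\<rbrakk>
      \<Longrightarrow> gmul A (k + l) m U (gmul A k l U a b) c = gmul A k (l + m) U a (gmul A l m U b c)"
    and mul_comm: "\<lbrakk>openin X U; a \<in> carrier (sec A k U); b \<in> carrier (sec A l U)\<rbrakk>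
      \<Longrightarrow> gmul A k l U a b = (- 1) ^ (k * l) \<odot>\<^bsub>sec A (k + l) U\<^esub> gmul A l k U b a"
    and one_closed: "openin X U \<Longrightarrow> gone A U \<in> carrier (sec A 0 U)"
    and mul_one: "\<lbrakk>openin X U; a \<in> carrier (sec A k U)\<rbrakk> \<Longrightarrow> gmul A k 0 U a (gone A U) = a"
    and one_mul: "\<lbrakk>openin X U; a \<in> carrier (sec A k U)\<rbrakk> \<Longrightarrow> gmul A 0 k U (gone A U) a = a"
    and res_linear: "\<lbrakk>openin X U; openin X V; V \<subseteq> U\<rbrakk>
      \<Longrightarrow> linear_between (sec A k U) (sec A k V) (res A k U V)"
    and res_self: "\<lbrakk>openin X U; a \<in> carrier (sec A k U)\<rbrakk> \<Longrightarrow> res A k U U a = a"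
    and res_res: "\<lbrakk>openin X U; openin X V; openin X W; W \<subseteq> V; V \<subseteq> U; a \<in> carrier (sec A k U)\<rbrakk>
      \<Longrightarrow> res A k V W (res A k U V a) = res A k U W a"
    and res_mul: "\<lbrakk>openin X U; openin X V; V \<subseteq> U; a \<in> carrier (sec A k U); b \<in> carrier (sec A l U)\<rbrakk>
      \<Longrightarrow> res A (k + l) U V (gmul A k l U a b) = gmul A k l V (res A k U V a) (res A l U V b)"
    and res_one: "\<lbrakk>openin X U; openin X V; V \<subseteq> U\<rbrakk> \<Longrightarrow> res A 0 U V (gone A U) = gone A V"
    and locality: "\<lbrakk>\<And>U. U \<in> \<U> \<Longrightarrow> openin X U; a \<in> carrier (sec A k (\<Union>\<U>)); b \<in> carrier (sec A k (\<Union>\<U>));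
        \<And>U. U \<in> \<U> \<Longrightarrow> res A k (\<Union>\<U>) U a = res A k (\<Union>\<U>) U b\<rbrakk> \<Longrightarrow> a = b"
    and gluing: "\<lbrakk>\<And>U. U \<in> \<U> \<Longrightarrow> openin X U; \<And>U. U \<in> \<U> \<Longrightarrow> s U \<in> carrier (sec A k U);
        \<And>U V. \<lbrakk>U \<in> \<U>; V \<in> \<U>\<rbrakk> \<Longrightarrow> res A k U (U \<inter> V) (s U) = res A k V (U \<inter> V) (s V)\<rbrakk>
      \<Longrightarrow> \<exists>a\<in>carrier (sec A k (\<Union>\<U>)). \<forall>U\<in>\<U>. res A k (\<Union>\<U>) U a = s U"


section \<open>N-manifolds\<close>

text \<open>The identification \<open>\<A>\<^sup>0 = C\<^sup>\<infinity>\<^sub>M\<close> is an isomorphism of sheaves of unital real algebras over the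
  identity of \<open>M\<close>. It is unique if it exists, so it is not recorded as data.\<close>

definition degree_zero_C_inf :: "'a mfd \<Rightarrow> ('a, 's) gsheaf \<Rightarrow> bool" where
  "degree_zero_C_inf M A \<longleftrightarrow> (\<exists>\<kappa> :: 'a set \<Rightarrow> 's \<Rightarrow> 'a \<Rightarrow> real.
     \<forall>U. openin (mtop M) U \<longrightarrow>
       bij_betw (\<kappa> U) (carrier (sec A 0 U)) (C_inf M U) \<and>
       (\<forall>a\<in>carrier (sec A 0 U). \<forall>b\<in>carrier (sec A 0 U). \<forall>x\<in>U.
          \<kappa> U (a \<oplus>\<^bsub>sec A 0 U\<^esub> b) x = \<kappa> U a x + \<kappa> U b x \<and>
          \<kappa> U (gmul A 0 0 U a b) x = \<kappa> U a x * \<kappa> U b x) \<and>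
       (\<forall>c. \<forall>a\<in>carrier (sec A 0 U). \<forall>x\<in>U. \<kappa> U (c \<odot>\<^bsub>sec A 0 U\<^esub> a) x = c * \<kappa> U a x) \<and>
       (\<forall>x\<in>U. \<kappa> U (gone A U) x = 1) \<and>
       (\<forall>V. openin (mtop M) V \<and> V \<subseteq> U \<longrightarrow>
          (\<forall>a\<in>carrier (sec A 0 U). \<kappa> V (res A 0 U V a) = restrict (\<kappa> U a) V)))"

text \<open>Monomials of degree \<open>k\<close> in graded commutative generators \<open>\<xi>\<^sub>i\<^sup>j\<close> (\<open>1 \<le> i \<le> n\<close>, \<open>j < q i\<close>) of degree
  \<open>i\<close>: words of generators in increasing lexicographic order in which only generators of even degree
  may be repeated.\<close>

definition gmonomials :: "nat \<Rightarrow> (nat \<Rightarrow> nat) \<Rightarrow> nat \<Rightarrow> (nat \<times> nat) list set" where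
  "gmonomials n q k =
     {w \<in> lists {(i, j). i \<in> {1..n} \<and> j < q i}.
        sorted_wrt (\<lambda>(i, j) (i', j'). i < i' \<or> i = i' \<and> (j < j' \<or> j = j' \<and> even i)) w \<and>
        sum_list (map fst w) = k}"

fun gword :: "('a, 's) gsheaf \<Rightarrow> 'a set \<Rightarrow> (nat \<Rightarrow> nat \<Rightarrow> 's) \<Rightarrow> (nat \<times> nat) list \<Rightarrow> 's" where
  "gword A U \<xi> [] = gone A U"
| "gword A U \<xi> ((i, j) # w) = gmul A i (sum_list (map fst w)) U (\<xi> i j) (gword A U \<xi> w)"

text \<open>On \<open>U\<close> the sheaf is freely generated over \<open>C\<^sup>\<infinity>\<close> by the \<open>\<xi> i j\<close>: over each open \<open>V \<subseteq> U\<close>, every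
  section is in a unique way a polynomial in the restricted generators with coefficients in
  \<open>\<A>\<^sup>0(V)\<close>.\<close>

definition freely_generated ::
  "'a topology \<Rightarrow> ('a, 's) gsheaf \<Rightarrow> nat \<Rightarrow> (nat \<Rightarrow> nat) \<Rightarrow> 'a set \<Rightarrow> (nat \<Rightarrow> nat \<Rightarrow> 's) \<Rightarrow> bool" where
  "freely_generated X A n q U \<xi> \<longleftrightarrow>
     (\<forall>i\<in>{1..n}. \<forall>j<q i. \<xi> i j \<in> carrier (sec A i U)) \<and>
     (\<forall>V k. openin X V \<and> V \<subseteq> U \<longrightarrow>
        (\<forall>a\<in>carrier (sec A k V).
           \<exists>!c. c \<in> gmonomials n q k \<rightarrow>\<^sub>E carrier (sec A 0 V) \<and>
             a = finsum (sec A k V) (\<lambda>w. gmul A 0 k V (c w) (res A k U V (gword A U \<xi> w)))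
                   (gmonomials n q k)))"

text \<open>An N-manifold of degree \<open>n\<close> and dimension \<open>mdim M | q 1 | ... | q n\<close>.\<close>

definition N_manifold :: "nat \<Rightarrow> (nat \<Rightarrow> nat) \<Rightarrow> 'a mfd \<times> ('a, 's) gsheaf \<Rightarrow> bool" where
  "N_manifold n q = (\<lambda>(M, A).
     smooth_manifold M \<and>
     graded_comm_sheaf (mtop M) A \<and>
     degree_zero_C_inf M A \<and>
     (\<forall>x\<in>topspace (mtop M). \<exists>U \<xi>. openin (mtop M) U \<and> x \<in> U \<and>
        freely_generated (mtop M) A n q U \<xi>))"

text \<open>Morphisms of ringed spaces that respect the grading: a continuous map \<open>\<phi>\<close> of the bases and
  algebra morphisms \<open>\<Phi> k V : \<B>\<^sup>k(V) \<rightarrow> \<A>\<^sup>k(\<phi>\<^sup>-\<^sup>1(V))\<close>, compatible with restrictions. Smoothness of \<open>\<phi>\<close>,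
  and the fact that \<open>\<Phi>\<close> is the pullback of functions in degree 0, are consequences.\<close>

definition preim :: "'a topology \<Rightarrow> ('a \<Rightarrow> 'b) \<Rightarrow> 'b set \<Rightarrow> 'a set" where
  "preim X \<phi> V = {x \<in> topspace X. \<phi> x \<in> V}"

definition N_morphism ::
  "'a mfd \<times> ('a, 's) gsheaf \<Rightarrow> 'b mfd \<times> ('b, 't) gsheaf \<Rightarrow>
   ('a \<Rightarrow> 'b) \<Rightarrow> (nat \<Rightarrow> 'b set \<Rightarrow> 't \<Rightarrow> 's) \<Rightarrow> bool" where
  "N_morphism = (\<lambda>(M, A) (N, B) \<phi> \<Phi>.
     continuous_map (mtop M) (mtop N) \<phi> \<and>
     (\<forall>V. openin (mtop N) V \<longrightarrow>
        (\<forall>k. linear_between (sec B k V) (sec A k (preim (mtop M) \<phi> V)) (\<Phi> k V)) \<and>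
        (\<forall>k l. \<forall>a\<in>carrier (sec B k V). \<forall>b\<in>carrier (sec B l V).
           \<Phi> (k + l) V (gmul B k l V a b) =
           gmul A k l (preim (mtop M) \<phi> V) (\<Phi> k V a) (\<Phi> l V b)) \<and>
        \<Phi> 0 V (gone B V) = gone A (preim (mtop M) \<phi> V) \<and>
        (\<forall>W k. openin (mtop N) W \<and> W \<subseteq> V \<longrightarrow>
           (\<forall>a\<in>carrier (sec B k V).
              \<Phi> k W (res B k V W a) =
              res A k (preim (mtop M) \<phi> V) (preim (mtop M) \<phi> W) (\<Phi> k V a)))))"

definition N_isomorphic :: "'a mfd \<times> ('a, 's) gsheaf \<Rightarrow> 'b mfd \<times> ('b, 't) gsheaf \<Rightarrow> bool" where
  "N_isomorphic = (\<lambda>(M, A) (N, B). \<exists>\<phi> \<Phi> \<psi> \<Psi>.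
     N_morphism (M, A) (N, B) \<phi> \<Phi> \<and> N_morphism (N, B) (M, A) \<psi> \<Psi> \<and>
     (\<forall>x\<in>topspace (mtop M). \<psi> (\<phi> x) = x) \<and>
     (\<forall>y\<in>topspace (mtop N). \<phi> (\<psi> y) = y) \<and>
     (\<forall>k U. openin (mtop M) U \<longrightarrow>
        (\<forall>a\<in>carrier (sec A k U). \<Phi> k (preim (mtop N) \<psi> U) (\<Psi> k U a) = a)) \<and>
     (\<forall>k V. openin (mtop N) V \<longrightarrow>
        (\<forall>b\<in>carrier (sec B k V). \<Psi> k (preim (mtop M) \<phi> V) (\<Phi> k V b) = b)))"


section \<open>Smooth vector bundles of finite rank\<close>

text \<open>Fibres are linear subspaces of an ambient real vector space type, whose operations provide
  those of the fibres; no relation between the position of the fibres in the ambient space and the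
  smooth structure of the bundle is assumed. A local trivialization \<open>(U, \<Phi>)\<close> consists of linear
  isomorphisms \<open>\<Phi> x\<close> from the fibre over \<open>x \<in> U\<close> onto \<open>Euclidean_space r\<close>, and the smooth structure
  is given by trivializations with smooth transition matrices.\<close>

record ('a, 'v) vbundle =
  vrank :: nat
  vfib :: "'a \<Rightarrow> 'v set"
  vtriv :: "('a set \<times> ('a \<Rightarrow> 'v \<Rightarrow> nat \<Rightarrow> real)) set"

definition unit_vec :: "nat \<Rightarrow> nat \<Rightarrow> real" where
  "unit_vec i = (\<lambda>j. if j = i then 1 else 0)"

definition smooth_vector_bundle :: "'a mfd \<Rightarrow> ('a, 'v::real_vector) vbundle \<Rightarrow> bool" where
  "smooth_vector_bundle M F \<longleftrightarrow>
     (\<forall>x\<in>topspace (mtop M). subspace (vfib F x) \<and> (\<exists>(U, \<Phi>)\<in>vtriv F. x \<in> U)) \<and>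
     (\<forall>(U, \<Phi>)\<in>vtriv F. openin (mtop M) U \<and>
        (\<forall>x\<in>U. bij_betw (\<Phi> x) (vfib F x) (topspace (Euclidean_space (vrank F))) \<and>
           (\<forall>v\<in>vfib F x. \<forall>w\<in>vfib F x. \<forall>j. \<Phi> x (v + w) j = \<Phi> x v j + \<Phi> x w j) \<and>
           (\<forall>c. \<forall>v\<in>vfib F x. \<forall>j. \<Phi> x (c *\<^sub>R v) j = c * \<Phi> x v j))) \<and>
     (\<forall>(U, \<Phi>)\<in>vtriv F. \<forall>(V, \<Psi>)\<in>vtriv F. \<forall>i<vrank F. \<forall>j<vrank F.
        smooth_fun M (U \<inter> V) (\<lambda>x. \<Psi> x (inv_into (vfib F x) (\<Phi> x) (unit_vec i)) j))"

definition dual_space :: "'v::real_vector set \<Rightarrow> (real, 'v \<Rightarrow> real) module" where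
  "dual_space S =
     \<lparr>carrier = {\<alpha> \<in> extensional S. (\<forall>v\<in>S. \<forall>w\<in>S. \<alpha> (v + w) = \<alpha> v + \<alpha> w) \<and>
                                  (\<forall>c. \<forall>v\<in>S. \<alpha> (c *\<^sub>R v) = c * \<alpha> v)},
      mult = undefined, one = undefined,
      zero = (\<lambda>v\<in>S. 0), add = (\<lambda>\<alpha> \<beta>. \<lambda>v\<in>S. \<alpha> v + \<beta> v), smult = (\<lambda>c \<alpha>. \<lambda>v\<in>S. c * \<alpha> v)\<rparr>"


section \<open>The graded symmetric tensor algebra\<close>

text \<open>Let \<open>W\<close> be a graded vector space with components \<open>W i\<close> in the degrees \<open>1 \<le> i \<le> n\<close>. Its graded
  symmetric tensor algebra is the tensor algebra of \<open>W\<close> modulo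
  \<open>a \<otimes> b - (-1)\<^sup>i\<^sup>j b \<otimes> a\<close> for \<open>a \<in> W i\<close>, \<open>b \<in> W j\<close>. It is constructed in one step as a quotient of
  the free associative algebra on the homogeneous vectors: formal linear combinations of words,
  modulo multilinearity of words and graded commutativity.\<close>

type_synonym 'w words = "(nat \<times> 'w) list \<Rightarrow>\<^sub>0 real"

definition letters :: "nat \<Rightarrow> (nat \<Rightarrow> (real, 'w) module) \<Rightarrow> (nat \<times> 'w) set" where
  "letters n W = {(i, a). i \<in> {1..n} \<and> a \<in> carrier (W i)}"

abbreviation word :: "(nat \<times> 'w) list \<Rightarrow> 'w words" where
  "word w \<equiv> Poly_Mapping.single w 1"

definition words_mult :: "'w words \<Rightarrow> 'w words \<Rightarrow> 'w words" where
  "words_mult f g = (\<Sum>u\<in>Poly_Mapping.keys f. \<Sum>v\<in>Poly_Mapping.keys g.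
     Poly_Mapping.single (u @ v) (Poly_Mapping.lookup f u * Poly_Mapping.lookup g v))"

definition gsym_ideal :: "nat \<Rightarrow> (nat \<Rightarrow> (real, 'w) module) \<Rightarrow> 'w words set" where
  "gsym_ideal n W = span (
     {word (u @ [(i, a \<oplus>\<^bsub>W i\<^esub> b)] @ v) - word (u @ [(i, a)] @ v) - word (u @ [(i, b)] @ v) | u v i a b.
        u \<in> lists (letters n W) \<and> v \<in> lists (letters n W) \<and>
        (i, a) \<in> letters n W \<and> (i, b) \<in> letters n W} \<union>
     {word (u @ [(i, c \<odot>\<^bsub>W i\<^esub> a)] @ v) - c *\<^sub>R word (u @ [(i, a)] @ v) | u v i c a.
        u \<in> lists (letters n W) \<and> v \<in> lists (letters n W) \<and> (i, a) \<in> letters n W} \<union>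
     {word (u @ [(i, a), (j, b)] @ v) - (- 1) ^ (i * j) *\<^sub>R word (u @ [(j, b), (i, a)] @ v) | u v i j a b.
        u \<in> lists (letters n W) \<and> v \<in> lists (letters n W) \<and>
        (i, a) \<in> letters n W \<and> (j, b) \<in> letters n W})"

definition gsym_class :: "nat \<Rightarrow> (nat \<Rightarrow> (real, 'w) module) \<Rightarrow> 'w words \<Rightarrow> 'w words set" where
  "gsym_class n W f = {f + h | h. h \<in> gsym_ideal n W}"

definition gsym :: "nat \<Rightarrow> (nat \<Rightarrow> (real, 'w) module) \<Rightarrow> nat \<Rightarrow> (real, 'w words set) module" where
  "gsym n W k =
     \<lparr>carrier = {gsym_class n W f | f.
         Poly_Mapping.keys f \<subseteq> {w \<in> lists (letters n W). sum_list (map fst w) = k}},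
      mult = undefined, one = undefined,
      zero = gsym_class n W 0,
      add = (\<lambda>P Q. \<Union>f\<in>P. \<Union>g\<in>Q. gsym_class n W (f + g)),
      smult = (\<lambda>c P. \<Union>f\<in>P. gsym_class n W (c *\<^sub>R f))\<rparr>"

definition gsym_mult ::
  "nat \<Rightarrow> (nat \<Rightarrow> (real, 'w) module) \<Rightarrow> 'w words set \<Rightarrow> 'w words set \<Rightarrow> 'w words set" where
  "gsym_mult n W P Q = (\<Union>f\<in>P. \<Union>g\<in>Q. gsym_class n W (words_mult f g))"


section \<open>Split N-manifolds\<close>

text \<open>A graded vector bundle \<open>E = \<Oplus>\<^sub>i E\<^sub>-\<^sub>i\<close> concentrated in degrees \<open>-1, ..., -n\<close> is given by the family
  \<open>E\<close> with \<open>E i\<close> standing for \<open>E\<^sub>-\<^sub>i\<close>, \<open>1 \<le> i \<le> n\<close>.\<close>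

definition dual_fibre :: "(nat \<Rightarrow> ('a, 'v::real_vector) vbundle) \<Rightarrow> 'a \<Rightarrow> nat \<Rightarrow> (real, 'v \<Rightarrow> real) module" where
  "dual_fibre E x i = dual_space (vfib (E i) x)"

text \<open>Smooth sections of degree \<open>k\<close> of the graded symmetric tensor algebra bundle of \<open>E\<^sup>*\<close>. Coordinate
  functionals of local trivializations of the \<open>E i\<close> form local frames of the duals, and the
  monomials of degree \<open>k\<close> in these form a local frame of the degree \<open>k\<close> part of the symmetric algebra
  bundle; a section is smooth if its coefficients in such frames are.\<close>

definition frame_word ::
  "(nat \<Rightarrow> ('a, 'v::real_vector) vbundle) \<Rightarrow> (nat \<Rightarrow> 'a \<Rightarrow> 'v \<Rightarrow> nat \<Rightarrow> real) \<Rightarrow> 'a \<Rightarrow>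
   (nat \<times> nat) list \<Rightarrow> (nat \<times> ('v \<Rightarrow> real)) list" where
  "frame_word E \<Phi> x w = map (\<lambda>(i, j). (i, \<lambda>v\<in>vfib (E i) x. \<Phi> i x v j)) w"

definition smooth_gsym_sections ::
  "nat \<Rightarrow> 'a mfd \<Rightarrow> (nat \<Rightarrow> ('a, 'v::real_vector) vbundle) \<Rightarrow> nat \<Rightarrow> 'a set \<Rightarrow>
   ('a \<Rightarrow> ('v \<Rightarrow> real) words set) set" where
  "smooth_gsym_sections n M E k U =
     {s \<in> (\<Pi>\<^sub>E x\<in>U. carrier (gsym n (dual_fibre E x) k)).
        \<forall>x\<in>U. \<exists>V T \<Phi> f. openin (mtop M) V \<and> x \<in> V \<and> V \<subseteq> U \<and>
          (\<forall>i\<in>{1..n}. (T i, \<Phi> i) \<in> vtriv (E i) \<and> V \<subseteq> T i) \<and>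
          (\<forall>w\<in>gmonomials n (\<lambda>i. vrank (E i)) k. smooth_fun M V (f w)) \<and>
          (\<forall>y\<in>V. s y = gsym_class n (dual_fibre E y)
             (\<Sum>w\<in>gmonomials n (\<lambda>i. vrank (E i)) k. f w y *\<^sub>R word (frame_word E \<Phi> y w)))}"

definition split_sheaf ::
  "nat \<Rightarrow> 'a mfd \<Rightarrow> (nat \<Rightarrow> ('a, 'v::real_vector) vbundle) \<Rightarrow>
   ('a, 'a \<Rightarrow> ('v \<Rightarrow> real) words set) gsheaf" where
  "split_sheaf n M E =
     \<lparr>sec = (\<lambda>k U.
        \<lparr>carrier = smooth_gsym_sections n M E k U,
         mult = undefined, one = undefined,
         zero = (\<lambda>x\<in>U. zero (gsym n (dual_fibre E x) k)),
         add = (\<lambda>s t. \<lambda>x\<in>U. s x \<oplus>\<^bsub>gsym n (dual_fibre E x) k\<^esub> t x),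
         smult = (\<lambda>c s. \<lambda>x\<in>U. c \<odot>\<^bsub>gsym n (dual_fibre E x) k\<^esub> s x)\<rparr>),
      res = (\<lambda>k U V s. restrict s V),
      gmul = (\<lambda>k l U s t. \<lambda>x\<in>U. gsym_mult n (dual_fibre E x) (s x) (t x)),
      gone = (\<lambda>U. \<lambda>x\<in>U. gsym_class n (dual_fibre E x) (word []))\<rparr>"

definition split_N_manifold ::
  "nat \<Rightarrow> 'a mfd \<Rightarrow> (nat \<Rightarrow> ('a, 'v::real_vector) vbundle) \<Rightarrow>
   'a mfd \<times> ('a, 'a \<Rightarrow> ('v \<Rightarrow> real) words set) gsheaf" where
  "split_N_manifold n M E = (M, split_sheaf n M E)"

end

theory Submission
  imports Defs
begin

text \<open>
  Choose generators \<open>\<eta>\<^sub>m\<close> of the sheaf over the members \<open>U\<^sub>m\<close> of a countable cover, and let \<open>g\<^sub>m\<^sub>l\<close> be the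
  matrix of linear coefficients in the expansion of \<open>\<eta>\<^sub>m\<close> in monomials of \<open>\<eta>\<^sub>l\<close>. A product of sections
  of positive degree has no linear part, hence \<open>g\<close> is a smooth cocycle. If \<open>\<rho>\<close> is a partition of
  unity, the averages \<open>\<xi>\<^sub>m = \<Sum>\<^sub>l \<rho>\<^sub>l g\<^sub>m\<^sub>l \<eta>\<^sub>l\<close> satisfy \<open>\<xi>\<^sub>m = g\<^sub>m\<^sub>l \<xi>\<^sub>l\<close> by the cocycle identity. They differ from
  \<open>\<eta>\<^sub>m\<close> by decomposable sections, so that their monomials still form local bases, by induction on the
  degree. Hence the bundle with cocycle \<open>g\<close> does the job: mapping the coordinate frames of its dual to
  the \<open>\<xi>\<^sub>m\<close> is independent of \<open>m\<close>. That monomials in a frame are linearly independent in the symmetric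
  algebra, given as a quotient of the free algebra, is obtained by evaluating words in the \<open>\<xi>\<^sub>m\<close>.
\<close>

section \<open>Calculus of smooth functions\<close>

text \<open>What is canonical is the quotient of the degree i sections by the decomposable ones: it
  is locally free with transition matrices g, hence the sheaf of sections of a bundle, the dual of
  the i-th summand of E. The projection onto this quotient has no preferred splitting. Chart l
  splits it locally by lifting its frame to its \<eta>; splittings form an affine space, so \<rho>
  averages them, and the \<xi> of chart m are the lifts of its frame by the averaged splitting. The
  choice of \<eta> and \<rho> is what makes the isomorphism noncanonical. Sections live over varying
  open sets, in a separate module for each degree. They are therefore compared at points:
  \<open>val m U k a w x\<close> is the coefficient of the monomial \<open>w\<close> in the
  expansion of \<open>a\<close> over chart m, at x. These numbers determine a section, change
  linearly between charts and determine those of a product bilinearly, so at a fixed x they behave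
  like the fibre of an algebra bundle, and the comparison with the symmetric algebra becomes linear
  algebra at each point.\<close>

lemma Euclidean_space_update:
  assumes "x \<in> topspace (Euclidean_space p)" "i < p"
  shows "continuous_map euclideanreal (Euclidean_space p) (\<lambda>t. x(i := t))"
proof -
  have "continuous_map euclideanreal euclideanreal (\<lambda>t. (x(i := t)) j)" for j
    by (cases "j = i") auto
  then show ?thesis
    using assms unfolding Euclidean_space_def
    by (auto simp: continuous_map_in_subtopology continuous_map_componentwise_UNIV)
qed

lemma eventually_update_in:
  assumes "openin (Euclidean_space p) \<Omega>" "x \<in> \<Omega>" "i < p"
  shows "eventually (\<lambda>t. x(i := t) \<in> \<Omega>) (nhds (x i))"
proof -
  have x: "x \<in> topspace (Euclidean_space p)"
    using assms openin_subset by blast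
  have "openin euclideanreal {t \<in> topspace euclideanreal. x(i := t) \<in> \<Omega>}"
    using openin_continuous_map_preimage[OF Euclidean_space_update[OF x assms(3)] assms(1)] .
  then show ?thesis
    using assms(2) by (auto simp: eventually_nhds intro!: exI[of _ "{t. x(i := t) \<in> \<Omega>}"])
qed

lemma field_differentiable_transform_eventually:
  assumes "f field_differentiable at a" "eventually (\<lambda>t. f t = g t) (nhds a)"
  shows "g field_differentiable at a"
  using assms unfolding field_differentiable_def
  by (metis DERIV_cong_ev)

text \<open>Partial derivatives at a point see only the germ of a function. As
  \<open>\<Omega>\<close> is open, a small change of one coordinate stays inside it, so agreement on
  \<open>\<Omega>\<close> suffices; this is where the calculus rules use an open domain.\<close>

lemma update_differentiable_cong:
  assumes "openin (Euclidean_space p) \<Omega>" "\<And>x. x \<in> \<Omega> \<Longrightarrow> f x = g x" "x \<in> \<Omega>" "i < p"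
  shows "(\<lambda>t. f (x(i := t))) field_differentiable at (x i) \<longleftrightarrow>
         (\<lambda>t. g (x(i := t))) field_differentiable at (x i)"
    and "partial i f x = partial i g x"
proof -
  have ev: "eventually (\<lambda>t. f (x(i := t)) = g (x(i := t))) (nhds (x i))"
    using eventually_update_in[OF assms(1,3,4)] by eventually_elim (use assms(2) in auto)
  have ev': "eventually (\<lambda>t. g (x(i := t)) = f (x(i := t))) (nhds (x i))"
    using ev by (simp add: eq_commute)
  show "(\<lambda>t. f (x(i := t))) field_differentiable at (x i) \<longleftrightarrow>
         (\<lambda>t. g (x(i := t))) field_differentiable at (x i)"
    using field_differentiable_transform_eventually[OF _ ev]
      field_differentiable_transform_eventually[OF _ ev'] by blast
  show "partial i f x = partial i g x"
    unfolding partial_def by (rule deriv_cong_ev[OF ev refl])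
qed

lemma continuous_map_cong_on:
  assumes "\<And>x. x \<in> \<Omega> \<Longrightarrow> f x = g x"
  shows "continuous_map (subtopology X \<Omega>) Y f \<longleftrightarrow> continuous_map (subtopology X \<Omega>) Y g"
  using assms by (auto intro: continuous_map_eq)

lemma Ck_on_cong:
  assumes "openin (Euclidean_space p) \<Omega>" "\<And>x. x \<in> \<Omega> \<Longrightarrow> f x = g x"
  shows "Ck_on k p \<Omega> f \<longleftrightarrow> Ck_on k p \<Omega> g"
  using assms(2)
proof (induction k arbitrary: f g)
  case 0
  then show ?case using continuous_map_cong_on[of \<Omega> f g] by simp
next
  case (Suc k)
  have "Ck_on k p \<Omega> (partial i f) \<longleftrightarrow> Ck_on k p \<Omega> (partial i g)" if "i < p" for i
    by (rule Suc.IH, rule update_differentiable_cong(2)[OF assms(1)]) (use Suc.prems that in auto)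
  moreover have "continuous_map (subtopology (Euclidean_space p) \<Omega>) euclideanreal f =
     continuous_map (subtopology (Euclidean_space p) \<Omega>) euclideanreal g"
    by (rule continuous_map_cong_on) (use Suc.prems in auto)
  moreover have "(\<lambda>t. f (x(i := t))) field_differentiable at (x i) \<longleftrightarrow>
      (\<lambda>t. g (x(i := t))) field_differentiable at (x i)" if "i < p" "x \<in> \<Omega>" for i x
    by (rule update_differentiable_cong(1)[OF assms(1)]) (use Suc.prems that in auto)
  ultimately show ?case by simp
qed

lemma Ck_on_mono:
  assumes "\<Omega>' \<subseteq> \<Omega>" "Ck_on k p \<Omega> f"
  shows "Ck_on k p \<Omega>' f"
  using assms(2)
proof (induction k arbitrary: f)
  case 0
  then show ?case using continuous_map_from_subtopology_mono assms(1) by auto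
next
  case (Suc k)
  then show ?case using continuous_map_from_subtopology_mono assms(1) by fastforce
qed

lemma Ck_on_continuous:
  "Ck_on k p \<Omega> f \<Longrightarrow> continuous_map (subtopology (Euclidean_space p) \<Omega>) euclideanreal f"
  by (cases k) auto

lemma continuous_map_local:
  assumes "\<And>x. x \<in> \<Omega> \<Longrightarrow> \<exists>V. openin X V \<and> x \<in> V \<and> continuous_map (subtopology X (\<Omega> \<inter> V)) Y f"
  shows "continuous_map (subtopology X \<Omega>) Y f"
proof -
  let ?X = "subtopology X \<Omega>"
  obtain V where V: "\<And>x. x \<in> \<Omega> \<Longrightarrow> openin X (V x) \<and> x \<in> V x \<and>
     continuous_map (subtopology X (\<Omega> \<inter> V x)) Y f"
    using assms by metis
  have sp: "f y \<in> topspace Y" if "y \<in> \<Omega>" "y \<in> topspace X" for y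
    using V[OF that(1)] that by (auto simp: continuous_map_def)
  have "openin ?X {y \<in> topspace ?X. f y \<in> T}" if T: "openin Y T" for T
  proof -
    have "openin ?X ({y \<in> topspace ?X. f y \<in> T} \<inter> V x)" if "x \<in> \<Omega>" for x
    proof -
      have "openin (subtopology X (\<Omega> \<inter> V x)) {y \<in> topspace (subtopology X (\<Omega> \<inter> V x)). f y \<in> T}"
        using V[OF that] T openin_continuous_map_preimage by blast
      then obtain S where S: "openin X S"
         "{y \<in> topspace (subtopology X (\<Omega> \<inter> V x)). f y \<in> T} = S \<inter> (\<Omega> \<inter> V x)"
        by (auto simp: openin_subtopology)
      then have "{y \<in> topspace ?X. f y \<in> T} \<inter> V x = (S \<inter> V x) \<inter> \<Omega>"
        by auto
      then show ?thesis using S V[OF that] by (auto simp: openin_subtopology)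
    qed
    then have "openin ?X (\<Union>x\<in>\<Omega>. {y \<in> topspace ?X. f y \<in> T} \<inter> V x)" by blast
    moreover have "(\<Union>x\<in>\<Omega>. {y \<in> topspace ?X. f y \<in> T} \<inter> V x) = {y \<in> topspace ?X. f y \<in> T}"
      using V by auto
    ultimately show ?thesis by simp
  qed
  then show ?thesis using sp by (auto simp: continuous_map_def)
qed

lemma Ck_on_local:
  assumes "\<And>x. x \<in> \<Omega> \<Longrightarrow> \<exists>V. openin (Euclidean_space p) V \<and> x \<in> V \<and> Ck_on k p (\<Omega> \<inter> V) f"
  shows "Ck_on k p \<Omega> f"
  using assms
proof (induction k arbitrary: f)
  case 0
  then have "\<exists>V. openin (Euclidean_space p) V \<and> x \<in> V \<and>
      continuous_map (subtopology (Euclidean_space p) (\<Omega> \<inter> V)) euclideanreal f" if "x \<in> \<Omega>" for x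
    using that by simp
  then show ?case by (simp add: continuous_map_local)
next
  case (Suc k)
  have "continuous_map (subtopology (Euclidean_space p) \<Omega>) euclideanreal f"
    by (rule continuous_map_local) (use Suc.prems in \<open>meson Ck_on.simps(2)\<close>)
  moreover have "(\<lambda>t. f (x(i := t))) field_differentiable at (x i)" if "i < p" "x \<in> \<Omega>" for i x
    using Suc.prems[OF that(2)] that by auto
  moreover have "Ck_on k p \<Omega> (partial i f)" if "i < p" for i
    by (rule Suc.IH) (use Suc.prems that in \<open>meson Ck_on.simps(2)\<close>)
  ultimately show ?case by simp
qed

lemma Ck_on_Suc_D: "Ck_on (Suc k) p \<Omega> f \<Longrightarrow> Ck_on k p \<Omega> f"
  by (induction k arbitrary: f) auto

lemma Ck_on_const: "Ck_on k p \<Omega> (\<lambda>_. c)"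
proof (induction k arbitrary: c)
  case (Suc k)
  have "partial i (\<lambda>_. c) = (\<lambda>_. 0)" for i by (auto simp: partial_def)
  then show ?case using Suc by auto
qed auto

lemma Ck_on_add:
  assumes "openin (Euclidean_space p) \<Omega>" "Ck_on k p \<Omega> f" "Ck_on k p \<Omega> g"
  shows "Ck_on k p \<Omega> (\<lambda>x. f x + g x)"
  using assms(2,3)
proof (induction k arbitrary: f g)
  case 0
  then show ?case by (auto intro: continuous_intros)
next
  case (Suc k)
  have "partial i (\<lambda>x. f x + g x) x = partial i f x + partial i g x" if "i < p" "x \<in> \<Omega>" for i x
    unfolding partial_def by (rule deriv_add) (use Suc.prems that in auto)
  moreover have "Ck_on k p \<Omega> (\<lambda>x. partial i f x + partial i g x)" if "i < p" for i
    using Suc.prems that by (intro Suc.IH) auto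
  ultimately have "Ck_on k p \<Omega> (partial i (\<lambda>x. f x + g x))" if "i < p" for i
    using Ck_on_cong[OF assms(1), of "partial i (\<lambda>x. f x + g x)" "\<lambda>x. partial i f x + partial i g x" k] that by simp
  then show ?case using Suc.prems
    by (auto intro: continuous_intros field_differentiable_add)
qed

lemma Ck_on_mult:
  assumes "openin (Euclidean_space p) \<Omega>" "Ck_on k p \<Omega> f" "Ck_on k p \<Omega> g"
  shows "Ck_on k p \<Omega> (\<lambda>x. f x * g x)"
  using assms(2,3)
proof (induction k arbitrary: f g)
  case 0
  then show ?case by (auto intro: continuous_intros)
next
  case (Suc k)
  have "partial i (\<lambda>x. f x * g x) x = f x * partial i g x + partial i f x * g x"
    if "i < p" "x \<in> \<Omega>" for i x
    unfolding partial_def by (subst deriv_mult) (use Suc.prems that in auto)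
  moreover have "Ck_on k p \<Omega> (\<lambda>x. f x * partial i g x + partial i f x * g x)" if "i < p" for i
    using Suc.prems that Ck_on_Suc_D by (intro Ck_on_add[OF assms(1)] Suc.IH) auto
  ultimately have "Ck_on k p \<Omega> (partial i (\<lambda>x. f x * g x))" if "i < p" for i
    using Ck_on_cong[OF assms(1), of "partial i (\<lambda>x. f x * g x)" "\<lambda>x. f x * partial i g x + partial i f x * g x" k] that by simp
  then show ?case using Suc.prems
    by (auto intro: continuous_intros field_differentiable_mult)
qed

text \<open>\<open>H\<close> lists the iterated derivatives of the outer function. The induction
  treats all \<open>H m\<close> at once, because a partial derivative of \<open>H m (f x)\<close> is
  \<open>H (Suc m) (f x)\<close> times a partial derivative of \<open>f\<close>.\<close>

lemma Ck_on_compose: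
  assumes "openin (Euclidean_space p) \<Omega>" "Ck_on k p \<Omega> f" "f ` \<Omega> \<subseteq> J"
    and H: "\<And>m t. t \<in> J \<Longrightarrow> (H m has_real_derivative H (Suc m) t) (at t)"
  shows "Ck_on k p \<Omega> (\<lambda>x. H m (f x))"
  using assms(2)
proof (induction k arbitrary: m)
  case 0
  have "continuous_on J (H m)"
    by (meson DERIV_isCont H continuous_at_imp_continuous_on)
  then have "continuous_map (top_of_set J) euclideanreal (H m)" by simp
  moreover have "continuous_map (subtopology (Euclidean_space p) \<Omega>) (top_of_set J) f"
    using 0 assms(1,3) by (auto simp: continuous_map_in_subtopology)
  ultimately have "continuous_map (subtopology (Euclidean_space p) \<Omega>) euclideanreal (H m \<circ> f)"
    using continuous_map_compose by blast
  then show ?case by (simp add: comp_def)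
next
  case (Suc k)
  have d: "((\<lambda>t. H m (f (x(i := t)))) has_real_derivative H (Suc m) (f x) * partial i f x) (at (x i))"
    if "i < p" "x \<in> \<Omega>" for i x
  proof -
    have "((\<lambda>t. f (x(i := t))) has_real_derivative partial i f x) (at (x i))"
      using Suc.prems that by (auto simp: partial_def DERIV_deriv_iff_field_differentiable)
    moreover have "(H m has_real_derivative H (Suc m) (f x)) (at (f (x(i := x i))))"
      using H assms(3) that by auto
    ultimately show ?thesis
      using DERIV_chain2[of "H m" "H (Suc m) (f x)" "\<lambda>t. f (x(i := t))" "x i"] by simp
  qed
  have "partial i (\<lambda>x. H m (f x)) x = H (Suc m) (f x) * partial i f x" if "i < p" "x \<in> \<Omega>" for i x
    unfolding partial_def[of i "\<lambda>x. H m (f x)"] using d[OF that] by (rule DERIV_imp_deriv)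
  moreover have "Ck_on k p \<Omega> (\<lambda>x. H (Suc m) (f x) * partial i f x)" if "i < p" for i
    using Suc.prems that Ck_on_Suc_D by (intro Ck_on_mult[OF assms(1)] Suc.IH) auto
  ultimately have "Ck_on k p \<Omega> (partial i (\<lambda>x. H m (f x)))" if "i < p" for i
    using Ck_on_cong[OF assms(1), of "partial i (\<lambda>x. H m (f x))" "\<lambda>x. H (Suc m) (f x) * partial i f x" k] that by simp
  moreover have "Ck_on k p \<Omega> (\<lambda>x. H m (f x))"
    using Suc Ck_on_Suc_D by blast
  moreover have "(\<lambda>t. H m (f (x(i := t)))) field_differentiable at (x i)" if "i < p" "x \<in> \<Omega>" for i x
    using d[OF that] unfolding field_differentiable_def by blast
  ultimately show ?case using Ck_on_continuous by simp
qed

lemma smooth_on_compose: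
  assumes "openin (Euclidean_space p) \<Omega>" "smooth_on p \<Omega> f" "f ` \<Omega> \<subseteq> J"
    and "\<And>m t. t \<in> J \<Longrightarrow> (H m has_real_derivative H (Suc m) t) (at t)"
  shows "smooth_on p \<Omega> (\<lambda>x. H 0 (f x))"
proof -
  have "Ck_on k p \<Omega> (\<lambda>x. H 0 (f x))" for k
  proof (rule Ck_on_compose[where J = J and H = H and m = 0])
    show "Ck_on k p \<Omega> f" using assms(2) by (simp add: smooth_on_def)
  qed (fact assms)+
  then show ?thesis by (simp add: smooth_on_def)
qed

subsection \<open>A flat function\<close>

text \<open>The functions p(1/t) e^(-1/t), extended by 0, form a family that contains e^(-1/t) and
  is closed under differentiation. Carrying the polynomial along provides all derivatives at
  once.\<close>

definition flat :: "real poly \<Rightarrow> real \<Rightarrow> real" where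
  "flat p t = (if t > 0 then poly p (1 / t) * exp (- (1 / t)) else 0)"

lemma poly_exp_tendsto_0: "((\<lambda>s. poly p s * exp (- s)) \<longlongrightarrow> (0::real)) at_top"
proof -
  have "((\<lambda>s. coeff p i * (s ^ i / exp s)) \<longlongrightarrow> 0) at_top" for i
    using tendsto_mult_right_zero[OF tendsto_power_div_exp_0] .
  then have "((\<lambda>s. \<Sum>i\<le>degree p. coeff p i * (s ^ i / exp s)) \<longlongrightarrow> 0) at_top"
    by (intro tendsto_null_sum) auto
  then show ?thesis
    by (rule Lim_transform_eventually)
       (auto simp: poly_altdef sum_distrib_right exp_minus divide_inverse mult.assoc)
qed

text \<open>With s = 1/t one has d/dt = -s^2 d/ds, which turns p(s) e^(-s) into s^2 (p - p')(s)
  e^(-s); \<open>[:0, 0, 1:]\<close> is s^2. At 0 the difference quotient is examined from both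
  sides.\<close>

lemma flat_has_real_derivative:
  "(flat p has_real_derivative flat ([:0, 0, 1:] * (p - pderiv p)) t) (at t)"
proof -
  consider "t > 0" | "t < 0" | "t = 0" by linarith
  then show ?thesis
  proof cases
    case 1
    have *: "((\<lambda>t. poly p (1 / t) * exp (- (1 / t))) has_real_derivative
        flat ([:0, 0, 1:] * (p - pderiv p)) t) (at t)"
      using 1 by (auto intro!: derivative_eq_intros poly_DERIV[THEN DERIV_chain2]
          simp: flat_def field_simps power2_eq_square)
    have ev: "eventually (\<lambda>s. flat p s = poly p (1 / s) * exp (- (1 / s))) (nhds t)"
      using eventually_nhds_in_open[of "{0<..}" t] 1 by (auto simp: flat_def elim: eventually_mono)
    show ?thesis using * DERIV_cong_ev[OF refl ev refl] by blast
  next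
    case 2
    have ev: "eventually (\<lambda>s. flat p s = 0) (nhds t)"
      using eventually_nhds_in_open[of "{..<0}" t] 2 by (auto simp: flat_def elim: eventually_mono)
    have "flat ([:0, 0, 1:] * (p - pderiv p)) t = 0" using 2 by (simp add: flat_def)
    then show ?thesis using DERIV_cong_ev[OF refl ev refl] DERIV_const by metis
  next
    case 3
    have "((\<lambda>h. flat p h / h) \<longlongrightarrow> 0) (at_right 0)"
    proof -
      \<comment> \<open>Dividing by h multiplies by s = 1/h, and \<open>pCons 0 p\<close> is the
        polynomial s p(s).\<close>
      have "((\<lambda>h. poly (pCons 0 p) (inverse h) * exp (- (inverse h))) \<longlongrightarrow> 0) (at_right (0::real))"
        using filterlim_compose[OF poly_exp_tendsto_0 filterlim_inverse_at_top_right] .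
      then show ?thesis
        by (rule Lim_transform_eventually)
           (auto simp: eventually_at_right_less eventually_at_filter flat_def field_simps)
    qed
    moreover have "((\<lambda>h. flat p h / h) \<longlongrightarrow> 0) (at_left 0)"
      by (rule tendsto_eventually) (auto simp: eventually_at_filter flat_def)
    ultimately have "((\<lambda>h. flat p h / h) \<longlongrightarrow> 0) (at 0)"
      by (simp add: filterlim_split_at)
    then show ?thesis using 3 by (simp add: DERIV_def flat_def)
  qed
qed

fun flat_poly :: "nat \<Rightarrow> real poly" where
  "flat_poly 0 = 1"
| "flat_poly (Suc m) = [:0, 0, 1:] * (flat_poly m - pderiv (flat_poly m))"

text \<open>This is e^(-1/t) for positive t, as \<open>flat_poly 0\<close> is 1.\<close>

definition cutoff :: "real \<Rightarrow> real" where
  "cutoff = flat (flat_poly 0)"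

lemma cutoff_pos_iff: "cutoff t > 0 \<longleftrightarrow> t > 0" and cutoff_eq_0: "t \<le> 0 \<Longrightarrow> cutoff t = 0"
  and cutoff_nonneg: "cutoff t \<ge> 0"
  by (auto simp: cutoff_def flat_def)

lemma smooth_on_cutoff:
  assumes "openin (Euclidean_space p) \<Omega>" "smooth_on p \<Omega> f"
  shows "smooth_on p \<Omega> (\<lambda>x. cutoff (f x))"
  unfolding cutoff_def
  using smooth_on_compose[OF assms, of UNIV "\<lambda>m. flat (flat_poly m)"]
    flat_has_real_derivative by simp

lemma smooth_on_inverse:
  assumes "openin (Euclidean_space p) \<Omega>" "smooth_on p \<Omega> f" "\<And>x. x \<in> \<Omega> \<Longrightarrow> f x > 0"
  shows "smooth_on p \<Omega> (\<lambda>x. inverse (f x))"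
proof -
  \<comment> \<open>The m-th derivative of 1/t.\<close>
  let ?H = "\<lambda>m t::real. (- 1) ^ m * fact m * inverse t ^ Suc m"
  have "(?H m has_real_derivative ?H (Suc m) t) (at t)" if "t \<in> {0<..}" for m t
  proof -
    have "((\<lambda>t. inverse t ^ Suc m) has_real_derivative
        of_nat (Suc m) * (- (inverse t ^ Suc (Suc 0)) * inverse t ^ (Suc m - Suc 0))) (at t)"
      using that by (intro DERIV_power DERIV_inverse) auto
    from DERIV_cmult[OF this, of "(- 1) ^ m * fact m"] show ?thesis
      by (simp add: algebra_simps)
  qed
  then have "smooth_on p \<Omega> (\<lambda>x. ?H 0 (f x))"
    by (intro smooth_on_compose[where J = "{0<..}" and H = ?H, OF assms(1,2)]) (use assms(3) in auto)
  then show ?thesis by simp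
qed

subsection \<open>Smooth functions on a manifold\<close>

locale smooth_mfd =
  fixes M :: "'a mfd"
  assumes smooth_manifold: "smooth_manifold M"
begin

abbreviation X where "X \<equiv> mtop M"
abbreviation p where "p \<equiv> mdim M"

lemma chart_inj: "(W, \<phi>) \<in> charts M \<Longrightarrow> inj_on \<phi> W"
  and chart_open: "(W, \<phi>) \<in> charts M \<Longrightarrow> openin X W"
proof -
  assume *: "(W, \<phi>) \<in> charts M"
  then show "openin X W" using smooth_manifold unfolding smooth_manifold_def by auto
  from * obtain \<Omega> where \<Omega>: "homeomorphic_map (subtopology X W) (subtopology (Euclidean_space p) \<Omega>) \<phi>"
    using smooth_manifold unfolding smooth_manifold_def by blast
  with \<open>openin X W\<close> show "inj_on \<phi> W"
    by (metis homeomorphic_imp_injective_map openin_subset topspace_subtopology_subset)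
qed

text \<open>The rules for functions on Euclidean space hold on open sets; this lemma is what lets
  them be applied in every chart.\<close>

lemma chart_image_open:
  assumes "(W, \<phi>) \<in> charts M" "openin X U"
  shows "openin (Euclidean_space p) (\<phi> ` (U \<inter> W))"
proof -
  from assms obtain \<Omega> where \<Omega>: "openin (Euclidean_space p) \<Omega>"
     "homeomorphic_map (subtopology X W) (subtopology (Euclidean_space p) \<Omega>) \<phi>"
    using smooth_manifold unfolding smooth_manifold_def by blast
  have "openin (subtopology X W) (U \<inter> W)"
    using assms(2) by (auto simp: openin_subtopology)
  then have "openin (subtopology (Euclidean_space p) \<Omega>) (\<phi> ` (U \<inter> W))"
    using \<Omega>(2) by (meson homeomorphic_map_openness_eq)
  then show ?thesis using \<Omega>(1) openin_trans_full by blast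
qed

lemma smooth_fun_cong:
  assumes "openin X U" "\<And>x. x \<in> U \<Longrightarrow> f x = g x"
  shows "smooth_fun M U f \<longleftrightarrow> smooth_fun M U g"
proof -
  have "smooth_on p (\<phi> ` (U \<inter> W)) (\<lambda>y. f (inv_into W \<phi> y)) \<longleftrightarrow>
        smooth_on p (\<phi> ` (U \<inter> W)) (\<lambda>y. g (inv_into W \<phi> y))" if c: "(W, \<phi>) \<in> charts M" for W \<phi>
  proof -
    have "f (inv_into W \<phi> y) = g (inv_into W \<phi> y)" if "y \<in> \<phi> ` (U \<inter> W)" for y
      using that chart_inj[OF c] assms(2) by auto
    then show ?thesis
      unfolding smooth_on_def by (intro all_cong1 Ck_on_cong[OF chart_image_open[OF c assms(1)]])
  qed
  then show ?thesis unfolding smooth_fun_def by blast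
qed

lemma smooth_fun_mono:
  assumes "smooth_fun M U f" "V \<subseteq> U"
  shows "smooth_fun M V f"
  unfolding smooth_fun_def smooth_on_def
proof safe
  fix W \<phi> k assume c: "(W, \<phi>) \<in> charts M"
  have "\<phi> ` (V \<inter> W) \<subseteq> \<phi> ` (U \<inter> W)" using assms(2) by blast
  then show "Ck_on k p (\<phi> ` (V \<inter> W)) (\<lambda>y. f (inv_into W \<phi> y))"
    by (rule Ck_on_mono) (use assms(1) c in \<open>auto simp: smooth_fun_def smooth_on_def\<close>)
qed

lemma smooth_fun_local:
  assumes "openin X U" "\<And>x. x \<in> U \<Longrightarrow> \<exists>V. openin X V \<and> x \<in> V \<and> smooth_fun M (U \<inter> V) f"
  shows "smooth_fun M U f"
  unfolding smooth_fun_def smooth_on_def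
proof safe
  fix W \<phi> k assume c: "(W, \<phi>) \<in> charts M"
  show "Ck_on k p (\<phi> ` (U \<inter> W)) (\<lambda>y. f (inv_into W \<phi> y))"
  proof (rule Ck_on_local)
    fix y assume "y \<in> \<phi> ` (U \<inter> W)"
    then obtain x where x: "x \<in> U" "x \<in> W" "y = \<phi> x" by auto
    then obtain V where V: "openin X V" "x \<in> V" "smooth_fun M (U \<inter> V) f" using assms by blast
    have "\<phi> ` (U \<inter> W) \<inter> \<phi> ` (V \<inter> W) = \<phi> ` (U \<inter> V \<inter> W)"
      using chart_inj[OF c] by (auto simp: inj_on_def)
    then have "Ck_on k p (\<phi> ` (U \<inter> W) \<inter> \<phi> ` (V \<inter> W)) (\<lambda>y. f (inv_into W \<phi> y))"
      using V(3) c unfolding smooth_fun_def smooth_on_def by auto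
    then show "\<exists>V. openin (Euclidean_space p) V \<and> y \<in> V \<and>
            Ck_on k p (\<phi> ` (U \<inter> W) \<inter> V) (\<lambda>y. f (inv_into W \<phi> y))"
      using chart_image_open[OF c V(1)] x V(2) by blast
  qed
qed

lemma smooth_fun_const: "smooth_fun M U (\<lambda>_. c)"
  unfolding smooth_fun_def smooth_on_def using Ck_on_const by blast

lemma smooth_fun_add:
  assumes "openin X U" "smooth_fun M U f" "smooth_fun M U g"
  shows "smooth_fun M U (\<lambda>x. f x + g x)"
  unfolding smooth_fun_def smooth_on_def
proof safe
  fix W \<phi> k assume c: "(W, \<phi>) \<in> charts M"
  show "Ck_on k p (\<phi> ` (U \<inter> W)) (\<lambda>y. f (inv_into W \<phi> y) + g (inv_into W \<phi> y))"
    by (rule Ck_on_add[OF chart_image_open[OF c assms(1)]])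
      (use assms(2,3) c in \<open>auto simp: smooth_fun_def smooth_on_def\<close>)
qed

lemma smooth_fun_mult:
  assumes "openin X U" "smooth_fun M U f" "smooth_fun M U g"
  shows "smooth_fun M U (\<lambda>x. f x * g x)"
  unfolding smooth_fun_def smooth_on_def
proof safe
  fix W \<phi> k assume c: "(W, \<phi>) \<in> charts M"
  show "Ck_on k p (\<phi> ` (U \<inter> W)) (\<lambda>y. f (inv_into W \<phi> y) * g (inv_into W \<phi> y))"
    by (rule Ck_on_mult[OF chart_image_open[OF c assms(1)]])
      (use assms(2,3) c in \<open>auto simp: smooth_fun_def smooth_on_def\<close>)
qed

lemma smooth_fun_sum:
  assumes "openin X U" "\<And>i. i \<in> I \<Longrightarrow> smooth_fun M U (f i)"
  shows "smooth_fun M U (\<lambda>x. \<Sum>i\<in>I. f i x)"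
  using assms(2) by (induction I rule: infinite_finite_induct)
    (auto intro: smooth_fun_const smooth_fun_add[OF assms(1)])

lemma smooth_fun_prod:
  assumes "openin X U" "\<And>i. i \<in> I \<Longrightarrow> smooth_fun M U (f i)"
  shows "smooth_fun M U (\<lambda>x. \<Prod>i\<in>I. f i x)"
  using assms(2) by (induction I rule: infinite_finite_induct)
    (auto intro: smooth_fun_const smooth_fun_mult[OF assms(1)])

lemma smooth_fun_diff:
  assumes "openin X U" "smooth_fun M U f" "smooth_fun M U g"
  shows "smooth_fun M U (\<lambda>x. f x - g x)"
  using smooth_fun_add[OF assms(1,2) smooth_fun_mult[OF assms(1) smooth_fun_const[of U "-1"] assms(3)]]
  by simp

lemma smooth_fun_cutoff:
  assumes "openin X U" "smooth_fun M U f"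
  shows "smooth_fun M U (\<lambda>x. cutoff (f x))"
  unfolding smooth_fun_def
proof safe
  fix W \<phi> assume c: "(W, \<phi>) \<in> charts M"
  show "smooth_on p (\<phi> ` (U \<inter> W)) (\<lambda>y. cutoff (f (inv_into W \<phi> y)))"
    by (rule smooth_on_cutoff[OF chart_image_open[OF c assms(1)]])
      (use assms(2) c in \<open>auto simp: smooth_fun_def\<close>)
qed

lemma smooth_fun_inverse:
  assumes "openin X U" "smooth_fun M U f" "\<And>x. x \<in> U \<Longrightarrow> f x > 0"
  shows "smooth_fun M U (\<lambda>x. inverse (f x))"
  unfolding smooth_fun_def
proof safe
  fix W \<phi> assume c: "(W, \<phi>) \<in> charts M"
  show "smooth_on p (\<phi> ` (U \<inter> W)) (\<lambda>y. inverse (f (inv_into W \<phi> y)))"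
    by (rule smooth_on_inverse[OF chart_image_open[OF c assms(1)]])
      (use assms(2,3) c chart_inj[OF c] in \<open>auto simp: smooth_fun_def inv_into_f_f\<close>)
qed

lemma smooth_fun_coordinate:
  assumes "(W, \<phi>) \<in> charts M" "j < p"
  shows "smooth_fun M W (\<lambda>x. \<phi> x j)"
  unfolding smooth_fun_def
proof safe
  fix V \<psi> assume c: "(V, \<psi>) \<in> charts M"
  have "\<forall>(U, \<phi>)\<in>charts M. \<forall>(V, \<psi>)\<in>charts M. \<forall>j<mdim M.
        smooth_on (mdim M) (\<phi> ` (U \<inter> V)) (\<lambda>y. \<psi> (inv_into U \<phi> y) j)"
    using smooth_manifold unfolding smooth_manifold_def by blast
  from this[rule_format, OF c, unfolded split_conv, rule_format, OF assms(1), unfolded split_conv, rule_format, OF assms(2)]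
  show "smooth_on p (\<psi> ` (W \<inter> V)) (\<lambda>y. \<phi> (inv_into V \<psi> y) j)"
    by (simp add: Int_commute)
qed

lemma smooth_fun_continuous:
  assumes "openin X U" "smooth_fun M U f"
  shows "continuous_map (subtopology X U) euclideanreal f"
proof (rule continuous_map_local)
  fix x assume x: "x \<in> U"
  then have "x \<in> topspace X" using assms(1) openin_subset by blast
  then obtain W \<phi> where c: "(W, \<phi>) \<in> charts M" "x \<in> W"
    using smooth_manifold unfolding smooth_manifold_def by blast
  from c obtain \<Omega> where \<Omega>: "openin (Euclidean_space p) \<Omega>"
     "homeomorphic_map (subtopology X W) (subtopology (Euclidean_space p) \<Omega>) \<phi>"
    using smooth_manifold unfolding smooth_manifold_def by blast
  have "continuous_map (subtopology X (U \<inter> W)) (subtopology (Euclidean_space p) \<Omega>) \<phi>"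
    using homeomorphic_imp_continuous_map[OF \<Omega>(2)]
    by (simp add: continuous_map_from_subtopology_mono)
  then have "continuous_map (subtopology X (U \<inter> W)) (subtopology (Euclidean_space p) (\<phi> ` (U \<inter> W))) \<phi>"
    by (auto simp: continuous_map_in_subtopology)
  moreover have "continuous_map (subtopology (Euclidean_space p) (\<phi> ` (U \<inter> W))) euclideanreal
      (\<lambda>y. f (inv_into W \<phi> y))"
    using assms(2) c Ck_on_continuous unfolding smooth_fun_def smooth_on_def by blast
  ultimately have "continuous_map (subtopology X (U \<inter> W)) euclideanreal ((\<lambda>y. f (inv_into W \<phi> y)) \<circ> \<phi>)"
    by (rule continuous_map_compose)
  then have "continuous_map (subtopology X (U \<inter> W)) euclideanreal f"
    by (rule continuous_map_eq) (use chart_inj[OF c(1)] in auto)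
  then show "\<exists>V. openin X V \<and> x \<in> V \<and> continuous_map (subtopology X (U \<inter> V)) euclideanreal f"
    using c chart_open by blast
qed

end

section \<open>Compact boxes, bump functions and partitions of unity\<close>

lemma Euclidean_space_box:
  assumes "openin (Euclidean_space p) O'" "y0 \<in> O'"
  obtains r where "r > 0" "{y \<in> topspace (Euclidean_space p). \<forall>j<p. \<bar>y j - y0 j\<bar> \<le> r} \<subseteq> O'"
proof -
  obtain T where T: "openin (powertop_real UNIV) T" "O' = T \<inter> {x. \<forall>i\<ge>p. x i = 0}"
    using assms(1) by (auto simp: Euclidean_space_def openin_subtopology)
  obtain U where U: "\<And>i::nat. open (U i :: real set)" "y0 \<in> PiE UNIV U" "PiE UNIV U \<subseteq> T"
  proof -
    have "y0 \<in> T" using T(2) assms(2) by blast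
    with T(1) obtain U where U: "\<forall>i\<in>UNIV. openin euclideanreal (U i)" "y0 \<in> PiE UNIV U" "PiE UNIV U \<subseteq> T"
      unfolding openin_product_topology_alt by metis
    have "open (U i)" for i using U(1) by (metis UNIV_I open_openin)
    then show thesis using U(2,3) by (rule that)
  qed
  have "\<exists>e>0. cball (y0 i) e \<subseteq> U i" for i
    using U(1)[of i] U(2) open_contains_cball by blast
  then obtain e where e: "\<And>i. e i > 0" "\<And>i. cball (y0 i) (e i) \<subseteq> U i" by metis
  define r where "r = Min (insert 1 (e ` {..<p}))"
  have r: "r > 0" "\<And>i. i < p \<Longrightarrow> r \<le> e i"
    using e(1) by (auto simp: r_def)
  have "y \<in> O'" if y: "y \<in> topspace (Euclidean_space p)" "\<forall>j<p. \<bar>y j - y0 j\<bar> \<le> r" for y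
  proof -
    have "y i \<in> U i" for i
    proof (cases "i < p")
      case True
      then have "y i \<in> cball (y0 i) (e i)"
        using y(2) r(2)[OF True] by (force simp: dist_real_def)
      then show ?thesis using e(2) by blast
    next
      case False
      then have "y i = y0 i" using y(1) assms(2) T(2) by (auto simp: topspace_Euclidean_space)
      then show ?thesis using U(2) by auto
    qed
    then have "y \<in> T" using U(3) by auto
    then show ?thesis using y(1) T(2) by (auto simp: topspace_Euclidean_space)
  qed
  then show thesis using that[OF r(1)] by blast
qed

text \<open>The box is a product of compact intervals, with the one-point factor {0} from index p
  on, so it is compact in the product of all the real lines.\<close>

lemma compactin_Euclidean_space_box:
  assumes "y0 \<in> topspace (Euclidean_space p)"
  shows "compactin (Euclidean_space p) {y \<in> topspace (Euclidean_space p). \<forall>j<p. \<bar>y j - y0 j\<bar> \<le> r}"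
proof -
  let ?S = "\<lambda>i. if i < p then {y0 i - r..y0 i + r} else {0::real}"
  have eq: "{y \<in> topspace (Euclidean_space p). \<forall>j<p. \<bar>y j - y0 j\<bar> \<le> r} = PiE UNIV ?S"
  proof -
    have "(\<bar>y j - y0 j\<bar> \<le> r) \<longleftrightarrow> y j \<in> {y0 j - r..y0 j + r}" for y j
      by (auto simp: abs_le_iff)
    then have "y \<in> topspace (Euclidean_space p) \<and> (\<forall>j<p. \<bar>y j - y0 j\<bar> \<le> r) \<longleftrightarrow> (\<forall>i. y i \<in> ?S i)" for y
      by (simp add: topspace_Euclidean_space) (metis linorder_not_le)
    then show ?thesis by (auto simp: PiE_def Pi_def extensional_def)
  qed
  have "compactin (powertop_real UNIV) (PiE UNIV ?S)"
    unfolding compactin_PiE by (simp add: compactin_euclidean_iff)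
  moreover have "PiE UNIV ?S \<subseteq> {x. \<forall>i\<ge>p. x i = 0}"
    unfolding eq[symmetric] topspace_Euclidean_space by blast
  ultimately show ?thesis
    unfolding eq unfolding Euclidean_space_def compactin_subtopology by blast
qed

context smooth_mfd
begin

text \<open>A product of cutoffs in chart coordinates vanishes outside a box that is compact in the
  chart. Since X is Hausdorff, the box is closed in all of X, not merely in the chart; hence its
  complement is open, and extension by zero is smooth on the two open sets \<open>W\<close> and the
  complement, which cover X.\<close>

lemma bump_function:
  assumes U: "openin X U" "x \<in> U"
  obtains b K where "smooth_fun M (topspace X) b" "closedin X K" "K \<subseteq> U" "b x > 0"
    "\<And>y. y \<notin> K \<Longrightarrow> b y = 0" "\<And>y. b y \<ge> 0"
proof -
  have "x \<in> topspace X" using U openin_subset by blast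
  then obtain W \<phi> where c: "(W, \<phi>) \<in> charts M" "x \<in> W"
    using smooth_manifold unfolding smooth_manifold_def by blast
  from c obtain \<Omega> where \<Omega>: "openin (Euclidean_space p) \<Omega>"
     "homeomorphic_map (subtopology X W) (subtopology (Euclidean_space p) \<Omega>) \<phi>"
    using smooth_manifold unfolding smooth_manifold_def by blast
  have W: "openin X W" using c chart_open by blast
  have spW: "topspace (subtopology X W) = W"
    by (rule topspace_subtopology_subset[OF openin_subset[OF W]])
  have sp\<Omega>: "topspace (subtopology (Euclidean_space p) \<Omega>) = \<Omega>"
    by (rule topspace_subtopology_subset[OF openin_subset[OF \<Omega>(1)]])
  have im: "\<phi> ` W = \<Omega>"
    using homeomorphic_imp_surjective_map[OF \<Omega>(2)] unfolding spW sp\<Omega> .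
  have O': "openin (Euclidean_space p) (\<phi> ` (U \<inter> W))" "\<phi> x \<in> \<phi> ` (U \<inter> W)"
    using chart_image_open[OF c(1) U(1)] U c by auto
  obtain r where r: "r > 0"
    "{y \<in> topspace (Euclidean_space p). \<forall>j<p. \<bar>y j - \<phi> x j\<bar> \<le> r} \<subseteq> \<phi> ` (U \<inter> W)"
    by (rule Euclidean_space_box[OF O'])
  let ?B = "{y \<in> topspace (Euclidean_space p). \<forall>j<p. \<bar>y j - \<phi> x j\<bar> \<le> r}"
  have x': "\<phi> x \<in> topspace (Euclidean_space p)" using O' openin_subset by blast
  obtain \<psi> where \<psi>: "homeomorphic_maps (subtopology X W) (subtopology (Euclidean_space p) \<Omega>) \<phi> \<psi>"
    using \<Omega>(2) homeomorphic_map_maps by blast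
  have B\<Omega>: "?B \<subseteq> \<Omega>" using r(2) im by blast
  have "compactin (subtopology (Euclidean_space p) \<Omega>) ?B"
    using compactin_Euclidean_space_box[OF x'] B\<Omega> by (simp add: compactin_subtopology)
  then have "compactin (subtopology X W) (\<psi> ` ?B)"
    using \<psi> image_compactin unfolding homeomorphic_maps_def by blast
  then have "compactin X (\<psi> ` ?B)" by (simp add: compactin_subtopology)
  then have K: "closedin X (\<psi> ` ?B)"
    using smooth_manifold compactin_imp_closedin unfolding smooth_manifold_def by blast
  have \<psi>\<phi>: "\<And>z. z \<in> W \<Longrightarrow> \<psi> (\<phi> z) = z" "\<And>y. y \<in> \<Omega> \<Longrightarrow> \<phi> (\<psi> y) = y"
    using \<psi> unfolding homeomorphic_maps_def spW sp\<Omega> by auto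
  have KU: "\<psi> ` ?B \<subseteq> U \<inter> W"
  proof
    fix z assume "z \<in> \<psi> ` ?B"
    then obtain y where y: "y \<in> ?B" "z = \<psi> y" by blast
    then obtain u where u: "u \<in> U \<inter> W" "y = \<phi> u" using r(2) by blast
    then show "z \<in> U \<inter> W" using y(2) \<psi>\<phi>(1)[of u] by simp
  qed
  \<comment> \<open>A factor is positive exactly where the coordinate differs from that of x by less
    than r; at x every factor is \<open>cutoff\<close> of r^2.\<close>
  define b where "b z = (if z \<in> W then \<Prod>j<p. cutoff (r\<^sup>2 - (\<phi> z j - \<phi> x j) * (\<phi> z j - \<phi> x j)) else 0)" for z
  have b0: "b z = 0" if "z \<notin> \<psi> ` ?B" for z
  proof (cases "z \<in> W")
    case True
    then have "\<phi> z \<notin> ?B" using that \<psi>\<phi> by (metis (no_types, lifting) image_eqI)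
    moreover have "\<phi> z \<in> topspace (Euclidean_space p)"
      using True im \<Omega>(1) openin_subset by blast
    ultimately obtain j where j: "j < p" "\<bar>\<phi> z j - \<phi> x j\<bar> > r" by auto
    then have "r\<^sup>2 < (\<phi> z j - \<phi> x j) * (\<phi> z j - \<phi> x j)"
      using r(1) by (metis abs_of_nonneg less_eq_real_def power2_abs power2_eq_square power_strict_mono zero_less_numeral)
    then have "cutoff (r\<^sup>2 - (\<phi> z j - \<phi> x j) * (\<phi> z j - \<phi> x j)) = 0"
      by (intro cutoff_eq_0) auto
    then show ?thesis using True j(1) by (auto simp: b_def intro: prod_zero)
  qed (simp add: b_def)
  have "smooth_fun M W (\<lambda>z. \<phi> z j - \<phi> x j)" if "j < p" for j
    by (intro smooth_fun_diff[OF W] smooth_fun_coordinate[OF c(1) that] smooth_fun_const)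
  then have "smooth_fun M W (\<lambda>z. (\<phi> z j - \<phi> x j) * (\<phi> z j - \<phi> x j))" if "j < p" for j
    using that by (intro smooth_fun_mult[OF W])
  then have "smooth_fun M W (\<lambda>z. r\<^sup>2 - (\<phi> z j - \<phi> x j) * (\<phi> z j - \<phi> x j))" if "j < p" for j
    using that by (intro smooth_fun_diff[OF W] smooth_fun_const)
  then have "smooth_fun M W (\<lambda>z. \<Prod>j<p. cutoff (r\<^sup>2 - (\<phi> z j - \<phi> x j) * (\<phi> z j - \<phi> x j)))"
    by (intro smooth_fun_prod[OF W] smooth_fun_cutoff[OF W]) auto
  then have bW: "smooth_fun M W b"
    using smooth_fun_cong[OF W, of b] by (simp add: b_def)
  have oK: "openin X (topspace X - \<psi> ` ?B)" using K by auto
  have "smooth_fun M (topspace X - \<psi> ` ?B) b \<longleftrightarrow> smooth_fun M (topspace X - \<psi> ` ?B) (\<lambda>_. 0)"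
    by (rule smooth_fun_cong[OF oK]) (use b0 in auto)
  then have bK: "smooth_fun M (topspace X - \<psi> ` ?B) b" using smooth_fun_const by blast
  have "smooth_fun M (topspace X) b"
  proof (rule smooth_fun_local[OF openin_topspace])
    fix y assume y: "y \<in> topspace X"
    have W': "topspace X \<inter> W = W" using W openin_subset by blast
    have K': "topspace X \<inter> (topspace X - \<psi> ` ?B) = topspace X - \<psi> ` ?B" by blast
    show "\<exists>V. openin X V \<and> y \<in> V \<and> smooth_fun M (topspace X \<inter> V) b"
    proof (cases "y \<in> W")
      case True
      then show ?thesis using W bW by (intro exI[of _ W]) (simp add: W')
    next
      case False
      then have "y \<in> topspace X - \<psi> ` ?B" using y KU by blast
      then show ?thesis using oK bK by (intro exI[of _ "topspace X - \<psi> ` ?B"]) (simp only: K' simp_thms)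
    qed
  qed
  moreover have "b x > 0"
    using c(2) r(1) by (auto simp: b_def cutoff_pos_iff intro!: prod_pos)
  moreover have "b y \<ge> 0" for y
    by (auto simp: b_def cutoff_nonneg intro!: prod_nonneg)
  ultimately show thesis using that K KU b0 by blast
qed

text \<open>A second countable space is Lindelof, so countably many of the sets where a bump is
  positive cover X. The condition \<open>P {}\<close> allows a dummy member, with empty
  \<open>U\<close> and \<open>K\<close> and zero bump, so that the family can be enumerated by the
  natural numbers even if X is empty.\<close>

lemma bump_cover:
  assumes "\<And>x. x \<in> topspace X \<Longrightarrow> \<exists>U. openin X U \<and> x \<in> U \<and> P U" "P {}"
  obtains U K :: "nat \<Rightarrow> 'a set" and b :: "nat \<Rightarrow> 'a \<Rightarrow> real" where
    "\<And>m. openin X (U m)" "\<And>m. P (U m)" "\<And>m. closedin X (K m)" "\<And>m. K m \<subseteq> U m"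
    "\<And>m. smooth_fun M (topspace X) (b m)" "\<And>m x. b m x \<ge> 0" "\<And>m x. x \<notin> K m \<Longrightarrow> b m x = 0"
    "\<And>x. x \<in> topspace X \<Longrightarrow> \<exists>m. b m x > 0"
proof -
  define Q where "Q = (\<lambda>(U, K, b). openin X U \<and> P U \<and> closedin X K \<and> K \<subseteq> U \<and>
     smooth_fun M (topspace X) b \<and> (\<forall>x. b x \<ge> 0) \<and> (\<forall>x. x \<notin> K \<longrightarrow> b x = 0))"
  have "\<exists>t. Q t \<and> snd (snd t) x > 0" if x: "x \<in> topspace X" for x
  proof -
    obtain U where U: "openin X U" "x \<in> U" "P U" using assms(1)[OF x] by (elim exE conjE)
    obtain b K where "smooth_fun M (topspace X) b" "closedin X K" "K \<subseteq> U" "b x > 0"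
      "\<And>y. y \<notin> K \<Longrightarrow> b y = 0" "\<And>y. b y \<ge> 0" 
      by (rule bump_function[OF U(1,2)]) (rule that, assumption+)
    then show ?thesis using U by (intro exI[of _ "(U, K, b)"]) (auto simp: Q_def)
  qed
  then obtain t where t: "\<And>x. x \<in> topspace X \<Longrightarrow> Q (t x) \<and> snd (snd (t x)) x > 0" by metis
  define pos where "pos b = {y \<in> topspace X. b y > (0::real)}" for b
  have opn: "openin X (pos (snd (snd s)))" if "Q s" for s
  proof -
    have "continuous_map X euclideanreal (snd (snd s))"
      using that smooth_fun_continuous[OF openin_topspace] by (auto simp: Q_def)
    from openin_continuous_map_preimage[OF this, of "{0<..}"] show ?thesis
      by (simp add: pos_def)
  qed
  have "Lindelof_space X"
    using smooth_manifold second_countable_imp_Lindelof_space unfolding smooth_manifold_def by blast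
  moreover have "\<Union>((\<lambda>x. pos (snd (snd (t x)))) ` topspace X) = topspace X"
    using t by (auto simp: pos_def)
  ultimately obtain V where V: "countable V" "V \<subseteq> (\<lambda>x. pos (snd (snd (t x)))) ` topspace X" "\<Union>V = topspace X"
    unfolding Lindelof_space_def using opn t by (smt (verit, ccfv_SIG) imageE)
  obtain C where C: "countable C" "C \<subseteq> topspace X" "V = (\<lambda>x. pos (snd (snd (t x)))) ` C"
    using V(1,2) by (meson countable_subset_image)
  \<comment> \<open>The dummy member; it makes the set to be enumerated nonempty.\<close>
  define t0 where "t0 = ({} :: 'a set, {} :: 'a set, \<lambda>_::'a. 0::real)"
  have "Q t0" using assms(2) by (auto simp: Q_def t0_def smooth_fun_const)
  define D where "D = insert t0 (t ` C)"
  have D: "countable D" "D \<noteq> {}" "\<And>s. s \<in> D \<Longrightarrow> Q s"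
    using C t \<open>Q t0\<close> by (auto simp: D_def)
  define s where "s = from_nat_into D"
  have rs: "range s = D" unfolding s_def by (rule range_from_nat_into[OF D(2,1)])
  have Qs: "Q (s m)" for m 
  proof -
    have "s m \<in> D" using rs by blast
    then show ?thesis by (rule D(3))
  qed
  have "\<exists>m. snd (snd (s m)) x > 0" if x: "x \<in> topspace X" for x
  proof -
    obtain z where "z \<in> C" "x \<in> pos (snd (snd (t z)))" using x V(3) C(3) by blast
    moreover obtain m where "s m = t z" using rs \<open>z \<in> C\<close> unfolding D_def by (metis imageI insertCI rangeE)
    ultimately show ?thesis by (auto simp: pos_def intro!: exI[of _ m])
  qed
  then show thesis
    using Qs by (intro that[of "\<lambda>m. fst (s m)" "\<lambda>m. fst (snd (s m))" "\<lambda>m. snd (snd (s m))"])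
      (auto simp: Q_def case_prod_unfold)
qed

text \<open>No exhaustion by compact sets is needed for local finiteness: where \<open>b l > 0\<close>, the factor
  \<open>cutoff (1 / (m + 1) - b l)\<close> of \<open>\<sigma> m\<close> vanishes for all large \<open>m\<close>.\<close>

lemma partition_of_unity:
  assumes "\<And>x. x \<in> topspace X \<Longrightarrow> \<exists>U. openin X U \<and> x \<in> U \<and> P U" "P {}"
  obtains U :: "nat \<Rightarrow> 'a set" and \<rho> :: "nat \<Rightarrow> 'a \<Rightarrow> real" where
    "\<And>m. openin X (U m)" "\<And>m. P (U m)" "\<And>m. smooth_fun M (topspace X) (\<rho> m)"
    "\<And>x. x \<in> topspace X \<Longrightarrow> \<exists>N F. openin X N \<and> x \<in> N \<and> finite F \<and>
       (\<forall>m\<in>F. N \<subseteq> U m) \<and> (\<forall>m. m \<notin> F \<longrightarrow> (\<forall>y\<in>N. \<rho> m y = 0)) \<and> (\<forall>y\<in>N. (\<Sum>m\<in>F. \<rho> m y) = 1)"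
proof -
  obtain U K :: "nat \<Rightarrow> 'a set" and b :: "nat \<Rightarrow> 'a \<Rightarrow> real" where
    U: "\<And>m. openin X (U m)" "\<And>m. P (U m)" and K: "\<And>m. closedin X (K m)" "\<And>m. K m \<subseteq> U m"
    and b: "\<And>m. smooth_fun M (topspace X) (b m)" "\<And>m x. b m x \<ge> 0" "\<And>m x. x \<notin> K m \<Longrightarrow> b m x = 0"
    and cov: "\<And>x. x \<in> topspace X \<Longrightarrow> \<exists>m. b m x > 0"
    by (rule bump_cover[of P, OF assms]) (assumption, rule that, assumption+)
  define \<sigma> where "\<sigma> m x = b m x * (\<Prod>l<m. cutoff (1 / (real m + 1) - b l x))" for m x
  have \<sigma>s: "smooth_fun M (topspace X) (\<sigma> m)" for m
    unfolding \<sigma>_def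
    by (intro smooth_fun_mult smooth_fun_prod smooth_fun_cutoff smooth_fun_diff smooth_fun_const
        openin_topspace b)
  have \<sigma>0: "\<sigma> m x \<ge> 0" for m x
    by (auto simp: \<sigma>_def b cutoff_nonneg intro!: mult_nonneg_nonneg prod_nonneg)
  have \<sigma>K: "\<sigma> m x = 0" if "x \<notin> K m" for m x
    using b(3)[OF that] by (simp add: \<sigma>_def)
  have \<sigma>pos: "\<exists>m. \<sigma> m x > 0" if "x \<in> topspace X" for x
  proof -
    \<comment> \<open>For the first bump that is positive at x all earlier ones vanish there, so the
      cutoff factors of \<open>\<sigma> m\<close> are \<open>cutoff\<close> of a positive
      number.\<close>
    define m where "m = (LEAST m. b m x > 0)"
    have "b m x > 0" unfolding m_def using cov[OF that] by (rule LeastI_ex)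
    moreover have "b l x = 0" if "l < m" for l
      using not_less_Least[of l "\<lambda>m. b m x > 0"] that b(2)[of l x] unfolding m_def by auto
    ultimately have "\<sigma> m x > 0"
      by (auto simp: \<sigma>_def cutoff_pos_iff intro!: mult_pos_pos prod_pos)
    then show ?thesis by blast
  qed
  have loc: "\<exists>N F. openin X N \<and> x \<in> N \<and> finite F \<and> (\<forall>m\<in>F. N \<subseteq> U m) \<and> (\<forall>m. m \<notin> F \<longrightarrow> (\<forall>y\<in>N. \<sigma> m y = 0))"
    if x: "x \<in> topspace X" for x
  proof -
    obtain l where l: "b l x > 0" using cov x by blast
    \<comment> \<open>For m beyond both l and k the factor with index l occurs in
      \<open>\<sigma> m\<close>, and its argument is negative wherever \<open>b l\<close> exceeds
      1/(k+1).\<close>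
    then obtain k where k: "1 / (real k + 1) < b l x"
      by (metis of_nat_Suc add.commute reals_Archimedean inverse_eq_divide)
    define N1 where "N1 = {y \<in> topspace X. b l y \<in> {1 / (real k + 1)<..}}"
    have "continuous_map X euclideanreal (b l)"
      using smooth_fun_continuous[OF openin_topspace b(1)] by simp
    then have N1: "openin X N1" unfolding N1_def by (rule openin_continuous_map_preimage) simp
    define k' where "k' = max l k"
    define F where "F = {m. m \<le> k' \<and> x \<in> K m}"
    define G where "G = {m. m \<le> k' \<and> x \<notin> K m}"
    \<comment> \<open>Only the finitely many indices up to \<open>k'\<close> remain on
      \<open>N1\<close>. Those with x outside \<open>K m\<close> are disposed of by removing the
      closed set \<open>K m\<close> from the neighbourhood; for the others x lies in
      \<open>U m\<close>, and the neighbourhood is shrunk into it.\<close>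
    define N where "N = N1 \<inter> (\<Inter>m\<in>F. U m) \<inter> (topspace X - (\<Union>m\<in>G. K m))"
    have fin: "finite F" "finite G" by (auto simp: F_def G_def)
    have "closedin X (\<Union>m\<in>G. K m)" using fin K by (intro closedin_Union) auto
    then have oG: "openin X (topspace X - (\<Union>m\<in>G. K m))" by blast
    have "openin X N"
    proof (cases "F = {}")
      case True
      then show ?thesis unfolding N_def using oG N1 by auto
    next
      case False
      then show ?thesis unfolding N_def using oG N1 U fin by (intro openin_Int openin_INT) auto
    qed
    moreover have "x \<in> N"
      using x k K(2) by (auto simp: N_def N1_def F_def G_def)
    moreover have "\<sigma> m y = 0" if "m \<notin> F" "y \<in> N" for m y
    proof (cases "m \<le> k'")
      case True
      then have "m \<in> G" using that by (auto simp: F_def G_def)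
      then have "y \<notin> K m" using that by (auto simp: N_def)
      then show ?thesis by (rule \<sigma>K)
    next
      case False
      then have m: "l < m" "k \<le> m" by (auto simp: k'_def)
      have "b l y > 1 / (real k + 1)" using that by (auto simp: N_def N1_def)
      moreover have "1 / (real m + 1) \<le> 1 / (real k + 1)" using m by (auto simp: field_simps)
      ultimately have "cutoff (1 / (real m + 1) - b l y) = 0" by (intro cutoff_eq_0) auto
      then show ?thesis using m by (auto simp: \<sigma>_def intro: prod_zero)
    qed
    ultimately show ?thesis using fin by (intro exI[of _ N] exI[of _ F]) (auto simp: N_def)
  qed
  \<comment> \<open>The total of all \<open>\<sigma> m\<close>, written as a sum over the support,
    which is finite at every point of X; dividing by it normalizes the sum to 1.\<close>
  define R where "R x = (\<Sum>m\<in>{m. \<sigma> m x \<noteq> 0}. \<sigma> m x)" for x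
  have R: "R y = (\<Sum>m\<in>F. \<sigma> m y)" if "finite F" "\<And>m. m \<notin> F \<Longrightarrow> \<sigma> m y = 0" for y F
    unfolding R_def using that by (intro sum.mono_neutral_left) auto
  have Rpos: "R x > 0" if x: "x \<in> topspace X" for x
  proof -
    obtain N F where NF: "x \<in> N" "finite F" "\<And>m. m \<notin> F \<Longrightarrow> (\<forall>y\<in>N. \<sigma> m y = 0)" using loc[OF x] by blast
    obtain m where m: "\<sigma> m x > 0" using \<sigma>pos[OF x] by blast
    have "m \<in> F" using NF m by force
    then have "(\<Sum>m\<in>F. \<sigma> m x) > 0" using m NF \<sigma>0 by (intro sum_pos2[of _ m]) auto
    then show ?thesis using R[of F x] NF by auto
  qed
  have Rs: "smooth_fun M (topspace X) R"
  proof (rule smooth_fun_local[OF openin_topspace])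
    fix x assume x: "x \<in> topspace X"
    obtain N F where NF: "openin X N" "x \<in> N" "finite F" "\<And>m. m \<notin> F \<Longrightarrow> (\<forall>y\<in>N. \<sigma> m y = 0)"
      using loc[OF x] by blast
    have N: "topspace X \<inter> N = N" using NF openin_subset by blast
    have "smooth_fun M N (\<lambda>y. \<Sum>m\<in>F. \<sigma> m y)"
      using NF(1) openin_subset by (intro smooth_fun_sum[OF NF(1)] smooth_fun_mono[OF \<sigma>s]) auto
    then have "smooth_fun M N R"
      using smooth_fun_cong[OF NF(1), of R "\<lambda>y. \<Sum>m\<in>F. \<sigma> m y"] R[OF NF(3)] NF(4) by blast
    then show "\<exists>V. openin X V \<and> x \<in> V \<and> smooth_fun M (topspace X \<inter> V) R"
      using NF N by metis
  qed
  show thesis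
  proof (rule that[of U "\<lambda>m x. \<sigma> m x * inverse (R x)"])
    show "smooth_fun M (topspace X) (\<lambda>x. \<sigma> m x * inverse (R x))" for m
      by (intro smooth_fun_mult smooth_fun_inverse openin_topspace \<sigma>s Rs Rpos)
    fix x assume x: "x \<in> topspace X"
    obtain N F where NF: "openin X N" "x \<in> N" "finite F" "\<forall>m\<in>F. N \<subseteq> U m" "\<And>m. m \<notin> F \<Longrightarrow> (\<forall>y\<in>N. \<sigma> m y = 0)"
      using loc[OF x] by blast
    have "(\<Sum>m\<in>F. \<sigma> m y * inverse (R y)) = 1" if "y \<in> N" for y
    proof -
      have "y \<in> topspace X" using that NF openin_subset by blast
      then have "R y > 0" by (rule Rpos)
      then show ?thesis using R[of F y] NF(3,5) that by (auto simp flip: sum_distrib_right)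
    qed
    then show "\<exists>N F. openin X N \<and> x \<in> N \<and> finite F \<and> (\<forall>m\<in>F. N \<subseteq> U m) \<and>
       (\<forall>m. m \<notin> F \<longrightarrow> (\<forall>y\<in>N. \<sigma> m y * inverse (R y) = 0)) \<and> (\<forall>y\<in>N. (\<Sum>m\<in>F. \<sigma> m y * inverse (R y)) = 1)"
      using NF by (intro exI[of _ N] exI[of _ F]) auto
  qed (use U in auto)
qed

end

section \<open>Words and normal forms\<close>

abbreviation wdeg :: "(nat \<times> 'b) list \<Rightarrow> nat" where
  "wdeg w \<equiv> sum_list (map fst w)"

definition gens :: "nat \<Rightarrow> (nat \<Rightarrow> nat) \<Rightarrow> (nat \<times> nat) set" where
  "gens n q = {(i, j). i \<in> {1..n} \<and> j < q i}"

abbreviation gen_le :: "nat \<times> nat \<Rightarrow> nat \<times> nat \<Rightarrow> bool" where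
  "gen_le \<equiv> \<lambda>(i, j) (i', j'). i < i' \<or> i = i' \<and> (j < j' \<or> j = j' \<and> even i)"

lemma gmonomials_alt:
  "gmonomials n q k = {w. set w \<subseteq> gens n q \<and> sorted_wrt gen_le w \<and> wdeg w = k}"
  unfolding gmonomials_def gens_def by (auto simp: in_lists_conv_set)

lemma finite_gens: "finite (gens n q)"
proof -
  have "gens n q = (SIGMA i:{1..n}. {..<q i})" by (auto simp: gens_def)
  then show ?thesis by simp
qed

text \<open>All generators have degree at least 1. This bounds the length of words of a given
  degree, which makes the monomials of that degree finite in number.\<close>

lemma length_le_wdeg: "set w \<subseteq> gens n q \<Longrightarrow> length w \<le> wdeg w"
  by (induction w) (auto simp: gens_def)

lemma finite_gmonomials [simp]: "finite (gmonomials n q k)"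
proof (rule finite_subset)
  show "gmonomials n q k \<subseteq> {w. set w \<subseteq> gens n q \<and> length w \<le> k}"
    unfolding gmonomials_alt using length_le_wdeg by blast
qed (rule finite_lists_length_le[OF finite_gens])

lemma gmonomialsD: "w \<in> gmonomials n q k \<Longrightarrow> set w \<subseteq> gens n q" "w \<in> gmonomials n q k \<Longrightarrow> wdeg w = k"
  by (auto simp: gmonomials_alt)

lemma gmonomials_Cons: "(i, j) # w \<in> gmonomials n q k \<Longrightarrow> w \<in> gmonomials n q (k - i)"
  by (auto simp: gmonomials_alt)

lemma gmonomials_0: "gmonomials n q 0 = {[]}"
proof -
  have "w = []" if "w \<in> gmonomials n q 0" for w
    using that by (cases w) (auto simp: gmonomials_alt gens_def)
  moreover have "[] \<in> gmonomials n q 0" by (simp add: gmonomials_alt)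
  ultimately show ?thesis by blast
qed

lemma gmonomials_singleton: "i \<in> {1..n} \<Longrightarrow> j < q i \<Longrightarrow> [(i, j)] \<in> gmonomials n q i"
  by (auto simp: gmonomials_alt gens_def)

text \<open>The dichotomy on which the arguments about linear parts rest: a monomial of positive
  degree is a single generator, or a generator times a monomial, both of strictly smaller
  degree.\<close>

lemma gmonomials_cases:
  assumes "w \<in> gmonomials n q i" "i \<ge> 1"
  obtains j where "w = [(i, j)]" "i \<in> {1..n}" "j < q i"
  | i' j' w' where "w = (i', j') # w'" "w' \<noteq> []" "i' \<in> {1..n}" "j' < q i'" "i' < i"
      "w' \<in> gmonomials n q (i - i')"
proof (cases w)
  case Nil
  then show ?thesis using assms by (auto simp: gmonomials_alt)
next
  case (Cons x w')
  obtain i' j' where x: "x = (i', j')" by fastforce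
  have w': "w' \<in> gmonomials n q (i - i')" using assms(1) unfolding Cons x by (rule gmonomials_Cons)
  have i': "i' \<in> {1..n}" "j' < q i'" "i' + wdeg w' = i"
    using assms(1) unfolding Cons x by (auto simp: gmonomials_alt gens_def)
  show ?thesis
  proof (cases "w' = []")
    case True
    then show ?thesis using that(1)[of j'] i' Cons x by auto
  next
    case False
    then have "wdeg w' \<ge> 1" using length_le_wdeg[of w' n q] gmonomialsD(1)[OF w'] by (cases w') auto
    then show ?thesis using that(2)[OF _ False] i' w' Cons x by auto
  qed
qed

text \<open>\<open>E\<close> evaluates words in a vector space in which neighbouring letters commute
  with the graded sign up to an error in \<open>S\<close>. The two uses are words in dual
  coordinates modulo the ideal of the symmetric algebra, and coefficients of products of sections
  with \<open>S\<close> equal to {0}.\<close>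

definition gcommuting ::
  "nat \<Rightarrow> (nat \<Rightarrow> nat) \<Rightarrow> 'v::real_vector set \<Rightarrow> ((nat \<times> nat) list \<Rightarrow> 'v) \<Rightarrow> bool" where
  "gcommuting n q S E \<longleftrightarrow> subspace S \<and> (\<forall>u v i j i' j'. set (u @ [(i, j), (i', j')] @ v) \<subseteq> gens n q \<longrightarrow>
     E (u @ [(i, j), (i', j')] @ v) - (- 1) ^ (i * i') *\<^sub>R E (u @ [(i', j'), (i, j)] @ v) \<in> S)"

text \<open>Quantifying over all evaluations makes \<open>c\<close> and \<open>v\<close> depend on
  the word alone. The evaluations range over a single type of values, which the first argument
  fixes.\<close>

definition reduces_to ::
  "'v::real_vector itself \<Rightarrow> nat \<Rightarrow> (nat \<Rightarrow> nat) \<Rightarrow> (nat \<times> nat) list \<Rightarrow> real \<Rightarrow> (nat \<times> nat) list \<Rightarrow> bool" where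
  "reduces_to _ n q u c v \<longleftrightarrow> (\<forall>S (E :: _ \<Rightarrow> 'v). gcommuting n q S E \<longrightarrow> E u - c *\<^sub>R E v \<in> S)"

lemma reduces_to_refl: "reduces_to T n q u 1 u"
  by (auto simp: reduces_to_def gcommuting_def subspace_0)

lemma reduces_to_trans:
  assumes "reduces_to T n q u c v" "reduces_to T n q v d w"
  shows "reduces_to T n q u (c * d) w"
  unfolding reduces_to_def
proof (intro allI impI)
  fix S and E :: "_ \<Rightarrow> 'a" assume E: "gcommuting n q S E"
  then have S: "subspace S" by (simp add: gcommuting_def)
  have "E u - c *\<^sub>R E v \<in> S" "E v - d *\<^sub>R E w \<in> S" using assms E by (auto simp: reduces_to_def)
  then have "(E u - c *\<^sub>R E v) + c *\<^sub>R (E v - d *\<^sub>R E w) \<in> S"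
    using S by (intro subspace_add subspace_scale)
  then show "E u - (c * d) *\<^sub>R E w \<in> S" by (simp add: algebra_simps)
qed

text \<open>Prefixing a letter y to all words turns an evaluation into another graded commuting one,
  to which the hypothesis applies.\<close>

lemma reduces_to_Cons:
  assumes "reduces_to T n q u c v" "y \<in> gens n q"
  shows "reduces_to T n q (y # u) c (y # v)"
  unfolding reduces_to_def
proof (intro allI impI)
  fix S and E :: "_ \<Rightarrow> 'a" assume E: "gcommuting n q S E"
  have "E ((y # u) @ [(i, j), (i', j')] @ v) - (- 1) ^ (i * i') *\<^sub>R E ((y # u) @ [(i', j'), (i, j)] @ v) \<in> S"
    if "set (u @ [(i, j), (i', j')] @ v) \<subseteq> gens n q" for u v i j i' j'
  proof -
    have "set ((y # u) @ [(i, j), (i', j')] @ v) \<subseteq> gens n q" using that assms(2) by auto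
    then show ?thesis using E unfolding gcommuting_def by blast
  qed
  then have "gcommuting n q S (\<lambda>w. E (y # w))"
    using E by (simp add: gcommuting_def)
  then show "E (y # u) - c *\<^sub>R E (y # v) \<in> S"
    using assms(1) by (auto simp: reduces_to_def)
qed

lemma reduces_to_swap:
  assumes "set ((i, j) # (i', j') # v) \<subseteq> gens n q"
  shows "reduces_to T n q ((i, j) # (i', j') # v) ((- 1) ^ (i * i')) ((i', j') # (i, j) # v)"
  unfolding reduces_to_def gcommuting_def
proof (intro allI impI, elim conjE)
  fix S and E :: "_ \<Rightarrow> 'a"
  assume *: "\<forall>u v i j i' j'. set (u @ [(i, j), (i', j')] @ v) \<subseteq> gens n q \<longrightarrow>
     E (u @ [(i, j), (i', j')] @ v) - (- 1) ^ (i * i') *\<^sub>R E (u @ [(i', j'), (i, j)] @ v) \<in> S"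
  show "E ((i, j) # (i', j') # v) - (- 1) ^ (i * i') *\<^sub>R E ((i', j') # (i, j) # v) \<in> S"
    using *[rule_format, of "[]" i j i' j' v] assms by simp
qed

text \<open>Exchanging two equal odd letters shows that the value equals its negative modulo
  \<open>S\<close>, so half of the difference gives the value itself. With coefficient 0 the target
  word \<open>u\<close> is arbitrary.\<close>

lemma reduces_to_square:
  assumes "set ((i, j) # (i, j) # v) \<subseteq> gens n q" "odd i"
  shows "reduces_to T n q ((i, j) # (i, j) # v) 0 u"
  unfolding reduces_to_def
proof (intro allI impI)
  fix S and E :: "_ \<Rightarrow> 'a" assume E: "gcommuting n q S E"
  let ?e = "E ((i, j) # (i, j) # v)"
  have "?e - (- 1) ^ (i * i) *\<^sub>R ?e \<in> S"
    using reduces_to_swap[OF assms(1), of "TYPE('a)"] E by (simp add: reduces_to_def)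
  then have "(1 / 2) *\<^sub>R (?e - (- 1) ^ (i * i) *\<^sub>R ?e) \<in> S"
    using E by (intro subspace_scale) (auto simp: gcommuting_def)
  moreover have "(- 1) ^ (i * i) = (- 1 :: real)" using assms(2) by simp
  ultimately have "?e \<in> S" by (simp add: scaleR_2[symmetric])
  then show "?e - 0 *\<^sub>R E u \<in> S" by simp
qed

lemma gen_le_trans: "gen_le x y \<Longrightarrow> gen_le y z \<Longrightarrow> gen_le x z"
  by (auto split: prod.splits)

lemma gen_le_linear: "x \<noteq> y \<Longrightarrow> \<not> gen_le x y \<Longrightarrow> gen_le y x"
  by (auto split: prod.splits)

text \<open>One pass of insertion sort: the new letter stays, annihilates with an equal odd letter,
  or moves past the head at the cost of a sign. Nothing is claimed about \<open>w\<close> when the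
  coefficient is 0.\<close>

lemma insert_normal_form:
  assumes "set (y # v) \<subseteq> gens n q" "sorted_wrt gen_le v"
  shows "\<exists>c w. reduces_to T n q (y # v) c w \<and>
     (c \<noteq> 0 \<longrightarrow> sorted_wrt gen_le w \<and> mset w = mset (y # v))"
  using assms
proof (induction v)
  case Nil
  then show ?case using reduces_to_refl[of T n q "[y]"] by (intro exI[of _ 1] exI[of _ "[y]"]) auto
next
  case (Cons z v)
  obtain i j i' j' where yz: "y = (i, j)" "z = (i', j')" by fastforce
  consider "gen_le y z" | "y = z" "odd i" | "y \<noteq> z" "gen_le z y"
    using gen_le_linear[of y z] yz by fastforce
  then show ?case
  proof cases
    case 1
    then have "sorted_wrt gen_le (y # z # v)"
      using Cons.prems(2) gen_le_trans[OF 1] by auto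
    then show ?thesis using reduces_to_refl[of T n q "y # z # v"] by blast
  next
    case 2
    then show ?thesis using reduces_to_square[of i j v n q T] Cons.prems(1) yz by blast
  next
    case 3
    obtain c w where c: "reduces_to T n q (y # v) c w"
      "c \<noteq> 0 \<longrightarrow> sorted_wrt gen_le w \<and> mset w = mset (y # v)"
      using Cons.IH Cons.prems by auto
    have "reduces_to T n q (y # z # v) ((- 1) ^ (i * i')) (z # y # v)"
      using reduces_to_swap[of i j i' j' v n q T] Cons.prems(1) yz by simp
    moreover have "reduces_to T n q (z # y # v) c (z # w)"
      using reduces_to_Cons[OF c(1)] Cons.prems(1) by simp
    ultimately have "reduces_to T n q (y # z # v) ((- 1) ^ (i * i') * c) (z # w)"
      by (rule reduces_to_trans)
    moreover have "sorted_wrt gen_le (z # w) \<and> mset (z # w) = mset (y # z # v)" if "c \<noteq> 0"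
    proof -
      have "set w = set (y # v)" using c(2) that by (metis mset_eq_setD)
      then show ?thesis using c(2) that 3 Cons.prems(2) by auto
    qed
    ultimately show ?thesis by fastforce
  qed
qed

lemma normal_form_reduces:
  assumes "set u \<subseteq> gens n q"
  shows "\<exists>c w. reduces_to T n q u c w \<and> (c \<noteq> 0 \<longrightarrow> sorted_wrt gen_le w \<and> mset w = mset u)"
  using assms
proof (induction u)
  case Nil
  then show ?case using reduces_to_refl[of T n q "[]"] by (intro exI[of _ 1] exI[of _ "[]"]) auto
next
  case (Cons y u)
  then obtain c w where c: "reduces_to T n q u c w"
    "c \<noteq> 0 \<longrightarrow> sorted_wrt gen_le w \<and> mset w = mset u" by auto
  have r: "reduces_to T n q (y # u) c (y # w)"
    using reduces_to_Cons[OF c(1)] Cons.prems by simp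
  show ?case
  proof (cases "c = 0")
    case True
    then show ?thesis using r by blast
  next
    case False
    then have "set (y # w) \<subseteq> gens n q" using c(2) Cons.prems by (metis mset_eq_setD list.simps(15))
    then obtain d w' where d: "reduces_to T n q (y # w) d w'"
      "d \<noteq> 0 \<longrightarrow> sorted_wrt gen_le w' \<and> mset w' = mset (y # w)"
      using insert_normal_form c(2) False by blast
    then show ?thesis using reduces_to_trans[OF r d(1)] c(2) False
      by (intro exI[of _ "c * d"] exI[of _ w']) auto
  qed
qed

text \<open>The length is recorded next to the degree because it is what prevents a product of
  several generators from reducing to a single one.\<close>

lemma normal_form:
  assumes "set u \<subseteq> gens n q"
  obtains c w where "c = 0 \<or> w \<in> gmonomials n q (wdeg u) \<and> length w = length u"
    "\<And>S (E :: _ \<Rightarrow> 'v::real_vector). gcommuting n q S E \<Longrightarrow> E u - c *\<^sub>R E w \<in> S"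
proof -
  obtain c w where c: "reduces_to TYPE('v) n q u c w"
    "c \<noteq> 0 \<longrightarrow> sorted_wrt gen_le w \<and> mset w = mset u"
    using normal_form_reduces[OF assms] by blast
  have "w \<in> gmonomials n q (wdeg u) \<and> length w = length u" if "c \<noteq> 0"
  proof -
    have m: "sorted_wrt gen_le w" "mset w = mset u" using c(2) that by auto
    have "wdeg w = wdeg u" using m(2) by (metis mset_map sum_mset_sum_list)
    moreover have "set w = set u" using m(2) by (rule mset_eq_setD)
    moreover have "length w = length u" using m(2) by (rule mset_eq_length)
    ultimately show ?thesis using m(1) assms by (auto simp: gmonomials_alt)
  qed
  then show thesis using that c(1) unfolding reduces_to_def by blast
qed

section \<open>Left inverses of finite matrices are right inverses\<close>

lemma lookup_scaleR [simp]: "Poly_Mapping.lookup (c *\<^sub>R f) x = c * Poly_Mapping.lookup f x"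
  for f :: "'i \<Rightarrow>\<^sub>0 real"
proof -
  have "finite {i. c * Poly_Mapping.lookup f i \<noteq> 0}"
    by (rule finite_subset[OF _ finite_lookup[of f]]) auto
  then show ?thesis
    by (simp add: scaleR_poly_mapping_def Abs_poly_mapping_inverse)
qed

lemma scaleR_single: "c *\<^sub>R Poly_Mapping.single u d = Poly_Mapping.single u (c * d)"
  for d :: real
  by (rule poly_mapping_eqI) (simp add: lookup_single when_def)

lemma finite_matrix_left_inverse:
  fixes P Q :: "'i \<Rightarrow> 'i \<Rightarrow> real"
  assumes I: "finite I"
    and PQ: "\<And>w w'. w \<in> I \<Longrightarrow> w' \<in> I \<Longrightarrow> (\<Sum>v\<in>I. P w v * Q v w') = (if w = w' then 1 else 0)"
    and cQ: "\<And>w'. w' \<in> I \<Longrightarrow> (\<Sum>w\<in>I. c w * Q w w') = 0" and w: "w \<in> I"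
  shows "c w = 0"
proof (rule ccontr)
  assume cw: "c w \<noteq> 0"
  define e where "e w = Poly_Mapping.single w (1::real)" for w :: 'i
  define L where "L v = (\<Sum>w'\<in>I. Q v w' *\<^sub>R e w')" for v
  have le: "Poly_Mapping.lookup (\<Sum>x\<in>I. f x *\<^sub>R e x) y = (if y \<in> I then f y else 0)" for f y
    using I by (simp add: lookup_sum e_def lookup_single when_def if_distrib sum.delta cong: if_cong)
  have lL: "Poly_Mapping.lookup (\<Sum>v\<in>I. f v *\<^sub>R L v) y = (if y \<in> I then \<Sum>v\<in>I. f v * Q v y else 0)" for f y
    by (simp add: lookup_sum) (auto simp: L_def le)
  have e: "e u = (\<Sum>v\<in>I. P u v *\<^sub>R L v)" if "u \<in> I" for u
    by (rule poly_mapping_eqI, subst lL) (use PQ that in \<open>auto simp: e_def lookup_single when_def\<close>)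
  have "(\<Sum>v\<in>I. c v *\<^sub>R L v) = 0"
    by (rule poly_mapping_eqI, subst lL) (use cQ in auto)
  then have cL: "c w *\<^sub>R L w = - (\<Sum>v\<in>I - {w}. c v *\<^sub>R L v)"
    using I w by (simp add: sum.remove eq_neg_iff_add_eq_0)
  have "(1 / c w) *\<^sub>R (c w *\<^sub>R L w) \<in> span (L ` (I - {w}))"
    unfolding cL by (intro span_scale span_neg span_sum span_base) auto
  then have Lw: "L w \<in> span (L ` (I - {w}))" using cw by simp
  have "L v \<in> span (L ` (I - {w}))" if "v \<in> I" for v
    using that Lw by (cases "v = w") (auto intro: span_base)
  then have "e ` I \<subseteq> span (L ` (I - {w}))"
    using e by (auto intro!: span_scale span_sum)
  moreover have inj: "inj_on e I" 
    by (rule inj_onI) (metis e_def lookup_single_eq lookup_single_not_eq zero_neq_one)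
  have "independent (e ` I)"
  proof (rule independent_if_scalars_zero)
    show "finite (e ` I)" using I by simp
    fix f x assume f: "(\<Sum>x\<in>e ` I. f x *\<^sub>R x) = 0" "x \<in> e ` I"
    then obtain u where u: "u \<in> I" "x = e u" by blast
    have "(\<Sum>v\<in>I. f (e v) *\<^sub>R e v) = 0" using f(1) by (simp add: sum.reindex[OF inj])
    then have "Poly_Mapping.lookup (\<Sum>v\<in>I. f (e v) *\<^sub>R e v) u = 0" by simp
    then show "f x = 0" using u by (simp only: le if_True)
  qed
  ultimately have "card (e ` I) \<le> card (L ` (I - {w}))"
    using independent_span_bound[of "L ` (I - {w})" "e ` I"] I by auto
  also have "\<dots> \<le> card (I - {w})" using I by (intro card_image_le) auto
  also have "\<dots> < card I" using I w by (intro psubset_card_mono) auto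
  finally show False using card_image[OF inj] by simp
qed

section \<open>The graded symmetric algebra\<close>

text \<open>Bilinearity compares products whose arguments have different supports; all of them are
  first written as sums over common finite sets of words.\<close>

lemma words_mult_superset:
  assumes "finite A" "finite B" "Poly_Mapping.keys f \<subseteq> A" "Poly_Mapping.keys g \<subseteq> B"
  shows "words_mult f g = (\<Sum>u\<in>A. \<Sum>v\<in>B.
    Poly_Mapping.single (u @ v) (Poly_Mapping.lookup f u * Poly_Mapping.lookup g v))"
proof -
  have 1: "(\<Sum>v\<in>Poly_Mapping.keys g. Poly_Mapping.single (u @ v) (Poly_Mapping.lookup f u * Poly_Mapping.lookup g v)) =
     (\<Sum>v\<in>B. Poly_Mapping.single (u @ v) (Poly_Mapping.lookup f u * Poly_Mapping.lookup g v))" for u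
    using assms by (intro sum.mono_neutral_left) (auto simp: in_keys_iff)
  show ?thesis unfolding words_mult_def 1
    using assms by (intro sum.mono_neutral_left) (auto simp: in_keys_iff)
qed

lemma linear_words_mult_left:
  fixes g :: "'w words"
  shows "linear (\<lambda>f. words_mult f g)"
proof (rule linearI)
  fix f f' :: "'w words" and c :: real
  let ?A = "Poly_Mapping.keys f \<union> Poly_Mapping.keys f'" and ?B = "Poly_Mapping.keys g"
  note * = words_mult_superset[of ?A ?B]
  show "words_mult (f + f') g = words_mult f g + words_mult f' g"
    using keys_add[of f f'] by (subst (1 2 3) *)
      (auto simp: lookup_add distrib_right single_add sum.distrib)
  have "Poly_Mapping.keys (c *\<^sub>R f) \<subseteq> ?A" by (auto simp: in_keys_iff)
  then show "words_mult (c *\<^sub>R f) g = c *\<^sub>R words_mult f g"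
    by (subst (1 2) *) (auto simp: scaleR_sum_right scaleR_single mult.assoc)
qed

lemma linear_words_mult_right:
  fixes f :: "'w words"
  shows "linear (words_mult f)"
proof (rule linearI)
  fix g g' :: "'w words" and c :: real
  let ?A = "Poly_Mapping.keys f" and ?B = "Poly_Mapping.keys g \<union> Poly_Mapping.keys g'"
  note * = words_mult_superset[of ?A ?B]
  show "words_mult f (g + g') = words_mult f g + words_mult f g'"
    using keys_add[of g g'] by (subst (1 2 3) *)
      (auto simp: lookup_add distrib_left single_add sum.distrib)
  have "Poly_Mapping.keys (c *\<^sub>R g) \<subseteq> ?B" by (auto simp: in_keys_iff)
  then show "words_mult f (c *\<^sub>R g) = c *\<^sub>R words_mult f g"
    by (subst (1 2) *) (auto simp: scaleR_sum_right scaleR_single mult.left_commute)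
qed

lemma words_mult_word: "words_mult (word u) (word v) = word (u @ v)"
  by (subst words_mult_superset[of "{u}" "{v}"]) (auto simp: lookup_single)

lemma words_expand: "f = (\<Sum>u\<in>Poly_Mapping.keys f. Poly_Mapping.lookup f u *\<^sub>R word u)"
  by (rule poly_mapping_eqI)
    (auto simp: lookup_sum lookup_single when_def in_keys_iff sum.delta if_distrib cong: if_cong)

lemma subspace_supported: "subspace {f :: 'i \<Rightarrow>\<^sub>0 real. Poly_Mapping.keys f \<subseteq> S}"
  unfolding subspace_def
proof (intro conjI ballI allI)
  fix f g :: "'i \<Rightarrow>\<^sub>0 real" and c :: real
  assume f: "f \<in> {f. Poly_Mapping.keys f \<subseteq> S}"
  then show "c *\<^sub>R f \<in> {f. Poly_Mapping.keys f \<subseteq> S}" by (auto simp: in_keys_iff)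
  assume "g \<in> {f. Poly_Mapping.keys f \<subseteq> S}"
  then show "f + g \<in> {f. Poly_Mapping.keys f \<subseteq> S}" using f keys_add[of f g] by auto
qed auto

definition linear_ext :: "('i \<Rightarrow> real) \<Rightarrow> ('i \<Rightarrow>\<^sub>0 real) \<Rightarrow> real" where
  "linear_ext F f = (\<Sum>u\<in>Poly_Mapping.keys f. Poly_Mapping.lookup f u * F u)"

lemma linear_ext_superset:
  "finite A \<Longrightarrow> Poly_Mapping.keys f \<subseteq> A \<Longrightarrow> linear_ext F f = (\<Sum>u\<in>A. Poly_Mapping.lookup f u * F u)"
  unfolding linear_ext_def by (intro sum.mono_neutral_left) (auto simp: in_keys_iff)

lemma linear_linear_ext: "linear (linear_ext F)"
proof (rule linearI)
  fix f f' :: "'a \<Rightarrow>\<^sub>0 real" and c :: real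
  let ?A = "Poly_Mapping.keys f \<union> Poly_Mapping.keys f'"
  note * = linear_ext_superset[of ?A]
  show "linear_ext F (f + f') = linear_ext F f + linear_ext F f'"
    using keys_add[of f f'] by (subst (1 2 3) *)
      (auto simp: lookup_add distrib_right sum.distrib)
  have "Poly_Mapping.keys (c *\<^sub>R f) \<subseteq> ?A" by (auto simp: in_keys_iff)
  then show "linear_ext F (c *\<^sub>R f) = c *\<^sub>R linear_ext F f"
    by (subst (1 2) *) (auto simp: sum_distrib_left mult.assoc)
qed

lemma linear_ext_word [simp]: "linear_ext F (word u) = F u"
  by (subst linear_ext_superset[of "{u}"]) auto

lemma gsym_ideal_add:
  assumes "u \<in> lists (letters n W)" "v \<in> lists (letters n W)" "(i, a) \<in> letters n W" "(i, b) \<in> letters n W"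
  shows "word (u @ [(i, a \<oplus>\<^bsub>W i\<^esub> b)] @ v) - word (u @ [(i, a)] @ v) - word (u @ [(i, b)] @ v) \<in> gsym_ideal n W"
  unfolding gsym_ideal_def by (rule span_base) (use assms in blast)

lemma gsym_ideal_smult:
  assumes "u \<in> lists (letters n W)" "v \<in> lists (letters n W)" "(i, a) \<in> letters n W"
  shows "word (u @ [(i, c \<odot>\<^bsub>W i\<^esub> a)] @ v) - c *\<^sub>R word (u @ [(i, a)] @ v) \<in> gsym_ideal n W"
  unfolding gsym_ideal_def by (rule span_base) (use assms in blast)

lemma gsym_ideal_comm:
  assumes "u \<in> lists (letters n W)" "v \<in> lists (letters n W)" "(i, a) \<in> letters n W" "(j, b) \<in> letters n W"
  shows "word (u @ [(i, a), (j, b)] @ v) - (- 1) ^ (i * j) *\<^sub>R word (u @ [(j, b), (i, a)] @ v) \<in> gsym_ideal n W"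
  unfolding gsym_ideal_def by (rule span_base) (use assms in blast)

lemma subspace_gsym_ideal: "subspace (gsym_ideal n W)"
  unfolding gsym_ideal_def by (rule subspace_span)

text \<open>The ideal is a span, so a linear map sends it into a subspace as soon as the three kinds
  of relations go there. All later facts about the ideal are obtained in this way: its support, its
  stability under products, and the vanishing of evaluations on it.\<close>

lemma gsym_ideal_linear_image:
  assumes T: "linear T" "subspace Z"
    and "\<And>u v i a b. \<lbrakk>u \<in> lists (letters n W); v \<in> lists (letters n W); (i, a) \<in> letters n W; (i, b) \<in> letters n W\<rbrakk>
      \<Longrightarrow> T (word (u @ [(i, a \<oplus>\<^bsub>W i\<^esub> b)] @ v)) - T (word (u @ [(i, a)] @ v)) - T (word (u @ [(i, b)] @ v)) \<in> Z"
    and "\<And>u v i c a. \<lbrakk>u \<in> lists (letters n W); v \<in> lists (letters n W); (i, a) \<in> letters n W\<rbrakk>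
      \<Longrightarrow> T (word (u @ [(i, c \<odot>\<^bsub>W i\<^esub> a)] @ v)) - c *\<^sub>R T (word (u @ [(i, a)] @ v)) \<in> Z"
    and "\<And>u v i a j b. \<lbrakk>u \<in> lists (letters n W); v \<in> lists (letters n W); (i, a) \<in> letters n W; (j, b) \<in> letters n W\<rbrakk>
      \<Longrightarrow> T (word (u @ [(i, a), (j, b)] @ v)) - (- 1) ^ (i * j) *\<^sub>R T (word (u @ [(j, b), (i, a)] @ v)) \<in> Z"
    and h: "h \<in> gsym_ideal n W"
  shows "T h \<in> Z"
proof -
  have "subspace {h. T h \<in> Z}"
    using linear_subspace_vimage[OF T] by (simp add: vimage_def)
  then have "gsym_ideal n W \<subseteq> {h. T h \<in> Z}"
    unfolding gsym_ideal_def
    by (intro span_minimal Un_least subsetI CollectI; (elim CollectE exE conjE)?; hypsubst?;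
        simp only: linear_diff[OF T(1)] linear_cmul[OF T(1)] assms(3-5))
  then show ?thesis using h by blast
qed

lemma gsym_class_eq_iff: "gsym_class n W f = gsym_class n W g \<longleftrightarrow> f - g \<in> gsym_ideal n W"
proof
  assume "gsym_class n W f = gsym_class n W g"
  moreover have "f \<in> gsym_class n W f"
    unfolding gsym_class_def using subspace_0[OF subspace_gsym_ideal] by force
  ultimately show "f - g \<in> gsym_ideal n W" by (auto simp: gsym_class_def)
next
  assume fg: "f - g \<in> gsym_ideal n W"
  have "f + h \<in> gsym_class n W g" if "h \<in> gsym_ideal n W" for h
    unfolding gsym_class_def using subspace_add[OF subspace_gsym_ideal fg that]
    by (intro CollectI exI[of _ "f - g + h"]) auto
  moreover have "g + h \<in> gsym_class n W f" if "h \<in> gsym_ideal n W" for h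
    unfolding gsym_class_def using subspace_diff[OF subspace_gsym_ideal that fg]
    by (intro CollectI exI[of _ "h - (f - g)"]) auto
  ultimately show "gsym_class n W f = gsym_class n W g" unfolding gsym_class_def by blast
qed

lemma gsym_class_self: "f \<in> gsym_class n W f"
  unfolding gsym_class_def using subspace_0[OF subspace_gsym_ideal] by force

lemma gsym_class_nonempty [simp]: "gsym_class n W f \<noteq> {}"
  using gsym_class_self by blast

lemma mem_gsym_class_iff: "g \<in> gsym_class n W f \<longleftrightarrow> g - f \<in> gsym_ideal n W"
  unfolding gsym_class_def by (auto intro: exI[of _ "g - f"])

text \<open>Sums in \<open>gsym\<close> are unions over all representatives; since every pair of
  representatives yields the same class, the union collapses to that class.\<close>

lemma gsym_add_class:
  "gsym_class n W f \<oplus>\<^bsub>gsym n W k\<^esub> gsym_class n W g = gsym_class n W (f + g)"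
proof -
  have "gsym_class n W (f' + g') = gsym_class n W (f + g)"
    if "f' \<in> gsym_class n W f" "g' \<in> gsym_class n W g" for f' g'
    using subspace_add[OF subspace_gsym_ideal, of "f' - f" n W "g' - g"] that
    by (simp add: gsym_class_eq_iff mem_gsym_class_iff algebra_simps)
  then have "(\<Union>f'\<in>gsym_class n W f. \<Union>g'\<in>gsym_class n W g. gsym_class n W (f' + g')) =
      (\<Union>f'\<in>gsym_class n W f. \<Union>g'\<in>gsym_class n W g. gsym_class n W (f + g))"
    by (intro SUP_cong refl)
  also have "\<dots> = gsym_class n W (f + g)"
    by simp
  finally show ?thesis by (simp add: gsym_def)
qed

lemma gsym_smult_class: "c \<odot>\<^bsub>gsym n W k\<^esub> gsym_class n W f = gsym_class n W (c *\<^sub>R f)"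
proof -
  have "gsym_class n W (c *\<^sub>R f') = gsym_class n W (c *\<^sub>R f)" if "f' \<in> gsym_class n W f" for f'
    using subspace_scale[OF subspace_gsym_ideal, of "f' - f" n W c] that
    by (simp add: gsym_class_eq_iff mem_gsym_class_iff algebra_simps)
  then have "(\<Union>f'\<in>gsym_class n W f. gsym_class n W (c *\<^sub>R f')) =
      (\<Union>f'\<in>gsym_class n W f. gsym_class n W (c *\<^sub>R f))"
    by (intro SUP_cong refl)
  also have "\<dots> = gsym_class n W (c *\<^sub>R f)"
    by simp
  finally show ?thesis by (simp add: gsym_def)
qed

text \<open>The type of words also contains words whose entries are not letters of \<open>W\<close>.
  The span that serves as ideal is stable under multiplication by combinations of words in true
  letters, and this set singles them out.\<close>

definition letter_words :: "nat \<Rightarrow> (nat \<Rightarrow> (real, 'w) module) \<Rightarrow> 'w words set" where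
  "letter_words n W = {f. Poly_Mapping.keys f \<subseteq> lists (letters n W)}"

definition deg_words :: "nat \<Rightarrow> (nat \<Rightarrow> (real, 'w) module) \<Rightarrow> nat \<Rightarrow> 'w words set" where
  "deg_words n W k = {f. Poly_Mapping.keys f \<subseteq> {w \<in> lists (letters n W). wdeg w = k}}"

lemma deg_words_letter_words: "f \<in> deg_words n W k \<Longrightarrow> f \<in> letter_words n W"
  by (auto simp: letter_words_def deg_words_def)

lemma subspace_letter_words: "subspace (letter_words n W)"
  unfolding letter_words_def by (rule subspace_supported)

lemma subspace_deg_words: "subspace (deg_words n W k)"
  unfolding deg_words_def by (rule subspace_supported)

lemma word_in_deg_words: "w \<in> lists (letters n W) \<Longrightarrow> wdeg w = k \<Longrightarrow> word w \<in> deg_words n W k"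
  by (auto simp: deg_words_def)

lemma words_mult_deg_words:
  assumes "f \<in> deg_words n W k" "g \<in> deg_words n W l"
  shows "words_mult f g \<in> deg_words n W (k + l)"
  unfolding words_mult_def
proof (intro subspace_sum[OF subspace_deg_words])
  fix u v assume "u \<in> Poly_Mapping.keys f" "v \<in> Poly_Mapping.keys g"
  then have "u @ v \<in> lists (letters n W)" "wdeg (u @ v) = k + l"
    using assms by (auto simp: deg_words_def)
  then show "Poly_Mapping.single (u @ v) (Poly_Mapping.lookup f u * Poly_Mapping.lookup g v) \<in> deg_words n W (k + l)"
    by (auto simp: deg_words_def)
qed

lemma gsym_carrier: "carrier (gsym n W k) = gsym_class n W ` deg_words n W k"
  by (auto simp: gsym_def deg_words_def)

text \<open>Closure of the components ensures that the sums and multiples occurring in the relations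
  are again letters, so that the ideal lies in \<open>letter_words\<close>.\<close>

locale graded_letters =
  fixes n :: nat and W :: "nat \<Rightarrow> (real, 'w) module"
  assumes add_closed: "\<And>i a b. a \<in> carrier (W i) \<Longrightarrow> b \<in> carrier (W i) \<Longrightarrow> a \<oplus>\<^bsub>W i\<^esub> b \<in> carrier (W i)"
    and smult_closed: "\<And>i c a. a \<in> carrier (W i) \<Longrightarrow> c \<odot>\<^bsub>W i\<^esub> a \<in> carrier (W i)"
begin

lemma letters_closed:
  "(i, a) \<in> letters n W \<Longrightarrow> (i, b) \<in> letters n W \<Longrightarrow> (i, a \<oplus>\<^bsub>W i\<^esub> b) \<in> letters n W"
  "(i, a) \<in> letters n W \<Longrightarrow> (i, c \<odot>\<^bsub>W i\<^esub> a) \<in> letters n W"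
  using add_closed smult_closed by (auto simp: letters_def)

lemma gsym_ideal_letter_words: "h \<in> gsym_ideal n W \<Longrightarrow> h \<in> letter_words n W"
proof (erule gsym_ideal_linear_image[of "\<lambda>h. h" "letter_words n W", rotated 5])
  note diff = subspace_diff[OF subspace_letter_words] and scale = subspace_scale[OF subspace_letter_words]
  have w: "word u \<in> letter_words n W" if "u \<in> lists (letters n W)" for u
    using that by (auto simp: letter_words_def)
  show "linear (\<lambda>h :: 'w words. h)" by (simp add: linear_iff)
  show "subspace (letter_words n W)" by (rule subspace_letter_words)
  fix u v i a
  assume uv: "u \<in> lists (letters n W)" "v \<in> lists (letters n W)" and a: "(i, a) \<in> letters n W"
  show "word (u @ [(i, c \<odot>\<^bsub>W i\<^esub> a)] @ v) - c *\<^sub>R word (u @ [(i, a)] @ v) \<in> letter_words n W" for c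
    using uv a letters_closed(2)[OF a] by (intro diff scale w) auto
  fix b assume b: "(i, b) \<in> letters n W"
  show "word (u @ [(i, a \<oplus>\<^bsub>W i\<^esub> b)] @ v) - word (u @ [(i, a)] @ v) - word (u @ [(i, b)] @ v) \<in> letter_words n W"
    using uv a b letters_closed(1)[OF a b] by (intro diff w) auto
next
  note diff = subspace_diff[OF subspace_letter_words] and scale = subspace_scale[OF subspace_letter_words]
  have w: "word u \<in> letter_words n W" if "u \<in> lists (letters n W)" for u
    using that by (auto simp: letter_words_def)
  fix u v i a j b
  assume "u \<in> lists (letters n W)" "v \<in> lists (letters n W)" "(i, a) \<in> letters n W" "(j, b) \<in> letters n W"
  then show "word (u @ [(i, a), (j, b)] @ v) - (- 1) ^ (i * j) *\<^sub>R word (u @ [(j, b), (i, a)] @ v) \<in> letter_words n W"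
    by (intro diff scale w) auto
qed

text \<open>Multiplying a relation by a word merely lengthens the context in which the relation
  takes place; linearity in the second factor does the rest.\<close>

lemma words_mult_ideal_left:
  assumes "h \<in> gsym_ideal n W" "g \<in> letter_words n W"
  shows "words_mult h g \<in> gsym_ideal n W"
proof -
  have "words_mult h (word s) \<in> gsym_ideal n W" if s: "s \<in> lists (letters n W)" for s
  proof (rule gsym_ideal_linear_image[OF linear_words_mult_left subspace_gsym_ideal _ _ _ assms(1)])
    fix u v i a b
    assume "u \<in> lists (letters n W)" "v \<in> lists (letters n W)" "(i, a) \<in> letters n W" "(i, b) \<in> letters n W"
    then show "words_mult (word (u @ [(i, a \<oplus>\<^bsub>W i\<^esub> b)] @ v)) (word s) - words_mult (word (u @ [(i, a)] @ v)) (word s) -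
       words_mult (word (u @ [(i, b)] @ v)) (word s) \<in> gsym_ideal n W"
      using gsym_ideal_add[of u n W "v @ s" i a b] s by (simp add: words_mult_word)
  next
    fix u v i c a
    assume "u \<in> lists (letters n W)" "v \<in> lists (letters n W)" "(i, a) \<in> letters n W"
    then show "words_mult (word (u @ [(i, c \<odot>\<^bsub>W i\<^esub> a)] @ v)) (word s) - c *\<^sub>R words_mult (word (u @ [(i, a)] @ v)) (word s) \<in> gsym_ideal n W"
      using gsym_ideal_smult[of u n W "v @ s" i a c] s by (simp add: words_mult_word)
  next
    fix u v i a j b
    assume "u \<in> lists (letters n W)" "v \<in> lists (letters n W)" "(i, a) \<in> letters n W" "(j, b) \<in> letters n W"
    then show "words_mult (word (u @ [(i, a), (j, b)] @ v)) (word s) -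
       (- 1) ^ (i * j) *\<^sub>R words_mult (word (u @ [(j, b), (i, a)] @ v)) (word s) \<in> gsym_ideal n W"
      using gsym_ideal_comm[of u n W "v @ s" i a j b] s by (simp add: words_mult_word)
  qed
  then have "(\<Sum>s\<in>Poly_Mapping.keys g. Poly_Mapping.lookup g s *\<^sub>R words_mult h (word s)) \<in> gsym_ideal n W"
    using assms(2) by (intro subspace_sum subspace_scale subspace_gsym_ideal) (auto simp: letter_words_def)
  also have "(\<Sum>s\<in>Poly_Mapping.keys g. Poly_Mapping.lookup g s *\<^sub>R words_mult h (word s)) = words_mult h g"
    using linear_sum[OF linear_words_mult_right, of h "\<lambda>s. Poly_Mapping.lookup g s *\<^sub>R word s" "Poly_Mapping.keys g"]
    by (simp add: linear_cmul[OF linear_words_mult_right] flip: words_expand)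
  finally show ?thesis .
qed

lemma words_mult_ideal_right:
  assumes "h \<in> gsym_ideal n W" "g \<in> letter_words n W"
  shows "words_mult g h \<in> gsym_ideal n W"
proof -
  have "words_mult (word s) h \<in> gsym_ideal n W" if s: "s \<in> lists (letters n W)" for s
  proof (rule gsym_ideal_linear_image[OF linear_words_mult_right subspace_gsym_ideal _ _ _ assms(1)])
    fix u v i a b
    assume "u \<in> lists (letters n W)" "v \<in> lists (letters n W)" "(i, a) \<in> letters n W" "(i, b) \<in> letters n W"
    then show "words_mult (word s) (word (u @ [(i, a \<oplus>\<^bsub>W i\<^esub> b)] @ v)) - words_mult (word s) (word (u @ [(i, a)] @ v)) -
       words_mult (word s) (word (u @ [(i, b)] @ v)) \<in> gsym_ideal n W"
      using gsym_ideal_add[of "s @ u" n W v i a b] s by (simp add: words_mult_word)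
  next
    fix u v i c a
    assume "u \<in> lists (letters n W)" "v \<in> lists (letters n W)" "(i, a) \<in> letters n W"
    then show "words_mult (word s) (word (u @ [(i, c \<odot>\<^bsub>W i\<^esub> a)] @ v)) - c *\<^sub>R words_mult (word s) (word (u @ [(i, a)] @ v)) \<in> gsym_ideal n W"
      using gsym_ideal_smult[of "s @ u" n W v i a c] s by (simp add: words_mult_word)
  next
    fix u v i a j b
    assume "u \<in> lists (letters n W)" "v \<in> lists (letters n W)" "(i, a) \<in> letters n W" "(j, b) \<in> letters n W"
    then show "words_mult (word s) (word (u @ [(i, a), (j, b)] @ v)) -
       (- 1) ^ (i * j) *\<^sub>R words_mult (word s) (word (u @ [(j, b), (i, a)] @ v)) \<in> gsym_ideal n W"
      using gsym_ideal_comm[of "s @ u" n W v i a j b] s by (simp add: words_mult_word)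
  qed
  then have "(\<Sum>s\<in>Poly_Mapping.keys g. Poly_Mapping.lookup g s *\<^sub>R words_mult (word s) h) \<in> gsym_ideal n W"
    using assms(2) by (intro subspace_sum subspace_scale subspace_gsym_ideal) (auto simp: letter_words_def)
  also have "(\<Sum>s\<in>Poly_Mapping.keys g. Poly_Mapping.lookup g s *\<^sub>R words_mult (word s) h) = words_mult g h"
    using linear_sum[OF linear_words_mult_left, of "\<lambda>s. Poly_Mapping.lookup g s *\<^sub>R word s" "Poly_Mapping.keys g" h]
    by (simp add: linear_cmul[OF linear_words_mult_left] flip: words_expand)
  finally show ?thesis .
qed

text \<open>Independence of representatives comes from f'g' - fg = (f' - f)g' + f(g' - g). Here
  \<open>g'\<close> is a combination of words in letters because it differs from \<open>g\<close> by
  an element of the ideal.\<close>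

lemma gsym_mult_class:
  assumes "f \<in> letter_words n W" "g \<in> letter_words n W"
  shows "gsym_mult n W (gsym_class n W f) (gsym_class n W g) = gsym_class n W (words_mult f g)"
proof -
  have "gsym_class n W (words_mult f' g') = gsym_class n W (words_mult f g)"
    if "f' \<in> gsym_class n W f" "g' \<in> gsym_class n W g" for f' g'
  proof -
    have d: "f' - f \<in> gsym_ideal n W" "g' - g \<in> gsym_ideal n W"
      using that by (auto simp: mem_gsym_class_iff)
    have "g' = g + (g' - g)" by simp
    then have g': "g' \<in> letter_words n W"
      using subspace_add[OF subspace_letter_words assms(2) gsym_ideal_letter_words[OF d(2)]] by simp
    have "words_mult (f' - f) g' + words_mult f (g' - g) \<in> gsym_ideal n W"
      using d g' assms by (intro subspace_add subspace_gsym_ideal words_mult_ideal_left words_mult_ideal_right)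
    then show ?thesis
      by (simp add: gsym_class_eq_iff linear_diff[OF linear_words_mult_left] linear_diff[OF linear_words_mult_right])
  qed
  then have "(\<Union>f'\<in>gsym_class n W f. \<Union>g'\<in>gsym_class n W g. gsym_class n W (words_mult f' g')) =
      (\<Union>f'\<in>gsym_class n W f. \<Union>g'\<in>gsym_class n W g. gsym_class n W (words_mult f g))"
    by (intro SUP_cong refl)
  also have "\<dots> = gsym_class n W (words_mult f g)"
    by simp
  finally show ?thesis by (simp add: gsym_mult_def)
qed

end

section \<open>The model fibre and its dual coordinates\<close>

text \<open>The position of the fibres of a bundle in the ambient space is unrelated to its smooth
  structure, so one constant space serves as the fibre over every point, and the twisting is carried
  by the trivializations alone.\<close>

definition seq_space :: "nat \<Rightarrow> (nat \<Rightarrow>\<^sub>0 real) set" where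
  "seq_space r = {v. Poly_Mapping.keys v \<subseteq> {..<r}}"

definition coord :: "nat \<Rightarrow> nat \<Rightarrow> (nat \<Rightarrow>\<^sub>0 real) \<Rightarrow> real" where
  "coord r j = (\<lambda>v\<in>seq_space r. Poly_Mapping.lookup v j)"

abbreviation (input) basis_vec :: "nat \<Rightarrow> nat \<Rightarrow>\<^sub>0 real" where
  "basis_vec j \<equiv> Poly_Mapping.single j 1"

lemma subspace_seq_space: "subspace (seq_space r)"
  unfolding seq_space_def by (rule subspace_supported)

lemma coord_in_dual: "coord r j \<in> carrier (dual_space (seq_space r))"
  using subspace_add[OF subspace_seq_space] subspace_scale[OF subspace_seq_space]
  by (auto simp: dual_space_def coord_def lookup_add)

definition dual_letters :: "(nat \<Rightarrow> nat) \<Rightarrow> nat \<Rightarrow> (real, (nat \<Rightarrow>\<^sub>0 real) \<Rightarrow> real) module" where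
  "dual_letters q i = dual_space (seq_space (q i))"

lemma dual_space_closed:
  assumes "subspace S"
  shows "a \<in> carrier (dual_space S) \<Longrightarrow> b \<in> carrier (dual_space S) \<Longrightarrow> a \<oplus>\<^bsub>dual_space S\<^esub> b \<in> carrier (dual_space S)"
    "a \<in> carrier (dual_space S) \<Longrightarrow> c \<odot>\<^bsub>dual_space S\<^esub> a \<in> carrier (dual_space S)"
  using subspace_add[OF assms] subspace_scale[OF assms]
  by (auto simp: dual_space_def algebra_simps)

interpretation dual_letters: graded_letters n "dual_letters q" for n q
  by unfold_locales (auto simp: dual_letters_def dual_space_closed subspace_seq_space)

lemma dual_expansion:
  assumes "a \<in> carrier (dual_space (seq_space r))" "v \<in> seq_space r"
  shows "a v = (\<Sum>j<r. a (basis_vec j) * Poly_Mapping.lookup v j)"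
proof -
  have add: "\<And>v w. v \<in> seq_space r \<Longrightarrow> w \<in> seq_space r \<Longrightarrow> a (v + w) = a v + a w"
    and sc: "\<And>c v. v \<in> seq_space r \<Longrightarrow> a (c *\<^sub>R v) = c * a v"
    using assms(1) by (auto simp: dual_space_def)
  have b: "basis_vec j \<in> seq_space r" if "j < r" for j
    using that by (auto simp: seq_space_def)
  have 0: "a 0 = 0" using sc[of 0 0] subspace_0[OF subspace_seq_space] by simp
  have "a (\<Sum>j\<in>J. c j *\<^sub>R basis_vec j) = (\<Sum>j\<in>J. c j * a (basis_vec j))" if "J \<subseteq> {..<r}" for J c
  proof -
    have "finite J" using that finite_subset by blast
    then show ?thesis using that
    proof (induction J)
      case (insert x J)
      then have "(\<Sum>j\<in>J. c j *\<^sub>R basis_vec j) \<in> seq_space r" "basis_vec x \<in> seq_space r"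
        using b by (auto intro!: subspace_sum subspace_scale subspace_seq_space)
      then show ?case
        using insert subspace_scale[OF subspace_seq_space] by (simp add: add sc)
    qed (simp add: 0)
  qed
  from this[of "{..<r}" "Poly_Mapping.lookup v"]
  have "a (\<Sum>j<r. Poly_Mapping.lookup v j *\<^sub>R basis_vec j) = (\<Sum>j<r. a (basis_vec j) * Poly_Mapping.lookup v j)"
    by (simp add: mult.commute)
  moreover have "(\<Sum>j<r. Poly_Mapping.lookup v j *\<^sub>R basis_vec j) = v"
  proof -
    have "Poly_Mapping.lookup v j = 0" if "\<not> j < r" for j
      using that assms(2) by (auto simp: seq_space_def in_keys_iff subset_iff)
    then show ?thesis
      by (intro poly_mapping_eqI) (auto simp: lookup_sum lookup_single when_def if_distrib cong: if_cong)
  qed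
  ultimately show ?thesis by simp
qed

definition coord_word :: "(nat \<Rightarrow> nat) \<Rightarrow> (nat \<times> nat) list \<Rightarrow> (nat \<times> ((nat \<Rightarrow>\<^sub>0 real) \<Rightarrow> real)) list" where
  "coord_word q w = map (\<lambda>(i, j). (i, coord (q i) j)) w"

lemma wdeg_coord_word [simp]: "wdeg (coord_word q w) = wdeg w"
  by (simp add: coord_word_def case_prod_unfold comp_def)

lemma coord_letter: "i \<in> {1..n} \<Longrightarrow> (i, coord (q i) j) \<in> letters n (dual_letters q)"
  using coord_in_dual by (simp add: letters_def dual_letters_def)

lemma coord_word_lists: "set w \<subseteq> gens n q \<Longrightarrow> coord_word q w \<in> lists (letters n (dual_letters q))"
  using coord_letter by (induction w) (auto simp: coord_word_def gens_def)

text \<open>The relations only express additivity for two summands and homogeneity, so the expansion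
  of \<open>a\<close> in the dual basis is built up through its partial sums
  \<open>p m\<close>.\<close>

lemma letter_expansion:
  assumes "u \<in> lists (letters n (dual_letters q))" "v \<in> lists (letters n (dual_letters q))"
    "(i, a) \<in> letters n (dual_letters q)"
  shows "word (u @ [(i, a)] @ v) - (\<Sum>j<q i. a (basis_vec j) *\<^sub>R word (u @ [(i, coord (q i) j)] @ v))
     \<in> gsym_ideal n (dual_letters q)"
proof -
  let ?W = "dual_letters q" and ?S = "seq_space (q i)"
  have i: "i \<in> {1..n}" and a: "a \<in> carrier (dual_space ?S)"
    using assms(3) by (auto simp: letters_def dual_letters_def)
  define p where "p m = (\<lambda>v\<in>?S. \<Sum>j<m. a (basis_vec j) * Poly_Mapping.lookup v j)" for m
  \<comment> \<open>Writing the empty sum as 0 times \<open>a\<close> lets homogeneity, with factor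
    0, show that a word containing it lies in the ideal.\<close>
  have p0: "p 0 = 0 \<odot>\<^bsub>?W i\<^esub> a"
    by (auto simp: p_def dual_letters_def dual_space_def)
  have pS: "p (Suc m) = p m \<oplus>\<^bsub>?W i\<^esub> (a (basis_vec m) \<odot>\<^bsub>?W i\<^esub> coord (q i) m)" for m
    by (auto simp: p_def dual_letters_def dual_space_def coord_def restrict_def)
  have cl: "(i, a (basis_vec m) \<odot>\<^bsub>?W i\<^esub> coord (q i) m) \<in> letters n ?W" for m
    using dual_letters.letters_closed(2) coord_letter[OF i] by blast
  have pl: "(i, p m) \<in> letters n ?W" for m
    by (induction m) (auto simp: p0 pS cl assms(3) dual_letters.letters_closed)
  have *: "word (u @ [(i, p m)] @ v) - (\<Sum>j<m. a (basis_vec j) *\<^sub>R word (u @ [(i, coord (q i) j)] @ v))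
     \<in> gsym_ideal n ?W" for m
  proof (induction m)
    case 0
    then show ?case using gsym_ideal_smult[OF assms, of 0] by (simp add: p0)
  next
    case (Suc m)
    have "(word (u @ [(i, p (Suc m))] @ v) - word (u @ [(i, p m)] @ v) -
        word (u @ [(i, a (basis_vec m) \<odot>\<^bsub>?W i\<^esub> coord (q i) m)] @ v)) +
      (word (u @ [(i, a (basis_vec m) \<odot>\<^bsub>?W i\<^esub> coord (q i) m)] @ v) -
         a (basis_vec m) *\<^sub>R word (u @ [(i, coord (q i) m)] @ v)) +
      (word (u @ [(i, p m)] @ v) - (\<Sum>j<m. a (basis_vec j) *\<^sub>R word (u @ [(i, coord (q i) j)] @ v)))
      \<in> gsym_ideal n ?W"
      unfolding pS
      by (intro subspace_add subspace_gsym_ideal gsym_ideal_add gsym_ideal_smult Suc.IH assms pl cl coord_letter i)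
    then show ?case by (simp add: algebra_simps)
  qed
  have "p (q i) = a"
  proof (rule extensionalityI)
    show "p (q i) \<in> extensional ?S" by (simp add: p_def)
    show "a \<in> extensional ?S" using a by (simp add: dual_space_def)
    show "p (q i) v = a v" if "v \<in> ?S" for v
      using dual_expansion[OF a that] that by (simp add: p_def)
  qed
  then show ?thesis using *[of "q i"] by simp
qed

text \<open>Multilinearity replaces arbitrary letters by coordinates, and the normal form of words
  then sorts them. The converse, that sorted words are independent, is not a matter of the relations
  and is obtained later by evaluation in the sheaf.\<close>

lemma coord_words_span:
  assumes "f \<in> deg_words n (dual_letters q) k"
  shows "\<exists>c. f - (\<Sum>w\<in>gmonomials n q k. c w *\<^sub>R word (coord_word q w)) \<in> gsym_ideal n (dual_letters q)"
proof -
  let ?I = "gsym_ideal n (dual_letters q)"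
  define Z where "Z k = {f. \<exists>c. f - (\<Sum>w\<in>gmonomials n q k. c w *\<^sub>R word (coord_word q w)) \<in> ?I}" for k
  have Z: "subspace (Z k)" for k
    unfolding subspace_def
  proof (intro conjI ballI allI)
    show "0 \<in> Z k" unfolding Z_def
      by (intro CollectI exI[of _ "\<lambda>_. 0"]) (simp add: subspace_0[OF subspace_gsym_ideal])
    fix f assume "f \<in> Z k"
    then obtain c where c: "f - (\<Sum>w\<in>gmonomials n q k. c w *\<^sub>R word (coord_word q w)) \<in> ?I"
      by (auto simp: Z_def)
    show "b *\<^sub>R f \<in> Z k" for b unfolding Z_def
      using subspace_scale[OF subspace_gsym_ideal c, of b]
      by (intro CollectI exI[of _ "\<lambda>w. b * c w"]) (simp add: scaleR_diff_right scaleR_sum_right)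
    fix g assume "g \<in> Z k"
    then obtain d where d: "g - (\<Sum>w\<in>gmonomials n q k. d w *\<^sub>R word (coord_word q w)) \<in> ?I"
      by (auto simp: Z_def)
    show "f + g \<in> Z k" unfolding Z_def
      using subspace_add[OF subspace_gsym_ideal c d]
      by (intro CollectI exI[of _ "\<lambda>w. c w + d w"]) (simp add: scaleR_add_left sum.distrib algebra_simps)
  qed
  have IZ: "f \<in> ?I \<Longrightarrow> f \<in> Z k" for f k
    unfolding Z_def by (intro CollectI exI[of _ "\<lambda>_. 0"]) simp
  have gc: "gcommuting n q ?I (\<lambda>w. word (coord_word q w))"
    unfolding gcommuting_def
  proof (intro conjI allI impI subspace_gsym_ideal)
    fix u v i j i' j' assume "set (u @ [(i, j), (i', j')] @ v) \<subseteq> gens n q"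
    then show "word (coord_word q (u @ [(i, j), (i', j')] @ v)) -
       (- 1) ^ (i * i') *\<^sub>R word (coord_word q (u @ [(i', j'), (i, j)] @ v)) \<in> ?I"
      using gsym_ideal_comm[of "coord_word q u" n "dual_letters q" "coord_word q v" i "coord (q i) j" i' "coord (q i') j'"]
        coord_word_lists[of u n q] coord_word_lists[of v n q] coord_letter
      by (simp add: coord_word_def gens_def)
  qed
  have sorted: "word (coord_word q s) \<in> Z (wdeg s)" if s: "set s \<subseteq> gens n q" for s
  proof -
    obtain c w where c0: "c = 0 \<or> w \<in> gmonomials n q (wdeg s) \<and> length w = length s"
      "\<And>S (E :: _ \<Rightarrow> ((nat \<Rightarrow>\<^sub>0 real) \<Rightarrow> real) words). gcommuting n q S E \<Longrightarrow> E s - c *\<^sub>R E w \<in> S"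
      by (rule normal_form[OF s]) (rule that, assumption+)
    note c = c0(1) c0(2)[OF gc]
    \<comment> \<open>If \<open>w\<close> is not a monomial then \<open>c\<close> is 0, and the
      identity still holds.\<close>
    have "(\<Sum>w'\<in>gmonomials n q (wdeg s). (if w' = w then c else 0) *\<^sub>R word (coord_word q w')) =
       c *\<^sub>R word (coord_word q w)"
      using c(1) by (auto simp: if_distrib[of "\<lambda>t. t *\<^sub>R _"] sum.delta cong: if_cong)
    then show ?thesis using c(2) unfolding Z_def
      by (intro CollectI exI[of _ "\<lambda>w'. if w' = w then c else 0"]) simp
  qed
  \<comment> \<open>The prefix \<open>s\<close> is already written in coordinates and
    \<open>u\<close> is not yet. The induction moves the first letter of \<open>u\<close> to the end
    of the prefix, which is therefore kept arbitrary.\<close>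
  have gen: "word (coord_word q s @ u) \<in> Z (wdeg s + wdeg u)"
    if "set s \<subseteq> gens n q" "u \<in> lists (letters n (dual_letters q))" for s u
    using that
  proof (induction u arbitrary: s)
    case Nil
    then show ?case using sorted by simp
  next
    case (Cons x u)
    obtain i a where x: "x = (i, a)" by fastforce
    then have i: "i \<in> {1..n}" using Cons.prems by (auto simp: letters_def)
    have "word (coord_word q s @ [(i, coord (q i) j)] @ u) \<in> Z (wdeg s + wdeg (x # u))" if "j < q i" for j
      using Cons.IH[of "s @ [(i, j)]"] Cons.prems that i
      by (simp add: coord_word_def gens_def x add.assoc)
    then have "(\<Sum>j<q i. a (basis_vec j) *\<^sub>R word (coord_word q s @ [(i, coord (q i) j)] @ u)) \<in> Z (wdeg s + wdeg (x # u))"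
      by (intro subspace_sum subspace_scale Z) auto
    moreover have "word (coord_word q s @ [(i, a)] @ u) -
        (\<Sum>j<q i. a (basis_vec j) *\<^sub>R word (coord_word q s @ [(i, coord (q i) j)] @ u)) \<in> Z (wdeg s + wdeg (x # u))"
      using letter_expansion[of "coord_word q s" n q u i a] coord_word_lists Cons.prems x by (intro IZ) auto
    ultimately show ?case
      using subspace_add[OF Z] unfolding x by fastforce
  qed
  have "f \<in> Z k"
  proof (subst words_expand, intro subspace_sum subspace_scale Z)
    fix u assume "u \<in> Poly_Mapping.keys f"
    then show "word u \<in> Z k" using gen[of "[]" u] assms by (auto simp: deg_words_def coord_word_def)
  qed
  then show ?thesis by (simp add: Z_def)
qed

section \<open>Sections as modules over smooth functions\<close>

lemma linear_betweenD:
  assumes "linear_between P Q h"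
  shows "a \<in> carrier P \<Longrightarrow> h a \<in> carrier Q"
    "a \<in> carrier P \<Longrightarrow> b \<in> carrier P \<Longrightarrow> h (a \<oplus>\<^bsub>P\<^esub> b) = h a \<oplus>\<^bsub>Q\<^esub> h b"
    "a \<in> carrier P \<Longrightarrow> h (c \<odot>\<^bsub>P\<^esub> a) = c \<odot>\<^bsub>Q\<^esub> h a"
  using assms by (auto simp: linear_between_def)

lemma additive_finsum:
  fixes F :: "'s \<Rightarrow> real"
  assumes "abelian_group P" and F: "\<And>a b. a \<in> carrier P \<Longrightarrow> b \<in> carrier P \<Longrightarrow> F (a \<oplus>\<^bsub>P\<^esub> b) = F a + F b"
    and "finite I" "g \<in> I \<rightarrow> carrier P"
  shows "F (finsum P g I) = (\<Sum>i\<in>I. F (g i))"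
  using assms(3,4)
proof (induction I)
  case empty
  interpret P: abelian_group P by fact
  have "F \<zero>\<^bsub>P\<^esub> = 0" using F[of "\<zero>\<^bsub>P\<^esub>" "\<zero>\<^bsub>P\<^esub>"] by simp
  then show ?case by simp
next
  case (insert x I)
  interpret P: abelian_group P by fact
  show ?case using insert by (simp add: P.finsum_insert F P.finsum_closed Pi_iff)
qed

lemma hom_finsum:
  assumes "abelian_group P" "abelian_group Q" and h: "\<And>a. a \<in> carrier P \<Longrightarrow> h a \<in> carrier Q"
    "\<And>a b. a \<in> carrier P \<Longrightarrow> b \<in> carrier P \<Longrightarrow> h (a \<oplus>\<^bsub>P\<^esub> b) = h a \<oplus>\<^bsub>Q\<^esub> h b"
    and "finite I" "g \<in> I \<rightarrow> carrier P"
  shows "h (finsum P g I) = finsum Q (\<lambda>i. h (g i)) I"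
  using assms(5,6)
proof (induction I)
  case empty
  interpret P: abelian_group P by fact
  interpret Q: abelian_group Q by fact
  have "h \<zero>\<^bsub>P\<^esub> \<oplus>\<^bsub>Q\<^esub> h \<zero>\<^bsub>P\<^esub> = h \<zero>\<^bsub>P\<^esub>" using h(2)[of "\<zero>\<^bsub>P\<^esub>" "\<zero>\<^bsub>P\<^esub>"] by simp
  then have "h \<zero>\<^bsub>P\<^esub> = \<zero>\<^bsub>Q\<^esub>" using h(1)[of "\<zero>\<^bsub>P\<^esub>"]
    by (metis P.zero_closed Q.add.l_cancel_one')
  then show ?case by simp
next
  case (insert x I)
  interpret P: abelian_group P by fact
  interpret Q: abelian_group Q by fact
  have "(\<lambda>i. h (g i)) \<in> I \<rightarrow> carrier Q" "h (g x) \<in> carrier Q" using insert.prems h(1) by auto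
  then show ?case using insert by (simp add: P.finsum_insert Q.finsum_insert h P.finsum_closed Pi_iff)
qed

text \<open>Fixing one identification \<open>\<kappa>\<close> of degree 0 sections with smooth
  functions lets functions act on sections of every degree.\<close>

locale function_sheaf = smooth_mfd M + graded_comm_sheaf "mtop M" A
  for M :: "'a mfd" and A :: "('a, 's) gsheaf" +
  fixes \<kappa> :: "'a set \<Rightarrow> 's \<Rightarrow> 'a \<Rightarrow> real"
  assumes kappa: "\<forall>U. openin (mtop M) U \<longrightarrow>
       bij_betw (\<kappa> U) (carrier (sec A 0 U)) (C_inf M U) \<and>
       (\<forall>a\<in>carrier (sec A 0 U). \<forall>b\<in>carrier (sec A 0 U). \<forall>x\<in>U.
          \<kappa> U (a \<oplus>\<^bsub>sec A 0 U\<^esub> b) x = \<kappa> U a x + \<kappa> U b x \<and>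
          \<kappa> U (gmul A 0 0 U a b) x = \<kappa> U a x * \<kappa> U b x) \<and>
       (\<forall>c. \<forall>a\<in>carrier (sec A 0 U). \<forall>x\<in>U. \<kappa> U (c \<odot>\<^bsub>sec A 0 U\<^esub> a) x = c * \<kappa> U a x) \<and>
       (\<forall>x\<in>U. \<kappa> U (gone A U) x = 1) \<and>
       (\<forall>V. openin (mtop M) V \<and> V \<subseteq> U \<longrightarrow>
          (\<forall>a\<in>carrier (sec A 0 U). \<kappa> V (res A 0 U V a) = restrict (\<kappa> U a) V))"
begin

abbreviation S where "S k U \<equiv> carrier (sec A k U)"

lemma sec_abelian: "openin X U \<Longrightarrow> abelian_group (sec A k U)"
  using sec_module by (rule module.axioms(2))

lemma add_closed: "openin X U \<Longrightarrow> a \<in> S k U \<Longrightarrow> b \<in> S k U \<Longrightarrow> a \<oplus>\<^bsub>sec A k U\<^esub> b \<in> S k U"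
  by (rule abelian_monoid.a_closed[OF abelian_group.axioms(1)[OF sec_abelian]])

lemma smult_closed: "openin X U \<Longrightarrow> a \<in> S k U \<Longrightarrow> c \<odot>\<^bsub>sec A k U\<^esub> a \<in> S k U"
  using module.smult_closed[OF sec_module, of U c] by (simp add: real_ring_def)

lemma smult_one: "openin X U \<Longrightarrow> a \<in> S k U \<Longrightarrow> 1 \<odot>\<^bsub>sec A k U\<^esub> a = a"
  using module.smult_one[OF sec_module, of U a] by (simp add: real_ring_def)

lemmas mul_left = linear_betweenD[OF mul_left_linear]
lemmas mul_right = linear_betweenD[OF mul_right_linear]
lemmas res_lin = linear_betweenD[OF res_linear]

lemma gmul_closed:
  "openin X U \<Longrightarrow> a \<in> S k U \<Longrightarrow> b \<in> S l U \<Longrightarrow> gmul A k l U a b \<in> S (k + l) U"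
  by (rule mul_left(1))

lemma kappa_inj:
  assumes "openin X U" "a \<in> S 0 U" "b \<in> S 0 U" "\<And>x. x \<in> U \<Longrightarrow> \<kappa> U a x = \<kappa> U b x"
  shows "a = b"
proof -
  have bij: "bij_betw (\<kappa> U) (S 0 U) (C_inf M U)" using kappa assms(1) by blast
  then have "\<kappa> U a \<in> C_inf M U" "\<kappa> U b \<in> C_inf M U" using assms(2,3) bij_betw_apply by metis+
  then have "\<kappa> U a = \<kappa> U b" using assms(4) extensionalityI[of "\<kappa> U a" U "\<kappa> U b"] by (simp add: C_inf_def)
  then show ?thesis using bij assms(2,3) by (auto simp: bij_betw_def inj_on_def)
qed

lemma kappa_smooth:
  assumes "openin X U" "a \<in> S 0 U"
  shows "smooth_fun M U (\<kappa> U a)"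
proof -
  have "bij_betw (\<kappa> U) (S 0 U) (C_inf M U)" using kappa assms(1) by blast
  then have "\<kappa> U a \<in> C_inf M U" using assms(2) bij_betw_apply by metis
  then show ?thesis by (simp add: C_inf_def)
qed

text \<open>The degree 0 section with values \<open>f\<close>, the inverse of
  \<open>\<kappa>\<close>. The restriction is needed because the functions in \<open>C_inf\<close>
  are extensional, whereas those handled below are arbitrary outside \<open>U\<close>.\<close>

definition fsec :: "'a set \<Rightarrow> ('a \<Rightarrow> real) \<Rightarrow> 's" where
  "fsec U f = inv_into (S 0 U) (\<kappa> U) (restrict f U)"

lemma fsec:
  assumes "openin X U" "smooth_fun M U f"
  shows "fsec U f \<in> S 0 U" "x \<in> U \<Longrightarrow> \<kappa> U (fsec U f) x = f x"
proof -
  have "smooth_fun M U (restrict f U)"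
    using smooth_fun_cong[OF assms(1), of "restrict f U" f] assms(2) by simp
  then have "restrict f U \<in> C_inf M U" by (simp add: C_inf_def)
  moreover have "\<kappa> U ` S 0 U = C_inf M U" using kappa assms(1) by (simp add: bij_betw_def)
  ultimately have r: "restrict f U \<in> \<kappa> U ` S 0 U" by simp
  show "fsec U f \<in> S 0 U" unfolding fsec_def by (rule inv_into_into[OF r])
  show "x \<in> U \<Longrightarrow> \<kappa> U (fsec U f) x = f x" unfolding fsec_def f_inv_into_f[OF r] by simp
qed

lemma fsec_eqI:
  assumes "openin X U" "smooth_fun M U f" "a \<in> S 0 U" "\<And>x. x \<in> U \<Longrightarrow> \<kappa> U a x = f x"
  shows "fsec U f = a"
  by (rule kappa_inj[OF assms(1)]) (use assms fsec in auto)

lemma fsec_kappa: "openin X U \<Longrightarrow> a \<in> S 0 U \<Longrightarrow> fsec U (\<kappa> U a) = a"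
  by (rule fsec_eqI) (auto simp: kappa_smooth)

lemma fsec_cong: "(\<And>x. x \<in> U \<Longrightarrow> f x = g x) \<Longrightarrow> fsec U f = fsec U g"
  unfolding fsec_def by (metis restrict_ext)

lemma fsec_res:
  assumes "openin X U" "smooth_fun M U f" "openin X V" "V \<subseteq> U"
  shows "res A 0 U V (fsec U f) = fsec V f"
proof (rule fsec_eqI[symmetric])
  show "smooth_fun M V f" using smooth_fun_mono assms by blast
  show "res A 0 U V (fsec U f) \<in> S 0 V" using res_lin(1) fsec assms by blast
  fix x assume "x \<in> V"
  then show "\<kappa> V (res A 0 U V (fsec U f)) x = f x"
    using kappa assms fsec by auto
qed fact

lemma fsec_add:
  assumes U: "openin X U" and f: "smooth_fun M U f" and g: "smooth_fun M U g"
  shows "fsec U (\<lambda>x. f x + g x) = fsec U f \<oplus>\<^bsub>sec A 0 U\<^esub> fsec U g"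
proof (rule fsec_eqI[OF U smooth_fun_add[OF U f g]])
  show "fsec U f \<oplus>\<^bsub>sec A 0 U\<^esub> fsec U g \<in> S 0 U"
    using add_closed U fsec(1)[OF U f] fsec(1)[OF U g] by blast
  show "\<kappa> U (fsec U f \<oplus>\<^bsub>sec A 0 U\<^esub> fsec U g) x = f x + g x" if "x \<in> U" for x
    using kappa[rule_format, OF U] fsec[OF U f] fsec[OF U g] that by simp
qed

lemma fsec_mult:
  assumes U: "openin X U" and f: "smooth_fun M U f" and g: "smooth_fun M U g"
  shows "fsec U (\<lambda>x. f x * g x) = gmul A 0 0 U (fsec U f) (fsec U g)"
proof (rule fsec_eqI[OF U smooth_fun_mult[OF U f g]])
  show "gmul A 0 0 U (fsec U f) (fsec U g) \<in> S 0 U"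
    using gmul_closed[OF U fsec(1)[OF U f] fsec(1)[OF U g]] by simp
  show "\<kappa> U (gmul A 0 0 U (fsec U f) (fsec U g)) x = f x * g x" if "x \<in> U" for x
    using kappa[rule_format, OF U] fsec[OF U f] fsec[OF U g] that by simp
qed

lemma fsec_const:
  assumes U: "openin X U"
  shows "fsec U (\<lambda>_. c) = c \<odot>\<^bsub>sec A 0 U\<^esub> gone A U"
proof (rule fsec_eqI[OF U smooth_fun_const])
  show "c \<odot>\<^bsub>sec A 0 U\<^esub> gone A U \<in> S 0 U"
    using smult_closed U one_closed by blast
  show "\<kappa> U (c \<odot>\<^bsub>sec A 0 U\<^esub> gone A U) x = c" if "x \<in> U" for x
    using kappa[rule_format, OF U] one_closed[OF U] that by simp
qed

definition act :: "nat \<Rightarrow> 'a set \<Rightarrow> ('a \<Rightarrow> real) \<Rightarrow> 's \<Rightarrow> 's" where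
  "act k U f a = gmul A 0 k U (fsec U f) a"

lemma act_closed: "openin X U \<Longrightarrow> smooth_fun M U f \<Longrightarrow> a \<in> S k U \<Longrightarrow> act k U f a \<in> S k U"
  unfolding act_def using gmul_closed[of U "fsec U f" 0 a k] fsec(1) by simp

lemma act_add:
  "openin X U \<Longrightarrow> smooth_fun M U f \<Longrightarrow> a \<in> S k U \<Longrightarrow> b \<in> S k U \<Longrightarrow>
    act k U f (a \<oplus>\<^bsub>sec A k U\<^esub> b) = act k U f a \<oplus>\<^bsub>sec A k U\<^esub> act k U f b"
  unfolding act_def using mul_right(2)[of U "fsec U f" 0 a k b] fsec(1) by simp

lemma act_add_fun:
  "openin X U \<Longrightarrow> smooth_fun M U f \<Longrightarrow> smooth_fun M U g \<Longrightarrow> a \<in> S k U \<Longrightarrow>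
    act k U (\<lambda>x. f x + g x) a = act k U f a \<oplus>\<^bsub>sec A k U\<^esub> act k U g a"
  unfolding act_def using mul_left(2)[of U a k "fsec U f" 0 "fsec U g"] fsec(1) by (simp add: fsec_add)

lemma act_act:
  "openin X U \<Longrightarrow> smooth_fun M U f \<Longrightarrow> smooth_fun M U g \<Longrightarrow> a \<in> S k U \<Longrightarrow>
    act k U f (act k U g a) = act k U (\<lambda>x. f x * g x) a"
  unfolding act_def using mul_assoc[of U "fsec U f" 0 "fsec U g" 0 a k] fsec(1) by (simp add: fsec_mult)

lemma act_const: "openin X U \<Longrightarrow> a \<in> S k U \<Longrightarrow> act k U (\<lambda>_. c) a = c \<odot>\<^bsub>sec A k U\<^esub> a"
  unfolding act_def using mul_left(3)[of U a k "gone A U" 0 c] one_closed by (simp add: fsec_const one_mul)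

lemma act_res:
  "openin X U \<Longrightarrow> smooth_fun M U f \<Longrightarrow> a \<in> S k U \<Longrightarrow> openin X V \<Longrightarrow> V \<subseteq> U \<Longrightarrow>
    res A k U V (act k U f a) = act k V f (res A k U V a)"
  unfolding act_def using res_mul[of U V "fsec U f" 0 a k] fsec(1) by (simp add: fsec_res)

lemma act_cong: "(\<And>x. x \<in> U \<Longrightarrow> f x = g x) \<Longrightarrow> act k U f a = act k U g a"
  unfolding act_def using fsec_cong by metis

lemma gmul_act_left:
  "openin X U \<Longrightarrow> smooth_fun M U f \<Longrightarrow> a \<in> S k U \<Longrightarrow> b \<in> S l U \<Longrightarrow>
    gmul A k l U (act k U f a) b = act (k + l) U f (gmul A k l U a b)"
  unfolding act_def using mul_assoc[of U "fsec U f" 0 a k b l] fsec(1) by simp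

text \<open>A factor of degree 0 commutes with everything: the sign in graded commutativity has
  exponent k * 0.\<close>

lemma gmul_act_right:
  assumes "openin X U" "smooth_fun M U f" "a \<in> S k U" "b \<in> S l U"
  shows "gmul A k l U a (act l U f b) = act (k + l) U f (gmul A k l U a b)"
proof -
  have f: "fsec U f \<in> S 0 U" using fsec(1) assms by blast
  have "gmul A k 0 U a (fsec U f) = 1 \<odot>\<^bsub>sec A k U\<^esub> gmul A 0 k U (fsec U f) a"
    using mul_comm[of U a k "fsec U f" 0] assms f by simp
  also have "\<dots> = act k U f a"
    using act_closed[of U f a k] assms by (simp add: smult_one act_def)
  finally have "gmul A k 0 U a (fsec U f) = act k U f a" .
  then have "gmul A k l U a (act l U f b) = gmul A k l U (act k U f a) b"
    using mul_assoc[of U a k "fsec U f" 0 b l] assms f by (simp add: act_def)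
  then show ?thesis using gmul_act_left assms by simp
qed

lemma gword_closed:
  assumes "openin X U" "\<And>i j. i \<in> {1..n} \<Longrightarrow> j < q i \<Longrightarrow> \<xi> i j \<in> S i U" "set w \<subseteq> gens n q"
  shows "gword A U \<xi> w \<in> S (wdeg w) U"
  using assms(3)
proof (induction w)
  case Nil
  then show ?case using one_closed assms(1) by simp
next
  case (Cons x w)
  obtain i j where "x = (i, j)" by fastforce
  then show ?case using Cons assms(1,2) by (auto simp: gens_def intro!: gmul_closed)
qed

end

section \<open>Local coefficients\<close>

locale nmfd_chart = function_sheaf M A \<kappa>
  for M :: "'a mfd" and A :: "('a, 's) gsheaf" and \<kappa> +
  fixes n :: nat and q :: "nat \<Rightarrow> nat" and U0 :: "'a set" and \<eta> :: "nat \<Rightarrow> nat \<Rightarrow> 's"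
  assumes U0: "openin (mtop M) U0"
    and free: "freely_generated (mtop M) A n q U0 \<eta>"
begin

abbreviation mons where "mons k \<equiv> gmonomials n q k"

definition mon :: "nat \<Rightarrow> 'a set \<Rightarrow> (nat \<times> nat) list \<Rightarrow> 's" where
  "mon k V w = res A k U0 V (gword A U0 \<eta> w)"

lemma eta_closed: "i \<in> {1..n} \<Longrightarrow> j < q i \<Longrightarrow> \<eta> i j \<in> S i U0"
  using free by (simp add: freely_generated_def)

lemma gword_eta_closed: "w \<in> mons k \<Longrightarrow> gword A U0 \<eta> w \<in> S k U0"
  using gword_closed[where n = n and q = q and \<xi> = \<eta> and w = w, OF U0 eta_closed gmonomialsD(1)]
  by (simp add: gmonomialsD(2))

lemma mon_closed: "openin X V \<Longrightarrow> V \<subseteq> U0 \<Longrightarrow> w \<in> mons k \<Longrightarrow> mon k V w \<in> S k V"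
  unfolding mon_def using res_lin(1) U0 gword_eta_closed by blast

lemma mon_res: "openin X V \<Longrightarrow> V \<subseteq> U0 \<Longrightarrow> openin X V' \<Longrightarrow> V' \<subseteq> V \<Longrightarrow> w \<in> mons k \<Longrightarrow>
    res A k V V' (mon k V w) = mon k V' w"
  unfolding mon_def using res_res U0 gword_eta_closed by blast

definition coeff :: "'a set \<Rightarrow> nat \<Rightarrow> 's \<Rightarrow> (nat \<times> nat) list \<Rightarrow> 'a \<Rightarrow> real" where
  "coeff V k a w = \<kappa> V ((THE c. c \<in> mons k \<rightarrow>\<^sub>E S 0 V \<and>
     a = finsum (sec A k V) (\<lambda>w. gmul A 0 k V (c w) (mon k V w)) (mons k)) w)"

text \<open>The three claims restate freeness with functions as coefficients: smoothness, expansion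
  and uniqueness. Uniqueness yields the rules for sums, multiples and restrictions, since in each
  case the expected coefficients also give an expansion.\<close>

lemma coeff:
  assumes V: "openin X V" "V \<subseteq> U0" and a: "a \<in> S k V"
  shows "w \<in> mons k \<Longrightarrow> smooth_fun M V (coeff V k a w)"
    and "a = finsum (sec A k V) (\<lambda>w. act k V (coeff V k a w) (mon k V w)) (mons k)"
    and "(\<And>w. w \<in> mons k \<Longrightarrow> smooth_fun M V (f w)) \<Longrightarrow>
      a = finsum (sec A k V) (\<lambda>w. act k V (f w) (mon k V w)) (mons k) \<Longrightarrow>
      w \<in> mons k \<Longrightarrow> x \<in> V \<Longrightarrow> coeff V k a w x = f w x"
proof -
  let ?P = "\<lambda>c. c \<in> mons k \<rightarrow>\<^sub>E S 0 V \<and>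
     a = finsum (sec A k V) (\<lambda>w. gmul A 0 k V (c w) (mon k V w)) (mons k)"
  interpret G: abelian_group "sec A k V" by (rule sec_abelian[OF V(1)])
  have ex1: "\<exists>!c. ?P c"
    unfolding mon_def
    by (rule bspec[OF mp[OF spec[OF spec[OF conjunct2[OF free[unfolded freely_generated_def]], of V], of k] conjI[OF V]] a])
  define c where "c = (THE c. ?P c)"
  have c: "?P c" unfolding c_def by (rule theI'[OF ex1])
  have co: "coeff V k a w = \<kappa> V (c w)" for w unfolding coeff_def c_def ..
  have cS: "c w \<in> S 0 V" if "w \<in> mons k" for w using c that by auto
  show "smooth_fun M V (coeff V k a w)" if "w \<in> mons k" for w
    unfolding co by (rule kappa_smooth[OF V(1) cS[OF that]])
  have "act k V (coeff V k a w) (mon k V w) = gmul A 0 k V (c w) (mon k V w)" if "w \<in> mons k" for w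
    unfolding act_def co using fsec_kappa[OF V(1) cS[OF that]] by simp
  moreover have "gmul A 0 k V (c w) (mon k V w) \<in> S k V" if "w \<in> mons k" for w
    using gmul_closed[OF V(1) cS[OF that] mon_closed[OF V that]] by simp
  ultimately show "a = finsum (sec A k V) (\<lambda>w. act k V (coeff V k a w) (mon k V w)) (mons k)"
    using c G.finsum_cong'[of "mons k" "mons k" "\<lambda>w. gmul A 0 k V (c w) (mon k V w)"
        "\<lambda>w. act k V (coeff V k a w) (mon k V w)"] by (auto simp: Pi_iff)
  assume f: "\<And>w. w \<in> mons k \<Longrightarrow> smooth_fun M V (f w)"
    and af: "a = finsum (sec A k V) (\<lambda>w. act k V (f w) (mon k V w)) (mons k)"
    and w: "w \<in> mons k" and x: "x \<in> V"
  let ?c = "\<lambda>w\<in>mons k. fsec V (f w)"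
  have "gmul A 0 k V (fsec V (f w)) (mon k V w) \<in> S k V" if "w \<in> mons k" for w
    using gmul_closed[OF V(1) fsec(1)[OF V(1) f[OF that]] mon_closed[OF V that]] by simp
  then have "finsum (sec A k V) (\<lambda>w. gmul A 0 k V (?c w) (mon k V w)) (mons k) =
     finsum (sec A k V) (\<lambda>w. act k V (f w) (mon k V w)) (mons k)"
    by (intro G.finsum_cong') (auto simp: act_def)
  then have "?P ?c" using af fsec(1)[OF V(1) f] by simp
  then have "c = ?c" using ex1 c by blast
  then show "coeff V k a w x = f w x" using co w x fsec(2)[OF V(1) f] by simp
qed

lemma coeff_mon:
  assumes V: "openin X V" "V \<subseteq> U0" and w: "w \<in> mons k" "w' \<in> mons k" and x: "x \<in> V"
  shows "coeff V k (mon k V w) w' x = (if w' = w then 1 else 0)"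
proof -
  interpret G: abelian_group "sec A k V" by (rule sec_abelian[OF V(1)])
  interpret m: Module.module real_ring "sec A k V" by (rule sec_module[OF V(1)])
  let ?f = "\<lambda>w' _. if w' = w then 1 else (0::real)"
  have a: "act k V (?f w') (mon k V w') = (if w = w' then mon k V w' else \<zero>\<^bsub>sec A k V\<^esub>)" if "w' \<in> mons k" for w'
    using act_const[OF V(1) mon_closed[OF V that]] smult_one[OF V(1) mon_closed[OF V that]]
      m.smult_l_null[OF mon_closed[OF V that]] by (auto simp: real_ring_def)
  have "finsum (sec A k V) (\<lambda>w'. act k V (?f w') (mon k V w')) (mons k) =
      finsum (sec A k V) (\<lambda>w'. if w = w' then mon k V w' else \<zero>\<^bsub>sec A k V\<^esub>) (mons k)"
    using mon_closed[OF V] by (intro G.finsum_cong') (auto simp: a)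
  also have "\<dots> = mon k V w"
    using mon_closed[OF V] w by (intro G.finsum_singleton) auto
  finally show ?thesis
    using coeff(3)[OF V mon_closed[OF V w(1)], of ?f w' x] w x smooth_fun_const by simp
qed

lemma coeff_add:
  assumes V: "openin X V" "V \<subseteq> U0" and a: "a \<in> S k V" "b \<in> S k V" and w: "w \<in> mons k" "x \<in> V"
  shows "coeff V k (a \<oplus>\<^bsub>sec A k V\<^esub> b) w x = coeff V k a w x + coeff V k b w x"
proof -
  interpret G: abelian_group "sec A k V" by (rule sec_abelian[OF V(1)])
  note c = coeff(1)[OF V a(1)] coeff(1)[OF V a(2)]
  have "finsum (sec A k V) (\<lambda>w. act k V (\<lambda>x. coeff V k a w x + coeff V k b w x) (mon k V w)) (mons k) =
     finsum (sec A k V) (\<lambda>w. act k V (coeff V k a w) (mon k V w) \<oplus>\<^bsub>sec A k V\<^esub> act k V (coeff V k b w) (mon k V w)) (mons k)"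
    using c act_closed[OF V(1)] mon_closed[OF V]
    by (intro G.finsum_cong') (auto simp: act_add_fun[OF V(1)])
  also have "\<dots> = finsum (sec A k V) (\<lambda>w. act k V (coeff V k a w) (mon k V w)) (mons k) \<oplus>\<^bsub>sec A k V\<^esub>
     finsum (sec A k V) (\<lambda>w. act k V (coeff V k b w) (mon k V w)) (mons k)"
    using c act_closed[OF V(1)] mon_closed[OF V] by (intro G.finsum_addf) auto
  also have "\<dots> = a \<oplus>\<^bsub>sec A k V\<^esub> b" using coeff(2)[OF V a(1)] coeff(2)[OF V a(2)] by simp
  finally show ?thesis
    using coeff(3)[OF V add_closed[OF V(1) a], of "\<lambda>w x. coeff V k a w x + coeff V k b w x"] c w
      smooth_fun_add[OF V(1)] by simp
qed

lemma coeff_act: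
  assumes V: "openin X V" "V \<subseteq> U0" and a: "a \<in> S k V" and g: "smooth_fun M V g" and w: "w \<in> mons k" "x \<in> V"
  shows "coeff V k (act k V g a) w x = g x * coeff V k a w x"
proof -
  interpret G: abelian_group "sec A k V" by (rule sec_abelian[OF V(1)])
  note c = coeff(1)[OF V a]
  have "act k V g a = act k V g (finsum (sec A k V) (\<lambda>w. act k V (coeff V k a w) (mon k V w)) (mons k))"
    using coeff(2)[OF V a] by simp
  also have "\<dots> = finsum (sec A k V) (\<lambda>w. act k V g (act k V (coeff V k a w) (mon k V w))) (mons k)"
    using c act_closed[OF V(1)] mon_closed[OF V] act_add[OF V(1) g] g
    by (intro hom_finsum sec_abelian V(1)) auto
  also have "\<dots> = finsum (sec A k V) (\<lambda>w. act k V (\<lambda>x. g x * coeff V k a w x) (mon k V w)) (mons k)"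
    using c act_closed[OF V(1)] mon_closed[OF V] g smooth_fun_mult[OF V(1) g]
    by (intro G.finsum_cong') (auto simp: act_act[OF V(1)])
  finally show ?thesis
    using coeff(3)[OF V act_closed[OF V(1) g a], of "\<lambda>w x. g x * coeff V k a w x"] c w
      smooth_fun_mult[OF V(1) g] by simp
qed

lemma coeff_res:
  assumes V: "openin X V" "V \<subseteq> U0" and a: "a \<in> S k V" and V': "openin X V'" "V' \<subseteq> V" and w: "w \<in> mons k" "x \<in> V'"
  shows "coeff V' k (res A k V V' a) w x = coeff V k a w x"
proof -
  interpret G: abelian_group "sec A k V" by (rule sec_abelian[OF V(1)])
  interpret G': abelian_group "sec A k V'" by (rule sec_abelian[OF V'(1)])
  have V'U: "V' \<subseteq> U0" using V V' by blast
  note c = coeff(1)[OF V a]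
  have c': "smooth_fun M V' (coeff V k a w)" if "w \<in> mons k" for w
    using smooth_fun_mono[OF c[OF that] V'(2)] .
  note r = res_lin[OF V(1) V']
  have "res A k V V' a = res A k V V' (finsum (sec A k V) (\<lambda>w. act k V (coeff V k a w) (mon k V w)) (mons k))"
    using coeff(2)[OF V a] by simp
  also have "\<dots> = finsum (sec A k V') (\<lambda>w. res A k V V' (act k V (coeff V k a w) (mon k V w))) (mons k)"
    using c act_closed[OF V(1)] mon_closed[OF V] r
    by (intro hom_finsum sec_abelian V(1) V'(1)) auto
  also have "\<dots> = finsum (sec A k V') (\<lambda>w. act k V' (coeff V k a w) (mon k V' w)) (mons k)"
    using c c' act_closed[OF V'(1)] mon_closed[OF V'(1) V'U] mon_closed[OF V] mon_res[OF V V']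
    by (intro G'.finsum_cong') (auto simp: act_res[OF V(1) _ _ V'])
  finally show ?thesis
    using coeff(3)[OF V'(1) V'U r(1)[OF a], of "coeff V k a"] c' w by simp
qed

text \<open>\<open>F\<close> stands for an evaluation at x: additive, and linear over functions
  through their value at x. Such a functional is known once its values on the monomials are. Changes
  of charts and products are both computed with it.\<close>

lemma functional_expand:
  fixes F :: "'s \<Rightarrow> real"
  assumes V: "openin X V" "V \<subseteq> U0" and a: "a \<in> S k V"
    and F: "\<And>a b. a \<in> S k V \<Longrightarrow> b \<in> S k V \<Longrightarrow> F (a \<oplus>\<^bsub>sec A k V\<^esub> b) = F a + F b"
    "\<And>g a. smooth_fun M V g \<Longrightarrow> a \<in> S k V \<Longrightarrow> F (act k V g a) = g x * F a"
  shows "F a = (\<Sum>w\<in>mons k. coeff V k a w x * F (mon k V w))"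
proof -
  have "F a = F (finsum (sec A k V) (\<lambda>w. act k V (coeff V k a w) (mon k V w)) (mons k))"
    using coeff(2)[OF V a] by simp
  also have "\<dots> = (\<Sum>w\<in>mons k. F (act k V (coeff V k a w) (mon k V w)))"
    using coeff(1)[OF V a] act_closed[OF V(1)] mon_closed[OF V]
    by (intro additive_finsum sec_abelian V F) auto
  also have "\<dots> = (\<Sum>w\<in>mons k. coeff V k a w x * F (mon k V w))"
    using coeff(1)[OF V a] mon_closed[OF V] by (intro sum.cong refl F(2)) auto
  finally show ?thesis .
qed

end

section \<open>Products of homogeneous sections\<close>

text \<open>Products of arbitrary homogeneous sections, of which \<open>gword\<close> is the case of
  generators. The generality is needed later for words in arbitrary dual vectors, whose letters
  become sections.\<close>

fun gprod :: "('a, 's) gsheaf \<Rightarrow> 'a set \<Rightarrow> (nat \<times> 's) list \<Rightarrow> 's" where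
  "gprod A U [] = gone A U"
| "gprod A U ((i, a) # w) = gmul A i (wdeg w) U a (gprod A U w)"

lemma wdeg_case_prod [simp]: "sum_list (map (\<lambda>(i, j). i) w) = wdeg w"
  by (simp add: case_prod_unfold)

lemma gword_eq_gprod: "gword A U \<xi> w = gprod A U (map (\<lambda>(i, j). (i, \<xi> i j)) w)"
proof (induction w)
  case (Cons x w)
  have "wdeg (map (\<lambda>(i, j). (i, \<xi> i j)) w) = wdeg w" by (simp add: case_prod_unfold comp_def)
  then show ?case using Cons by (cases x) simp
qed simp

context function_sheaf
begin

definition hom_sections :: "'a set \<Rightarrow> (nat \<times> 's) set" where
  "hom_sections U = {(i, a). a \<in> S i U}"

lemma gprod_closed: "openin X U \<Longrightarrow> set w \<subseteq> hom_sections U \<Longrightarrow> gprod A U w \<in> S (wdeg w) U"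
proof (induction w)
  case (Cons x w)
  then show ?case by (cases x) (auto simp: hom_sections_def intro!: gmul_closed)
qed (simp add: one_closed)

lemma gprod_append:
  "openin X U \<Longrightarrow> set u \<subseteq> hom_sections U \<Longrightarrow> set v \<subseteq> hom_sections U \<Longrightarrow>
    gprod A U (u @ v) = gmul A (wdeg u) (wdeg v) U (gprod A U u) (gprod A U v)"
proof (induction u)
  case Nil
  then show ?case using one_mul gprod_closed by simp
next
  case (Cons x u)
  obtain i a where x: "x = (i, a)" by fastforce
  have a: "a \<in> S i U" using Cons.prems x by (auto simp: hom_sections_def)
  have "gprod A U u \<in> S (wdeg u) U" "gprod A U v \<in> S (wdeg v) U"
    using gprod_closed Cons.prems by auto
  then show ?case using Cons x mul_assoc[OF Cons.prems(1) a] by simp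
qed

lemma gprod_swap:
  assumes "openin X U" "set (u @ [(i, a), (j, b)] @ v) \<subseteq> hom_sections U"
  shows "gprod A U (u @ [(i, a), (j, b)] @ v) =
    (- 1) ^ (i * j) \<odot>\<^bsub>sec A (wdeg (u @ [(i, a), (j, b)] @ v)) U\<^esub> gprod A U (u @ [(j, b), (i, a)] @ v)"
proof -
  have a: "a \<in> S i U" and b: "b \<in> S j U" and uv: "set u \<subseteq> hom_sections U" "set v \<subseteq> hom_sections U"
    using assms(2) by (auto simp: hom_sections_def)
  let ?v = "gprod A U v" and ?e = "(- 1) ^ (i * j)"
  have v: "?v \<in> S (wdeg v) U" using gprod_closed assms(1) uv by blast
  have ba: "gmul A j i U b a \<in> S (j + i) U" using gmul_closed assms(1) a b by blast
  have "gmul A i (j + wdeg v) U a (gmul A j (wdeg v) U b ?v) = gmul A (i + j) (wdeg v) U (gmul A i j U a b) ?v"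
    using mul_assoc[OF assms(1) a b v] by simp
  also have "gmul A i j U a b = ?e \<odot>\<^bsub>sec A (i + j) U\<^esub> gmul A j i U b a"
    by (rule mul_comm[OF assms(1) a b])
  also have "gmul A (i + j) (wdeg v) U (?e \<odot>\<^bsub>sec A (i + j) U\<^esub> gmul A j i U b a) ?v =
      ?e \<odot>\<^bsub>sec A (i + j + wdeg v) U\<^esub> gmul A (j + i) (wdeg v) U (gmul A j i U b a) ?v"
    using mul_left(3)[OF assms(1) v, of "gmul A j i U b a" "i + j" ?e] ba by (simp add: add.commute)
  also have "gmul A (j + i) (wdeg v) U (gmul A j i U b a) ?v = gmul A j (i + wdeg v) U b (gmul A i (wdeg v) U a ?v)"
    by (rule mul_assoc[OF assms(1) b a v])
  finally have eq: "gprod A U ([(i, a), (j, b)] @ v) =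
      ?e \<odot>\<^bsub>sec A (i + (j + wdeg v)) U\<^esub> gprod A U ([(j, b), (i, a)] @ v)" by (simp add: add.assoc)
  have s1: "set ([(i, a), (j, b)] @ v) \<subseteq> hom_sections U" and s2: "set ([(j, b), (i, a)] @ v) \<subseteq> hom_sections U"
    using assms(2) by auto
  have g2: "gprod A U ([(j, b), (i, a)] @ v) \<in> S (i + (j + wdeg v)) U"
    using gprod_closed[OF assms(1) s2] by (simp add: add.left_commute)
  have "gprod A U (u @ ([(i, a), (j, b)] @ v)) =
     gmul A (wdeg u) (i + (j + wdeg v)) U (gprod A U u) (gprod A U ([(i, a), (j, b)] @ v))"
    using gprod_append[OF assms(1) uv(1) s1] by simp
  also have "\<dots> = ?e \<odot>\<^bsub>sec A (wdeg u + (i + (j + wdeg v))) U\<^esub>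
     gmul A (wdeg u) (i + (j + wdeg v)) U (gprod A U u) (gprod A U ([(j, b), (i, a)] @ v))"
    unfolding eq by (rule mul_right(3)[OF assms(1) gprod_closed[OF assms(1) uv(1)] g2])
  also have "gmul A (wdeg u) (i + (j + wdeg v)) U (gprod A U u) (gprod A U ([(j, b), (i, a)] @ v)) =
     gprod A U (u @ ([(j, b), (i, a)] @ v))"
    using gprod_append[OF assms(1) uv(1) s2] by (simp add: add.left_commute)
  finally show ?thesis by simp
qed

lemma gprod_add:
  assumes "openin X U" "set u \<subseteq> hom_sections U" "set v \<subseteq> hom_sections U" "a \<in> S i U" "b \<in> S i U"
  shows "gprod A U (u @ [(i, a \<oplus>\<^bsub>sec A i U\<^esub> b)] @ v) =
    gprod A U (u @ [(i, a)] @ v) \<oplus>\<^bsub>sec A (wdeg (u @ [(i, a)] @ v)) U\<^esub> gprod A U (u @ [(i, b)] @ v)"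
proof -
  have v: "gprod A U v \<in> S (wdeg v) U" and u: "gprod A U u \<in> S (wdeg u) U"
    using gprod_closed assms by blast+
  have s: "set ([(i, c)] @ v) \<subseteq> hom_sections U" if "c \<in> S i U" for c
    using that assms by (auto simp: hom_sections_def)
  note cl = add_closed[OF assms(1,4,5)]
  note app = gprod_append[OF assms(1,2) s]
  have vc: "gmul A i (wdeg v) U c (gprod A U v) \<in> S (i + wdeg v) U" if "c \<in> S i U" for c
    using gmul_closed assms(1) that v by blast
  show ?thesis
    using app[OF cl] app[OF assms(4)] app[OF assms(5)] mul_left(2)[OF assms(1) v assms(4,5)]
      mul_right(2)[OF assms(1) u vc[OF assms(4)] vc[OF assms(5)]] by simp
qed

lemma gprod_smult:
  assumes "openin X U" "set u \<subseteq> hom_sections U" "set v \<subseteq> hom_sections U" "a \<in> S i U"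
  shows "gprod A U (u @ [(i, c \<odot>\<^bsub>sec A i U\<^esub> a)] @ v) =
    c \<odot>\<^bsub>sec A (wdeg (u @ [(i, a)] @ v)) U\<^esub> gprod A U (u @ [(i, a)] @ v)"
proof -
  have v: "gprod A U v \<in> S (wdeg v) U" and u: "gprod A U u \<in> S (wdeg u) U"
    using gprod_closed assms by blast+
  have s: "set ([(i, d)] @ v) \<subseteq> hom_sections U" if "d \<in> S i U" for d
    using that assms by (auto simp: hom_sections_def)
  note cl = smult_closed[OF assms(1,4)]
  note app = gprod_append[OF assms(1,2) s]
  have vc: "gmul A i (wdeg v) U a (gprod A U v) \<in> S (i + wdeg v) U"
    using gmul_closed assms(1,4) v by blast
  show ?thesis
    using app[OF cl] app[OF assms(4)] mul_left(3)[OF assms(1) v assms(4)]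
      mul_right(3)[OF assms(1) u vc] by simp
qed

end

section \<open>Values of sections\<close>

text \<open>Local finiteness is stated with a neighbourhood contained in all the charts that
  contribute there, so that every summand of a local average is a section over the whole
  neighbourhood.\<close>

locale nmfd = function_sheaf M A \<kappa>
  for M :: "'a mfd" and A :: "('a, 's) gsheaf" and \<kappa> +
  fixes n :: nat and q :: "nat \<Rightarrow> nat" and Uc :: "nat \<Rightarrow> 'a set" and \<eta> :: "nat \<Rightarrow> nat \<Rightarrow> nat \<Rightarrow> 's"
    and \<rho> :: "nat \<Rightarrow> 'a \<Rightarrow> real"
  assumes Uc: "\<And>m. openin (mtop M) (Uc m)"
    and Uc_free: "\<And>m. freely_generated (mtop M) A n q (Uc m) (\<eta> m)"
    and rho_smooth: "\<And>m. smooth_fun M (topspace (mtop M)) (\<rho> m)"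
    and rho_local: "\<And>x. x \<in> topspace (mtop M) \<Longrightarrow> \<exists>N F. openin (mtop M) N \<and> x \<in> N \<and> finite F \<and>
       (\<forall>m\<in>F. N \<subseteq> Uc m) \<and> (\<forall>m. m \<notin> F \<longrightarrow> (\<forall>y\<in>N. \<rho> m y = 0)) \<and> (\<forall>y\<in>N. (\<Sum>m\<in>F. \<rho> m y) = 1)"
begin

sublocale chart: nmfd_chart M A \<kappa> n q "Uc m" "\<eta> m" for m
  by unfold_locales (use Uc Uc_free in auto)

abbreviation mons where "mons k \<equiv> gmonomials n q k"
lemma mons_singleton: "i \<in> {1..n} \<Longrightarrow> j < q i \<Longrightarrow> [(i, j)] \<in> mons i"
  by (rule gmonomials_singleton)

abbreviation eta_word where "eta_word m w \<equiv> gword A (Uc m) (\<eta> m) w"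

lemma cover: "x \<in> topspace X \<Longrightarrow> \<exists>m. x \<in> Uc m"
  using rho_local[of x] by (metis (no_types, lifting) subsetD sum.neutral zero_neq_one)

text \<open>Restricting to \<open>U \<inter> Uc m\<close> first makes the coefficient meaningful for
  a section over any open set; its values are used only at points of this intersection.\<close>

definition val :: "nat \<Rightarrow> 'a set \<Rightarrow> nat \<Rightarrow> 's \<Rightarrow> (nat \<times> nat) list \<Rightarrow> 'a \<Rightarrow> real" where
  "val m U k a w = chart.coeff m (U \<inter> Uc m) k (res A k U (U \<inter> Uc m) a) w"

lemma eta_word_closed: "w \<in> mons k \<Longrightarrow> eta_word m w \<in> S k (Uc m)"
  by (rule chart.gword_eta_closed)

lemma val_coeff:
  assumes "openin X V" "V \<subseteq> Uc m" "a \<in> S k V"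
  shows "val m V k a w = chart.coeff m V k a w"
  using assms res_self[of V a k] unfolding val_def by (simp add: Int_absorb2)

context
  fixes U assumes U: "openin X U"
begin

lemma inter_Uc: "openin X (U \<inter> Uc m)" "U \<inter> Uc m \<subseteq> U" "U \<inter> Uc m \<subseteq> Uc m"
  using U Uc by auto

lemmas res_inter_Uc = res_lin[OF U inter_Uc(1,2)]

lemma val_smooth: "a \<in> S k U \<Longrightarrow> w \<in> mons k \<Longrightarrow> smooth_fun M (U \<inter> Uc m) (val m U k a w)"
  unfolding val_def by (rule chart.coeff(1)[OF inter_Uc(1,3) res_inter_Uc(1)])

lemma val_add:
  "a \<in> S k U \<Longrightarrow> b \<in> S k U \<Longrightarrow> w \<in> mons k \<Longrightarrow> x \<in> U \<Longrightarrow> x \<in> Uc m \<Longrightarrow>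
    val m U k (a \<oplus>\<^bsub>sec A k U\<^esub> b) w x = val m U k a w x + val m U k b w x"
  unfolding val_def by (simp add: res_inter_Uc chart.coeff_add[OF inter_Uc(1,3)])

lemma val_act:
  assumes "a \<in> S k U" "smooth_fun M U g" "w \<in> mons k" "x \<in> U" "x \<in> Uc m"
  shows "val m U k (act k U g a) w x = g x * val m U k a w x"
proof -
  have "smooth_fun M (U \<inter> Uc m) g" using assms(2) smooth_fun_mono inter_Uc(2) by blast
  then show ?thesis unfolding val_def
    using assms by (simp add: act_res[OF U _ _ inter_Uc(1,2)] res_inter_Uc chart.coeff_act[OF inter_Uc(1,3)])
qed

lemma val_smult:
  "a \<in> S k U \<Longrightarrow> w \<in> mons k \<Longrightarrow> x \<in> U \<Longrightarrow> x \<in> Uc m \<Longrightarrow>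
    val m U k (c \<odot>\<^bsub>sec A k U\<^esub> a) w x = c * val m U k a w x"
  using val_act[of a k "\<lambda>_. c" w x m] act_const[OF U, of a k c] smooth_fun_const by simp

lemma val_finsum:
  assumes "finite I" "\<And>i. i \<in> I \<Longrightarrow> g i \<in> S k U" "w \<in> mons k" "x \<in> U" "x \<in> Uc m"
  shows "val m U k (finsum (sec A k U) g I) w x = (\<Sum>i\<in>I. val m U k (g i) w x)"
  using assms by (intro additive_finsum[OF sec_abelian[OF U]] val_add) auto

lemma val_res:
  assumes "a \<in> S k U" "openin X V" "V \<subseteq> U" "w \<in> mons k" "x \<in> V" "x \<in> Uc m"
  shows "val m V k (res A k U V a) w x = val m U k a w x"
proof -
  have V: "openin X (V \<inter> Uc m)" "V \<inter> Uc m \<subseteq> V" "V \<inter> Uc m \<subseteq> U \<inter> Uc m"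
    using assms Uc by auto
  have "res A k V (V \<inter> Uc m) (res A k U V a) = res A k U (V \<inter> Uc m) a"
    using res_res[OF U assms(2) V(1,2) assms(3,1)] .
  also have "\<dots> = res A k (U \<inter> Uc m) (V \<inter> Uc m) (res A k U (U \<inter> Uc m) a)"
    using res_res[OF U inter_Uc(1) V(1,3) inter_Uc(2) assms(1)] by simp
  finally show ?thesis unfolding val_def
    using chart.coeff_res[OF inter_Uc(1,3) res_inter_Uc(1)[OF assms(1)] V(1,3) assms(4)] assms(5,6) by simp
qed

lemma val_functional:
  fixes F :: "'s \<Rightarrow> real"
  assumes a: "a \<in> S k U"
    and F: "\<And>a b. a \<in> S k (U \<inter> Uc m) \<Longrightarrow> b \<in> S k (U \<inter> Uc m) \<Longrightarrow> F (a \<oplus>\<^bsub>sec A k (U \<inter> Uc m)\<^esub> b) = F a + F b"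
    "\<And>g a. smooth_fun M (U \<inter> Uc m) g \<Longrightarrow> a \<in> S k (U \<inter> Uc m) \<Longrightarrow> F (act k (U \<inter> Uc m) g a) = g x * F a"
  shows "F (res A k U (U \<inter> Uc m) a) = (\<Sum>w\<in>mons k. val m U k a w x * F (res A k (Uc m) (U \<inter> Uc m) (eta_word m w)))"
  using chart.functional_expand[OF inter_Uc(1,3) res_inter_Uc(1)[OF a], where F = F and x = x, OF F]
  unfolding val_def chart.mon_def .

end

lemma val_eta_word:
  assumes "w \<in> mons k" "w' \<in> mons k" "x \<in> Uc m"
  shows "val m (Uc m) k (eta_word m w) w' x = (if w' = w then 1 else 0)"
proof -
  have "chart.mon m k (Uc m) w = eta_word m w"
    unfolding chart.mon_def using res_self[OF Uc eta_word_closed[OF assms(1)]] .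
  then show ?thesis
    using chart.coeff_mon[OF Uc subset_refl assms] val_coeff[OF Uc subset_refl eta_word_closed[OF assms(1)]] by simp
qed

text \<open>Taking a coefficient in chart m' at x is additive and linear over functions through
  their value at x, hence determined by its values on the monomials of chart m.\<close>

lemma val_change:
  assumes U: "openin X U" and a: "a \<in> S k U" and x: "x \<in> U" "x \<in> Uc m" "x \<in> Uc m'" and w': "w' \<in> mons k"
  shows "val m' U k a w' x = (\<Sum>w\<in>mons k. val m U k a w x * val m' (Uc m) k (eta_word m w) w' x)"
proof -
  let ?V = "U \<inter> Uc m"
  have V: "openin X ?V" "?V \<subseteq> U" "?V \<subseteq> Uc m" using U Uc by auto
  have "val m' ?V k (res A k U ?V a) w' x = (\<Sum>w\<in>mons k. val m U k a w x * val m' ?V k (res A k (Uc m) ?V (eta_word m w)) w' x)"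
    by (rule val_functional[OF U a]) (use val_add[OF V(1)] val_act[OF V(1)] w' x in auto)
  also have "\<dots> = (\<Sum>w\<in>mons k. val m U k a w x * val m' (Uc m) k (eta_word m w) w' x)"
    using val_res[OF Uc eta_word_closed V(1,3) w'] x by (intro sum.cong) auto
  finally show ?thesis using val_res[OF U a V(1,2) w'] x by simp
qed

text \<open>By \<open>val_change\<close> the coefficients in the second chart are fixed linear
  functions of those in the first, so linear relations at x carry over, even between sections over
  different open sets.\<close>

lemma val_linear_relation:
  assumes U: "openin X U" "a \<in> S k U" "x \<in> U" "x \<in> Uc m" "x \<in> Uc m'"
    and V: "\<And>i. i \<in> I \<Longrightarrow> openin X (V i)" "\<And>i. i \<in> I \<Longrightarrow> b i \<in> S k (V i)" "\<And>i. i \<in> I \<Longrightarrow> x \<in> V i"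
    and rel: "\<And>w. w \<in> mons k \<Longrightarrow> val m U k a w x = (\<Sum>i\<in>I. c i * val m (V i) k (b i) w x)"
    and w: "w \<in> mons k"
  shows "val m' U k a w x = (\<Sum>i\<in>I. c i * val m' (V i) k (b i) w x)"
proof -
  let ?T = "\<lambda>u. val m' (Uc m) k (eta_word m u) w x"
  have "val m' U k a w x = (\<Sum>u\<in>mons k. (\<Sum>i\<in>I. c i * val m (V i) k (b i) u x) * ?T u)"
    using val_change[OF U w] rel by simp
  also have "\<dots> = (\<Sum>i\<in>I. c i * (\<Sum>u\<in>mons k. val m (V i) k (b i) u x * ?T u))"
    by (simp add: sum_distrib_left sum_distrib_right mult.assoc) (rule sum.swap)
  also have "\<dots> = (\<Sum>i\<in>I. c i * val m' (V i) k (b i) w x)"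
    by (intro sum.cong refl) (use val_change[OF V U(4,5) w] in simp)
  finally show ?thesis .
qed

text \<open>The structure constants, at a point, of the multiplication in the basis of monomials of
  chart m.\<close>

definition eta_word_mult :: "nat \<Rightarrow> nat \<Rightarrow> nat \<Rightarrow> (nat \<times> nat) list \<Rightarrow> (nat \<times> nat) list \<Rightarrow> (nat \<times> nat) list \<Rightarrow> 'a \<Rightarrow> real" where
  "eta_word_mult m k l u v w x = val m (Uc m) (k + l) (gmul A k l (Uc m) (eta_word m u) (eta_word m v)) w x"

text \<open>The product is linear over functions in each argument. Expanding the first factor and
  then the second shows that the value of a product at x depends only on the values of the factors
  at x.\<close>

lemma val_gmul:
  assumes U: "openin X U" and a: "a \<in> S k U" and b: "b \<in> S l U" and w: "w \<in> mons (k + l)" and x: "x \<in> U" "x \<in> Uc m"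
  shows "val m U (k + l) (gmul A k l U a b) w x =
    (\<Sum>u\<in>mons k. \<Sum>v\<in>mons l. val m U k a u x * val m U l b v x * eta_word_mult m k l u v w x)"
proof -
  let ?V = "U \<inter> Uc m"
  have V: "openin X ?V" "?V \<subseteq> U" "?V \<subseteq> Uc m" using U Uc by auto
  note r = res_lin(1)[OF U V(1,2)] and rm = res_lin(1)[OF Uc V(1,3)]
  note va = val_add[OF V(1)] and vc = val_act[OF V(1)]
  let ?u = "\<lambda>u. res A k (Uc m) ?V (eta_word m u)" and ?v = "\<lambda>v. res A l (Uc m) ?V (eta_word m v)"
  have u: "?u u \<in> S k ?V" if "u \<in> mons k" for u using rm eta_word_closed that by blast
  have v: "?v v \<in> S l ?V" if "v \<in> mons l" for v using rm eta_word_closed that by blast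
  have "val m U (k + l) (gmul A k l U a b) w x = val m ?V (k + l) (res A (k + l) U ?V (gmul A k l U a b)) w x"
    using val_res[OF U gmul_closed[OF U a b] V(1,2) w] x by simp
  also have "\<dots> = val m ?V (k + l) (gmul A k l ?V (res A k U ?V a) (res A l U ?V b)) w x"
    using res_mul[OF U V(1,2) a b] by simp
  also have "\<dots> = (\<Sum>u\<in>mons k. val m U k a u x * val m ?V (k + l) (gmul A k l ?V (?u u) (res A l U ?V b)) w x)"
    by (rule val_functional[OF U a])
      (use va vc gmul_closed[OF V(1)] mul_left(2)[OF V(1)] gmul_act_left[OF V(1)] r b w x in auto)
  also have "\<dots> = (\<Sum>u\<in>mons k. val m U k a u x * (\<Sum>v\<in>mons l. val m U l b v x * val m ?V (k + l) (gmul A k l ?V (?u u) (?v v)) w x))"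
    by (intro sum.cong refl arg_cong2[of _ _ _ _ "(*)"] val_functional[OF U b])
      (use va vc gmul_closed[OF V(1)] mul_right(2)[OF V(1)] gmul_act_right[OF V(1)] u w x in auto)
  also have "\<dots> = (\<Sum>u\<in>mons k. \<Sum>v\<in>mons l. val m U k a u x * val m U l b v x * eta_word_mult m k l u v w x)"
  proof (simp only: sum_distrib_left, intro sum.cong refl)
    fix u' v' assume uv: "u' \<in> mons k" "v' \<in> mons l"
    have "val m ?V (k + l) (gmul A k l ?V (?u u') (?v v')) w x = eta_word_mult m k l u' v' w x"
      unfolding eta_word_mult_def
      using res_mul[OF Uc V(1,3) eta_word_closed[OF uv(1)] eta_word_closed[OF uv(2)]]
        val_res[OF Uc gmul_closed[OF Uc eta_word_closed[OF uv(1)] eta_word_closed[OF uv(2)]] V(1,3) w] x by simp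
    then show "val m U k a u' x * (val m U l b v' x * val m ?V (k + l) (gmul A k l ?V (?u u') (?v v')) w x) =
        val m U k a u' x * val m U l b v' x * eta_word_mult m k l u' v' w x" by simp
  qed
  finally show ?thesis .
qed

text \<open>Equality of values in one chart around a point implies it in every other, by the change
  of charts; then the expansions agree over each \<open>U \<inter> Uc m\<close>, and locality
  applies.\<close>

lemma val_inj:
  assumes U: "openin X U" and a: "a \<in> S k U" and b: "b \<in> S k U"
    and eq: "\<And>x. x \<in> U \<Longrightarrow> \<exists>m. x \<in> Uc m \<and> (\<forall>w\<in>mons k. val m U k a w x = val m U k b w x)"
  shows "a = b"
proof -
  have all: "val m U k a w x = val m U k b w x" if "x \<in> U" "x \<in> Uc m" "w \<in> mons k" for m w x
    using eq[OF that(1)] val_change[OF U a that(1) _ that(2,3)] val_change[OF U b that(1) _ that(2,3)] by force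
  let ?\<U> = "range (\<lambda>m. U \<inter> Uc m)"
  have un: "\<Union>?\<U> = U" using cover openin_subset[OF U] by blast
  have "res A k U V a = res A k U V b" if VU: "V \<in> ?\<U>" for V
  proof -
    obtain m where V: "V = U \<inter> Uc m" using VU by blast
    note UVm = inter_Uc[OF U, of m]
    interpret G: abelian_group "sec A k (U \<inter> Uc m)" by (rule sec_abelian[OF UVm(1)])
    note r = res_lin(1)[OF U UVm(1,2)]
    let ?c = "\<lambda>a w. act k (U \<inter> Uc m) (val m U k a w) (chart.mon m k (U \<inter> Uc m) w)"
    have "?c a w = ?c b w" if "w \<in> mons k" for w
      by (rule act_cong) (use all that in auto)
    moreover have "?c b w \<in> S k (U \<inter> Uc m)" if "w \<in> mons k" for w
      using act_closed[OF UVm(1) val_smooth[OF U b that] chart.mon_closed[OF UVm(1,3) that]] .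
    ultimately have "finsum (sec A k (U \<inter> Uc m)) (?c a) (mons k) = finsum (sec A k (U \<inter> Uc m)) (?c b) (mons k)"
      by (intro G.finsum_cong') auto
    then show ?thesis unfolding V
      using chart.coeff(2)[OF UVm(1,3) r[OF a]] chart.coeff(2)[OF UVm(1,3) r[OF b]] by (simp add: val_def)
  qed
  then show ?thesis using locality[of ?\<U> a k b] a b inter_Uc(1)[OF U] unfolding un by blast
qed

text \<open>\<open>D\<close> selects the charts in which the prescribed values are tested at a
  point: all of them when the averages are built, only \<open>ch x\<close> when \<open>Psi\<close>
  is shown to be surjective. One tested chart per point suffices for local solutions to agree on
  overlaps, because values in one chart determine a section.\<close>

lemma sections_glue:
  assumes U: "openin X U" and D: "\<And>x. x \<in> U \<Longrightarrow> \<exists>m. D m x \<and> x \<in> Uc m"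
    and loc: "\<And>x. x \<in> U \<Longrightarrow> \<exists>N t. openin X N \<and> x \<in> N \<and> N \<subseteq> U \<and> t \<in> S k N \<and>
      (\<forall>y\<in>N. \<forall>m. D m y \<longrightarrow> y \<in> Uc m \<longrightarrow> (\<forall>w\<in>mons k. val m N k t w y = v m w y))"
  obtains a where "a \<in> S k U"
    "\<And>y m w. y \<in> U \<Longrightarrow> D m y \<Longrightarrow> y \<in> Uc m \<Longrightarrow> w \<in> mons k \<Longrightarrow> val m U k a w y = v m w y"
proof -
  define P where "P N t \<longleftrightarrow> t \<in> S k N \<and>
      (\<forall>y\<in>N. \<forall>m. D m y \<longrightarrow> y \<in> Uc m \<longrightarrow> (\<forall>w\<in>mons k. val m N k t w y = v m w y))" for N t
  define \<U> where "\<U> = {N. openin X N \<and> N \<subseteq> U \<and> (\<exists>t. P N t)}"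
  define s where "s N = (SOME t. P N t)" for N
  have s: "P N (s N)" if NU: "N \<in> \<U>" for N
  proof -
    have "\<exists>t. P N t" using NU unfolding \<U>_def by (elim CollectE conjE)
    then show ?thesis unfolding s_def by (rule someI_ex)
  qed
  have o: "openin X N" if "N \<in> \<U>" for N using that by (simp add: \<U>_def)
  have un: "\<Union>\<U> = U"
  proof
    show "\<Union>\<U> \<subseteq> U" unfolding \<U>_def by blast
    show "U \<subseteq> \<Union>\<U>"
    proof
      fix x assume x: "x \<in> U"
      obtain N t where N: "openin X N" "x \<in> N" "N \<subseteq> U" "t \<in> S k N"
        "\<forall>y\<in>N. \<forall>m. D m y \<longrightarrow> y \<in> Uc m \<longrightarrow> (\<forall>w\<in>mons k. val m N k t w y = v m w y)"
        using loc[OF x] by (elim exE conjE) (rule that)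
      have "P N t" unfolding P_def using N(4,5) by (rule conjI)
      then have "N \<in> \<U>" unfolding \<U>_def using N(1,3) by blast
      then show "x \<in> \<Union>\<U>" using N(2) by blast
    qed
  qed
  have "\<exists>a\<in>S k (\<Union>\<U>). \<forall>N\<in>\<U>. res A k (\<Union>\<U>) N a = s N"
  proof (rule gluing)
    fix N N' assume N: "N \<in> \<U>" "N' \<in> \<U>"
    have oo: "openin X (N \<inter> N')" using N o by blast
    have PN: "s N \<in> S k N" "s N' \<in> S k N'" using s N by (auto simp: P_def)
    show "res A k N (N \<inter> N') (s N) = res A k N' (N \<inter> N') (s N')"
    proof (rule val_inj[OF oo])
      show "res A k N (N \<inter> N') (s N) \<in> S k (N \<inter> N')" "res A k N' (N \<inter> N') (s N') \<in> S k (N \<inter> N')"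
        using res_lin(1) o N oo PN by blast+
      fix x assume x: "x \<in> N \<inter> N'"
      then have "x \<in> U" using N un by blast
      then obtain m where m: "D m x" "x \<in> Uc m" using D by blast
      have "val m (N \<inter> N') k (res A k N (N \<inter> N') (s N)) w x = val m (N \<inter> N') k (res A k N' (N \<inter> N') (s N')) w x"
        if w: "w \<in> mons k" for w
        using val_res[OF o[OF N(1)] PN(1) oo _ w x m(2)] val_res[OF o[OF N(2)] PN(2) oo _ w x m(2)]
          s[OF N(1)] s[OF N(2)] x m w by (auto simp: P_def)
      then show "\<exists>m. x \<in> Uc m \<and> (\<forall>w\<in>mons k. val m (N \<inter> N') k (res A k N (N \<inter> N') (s N)) w x =
          val m (N \<inter> N') k (res A k N' (N \<inter> N') (s N')) w x)" using m by blast
    qed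
  qed (use o s in \<open>auto simp: P_def\<close>)
  then obtain a where a: "a \<in> S k U" "\<And>N. N \<in> \<U> \<Longrightarrow> res A k U N a = s N" unfolding un by blast
  show thesis
  proof (rule that[OF a(1)])
    fix y m w assume y: "y \<in> U" "D m y" "y \<in> Uc m" "w \<in> mons k"
    then have "y \<in> \<Union>\<U>" by (simp only: un)
    then obtain N where N: "N \<in> \<U>" "y \<in> N" by blast
    have "N \<subseteq> U" using N by (simp add: \<U>_def)
    then have "val m U k a w y = val m N k (s N) w y"
      using val_res[OF U a(1) o[OF N(1)] _ y(4) N(2) y(3)] a(2)[OF N(1)] by simp
    then show "val m U k a w y = v m w y" using s[OF N(1)] N(2) y by (auto simp: P_def)
  qed
qed

text \<open>Words of different degrees produce sections in different modules. Taking a coefficient,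
  and 0 if \<open>w\<close> does not have the degree of the word, gives one real-valued evaluation
  of all words.\<close>

lemma gcommuting_gword:
  assumes U: "openin X U" and xi: "\<And>i j. i \<in> {1..n} \<Longrightarrow> j < q i \<Longrightarrow> \<xi> i j \<in> S i U"
    and x: "x \<in> U" "x \<in> Uc m"
  shows "gcommuting n q {0} (\<lambda>u. if w \<in> mons (wdeg u) then val m U (wdeg u) (gword A U \<xi> u) w x else 0 :: real)"
  unfolding gcommuting_def
proof (intro conjI allI impI)
  fix u v i j i' j' assume s: "set (u @ [(i, j), (i', j')] @ v) \<subseteq> gens n q"
  let ?f = "\<lambda>(i, j). (i, \<xi> i j)"
  let ?u = "u @ [(i, j), (i', j')] @ v" and ?u' = "u @ [(i', j'), (i, j)] @ v"
  have d: "wdeg ?u' = wdeg ?u" by simp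
  have hs: "set (map ?f ?u) \<subseteq> hom_sections U"
    using s xi by (auto simp: hom_sections_def gens_def)
  have wd: "wdeg (map ?f w) = wdeg w" for w by (simp add: case_prod_unfold comp_def)
  have cl: "gword A U \<xi> ?u' \<in> S (wdeg ?u) U"
  proof -
    have "set ?u' \<subseteq> gens n q" using s by auto
    from gword_closed[where n = n and q = q and \<xi> = \<xi>, OF U xi this] show ?thesis by (simp add: d add.left_commute)
  qed
  have "gword A U \<xi> ?u = (- 1) ^ (i * i') \<odot>\<^bsub>sec A (wdeg ?u) U\<^esub> gword A U \<xi> ?u'"
    using gprod_swap[OF U, of "map ?f u" i "\<xi> i j" i' "\<xi> i' j'" "map ?f v"] hs
    by (simp add: gword_eq_gprod wd)
  then show "(if w \<in> mons (wdeg ?u) then val m U (wdeg ?u) (gword A U \<xi> ?u) w x else 0) -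
       (- 1) ^ (i * i') *\<^sub>R (if w \<in> mons (wdeg ?u') then val m U (wdeg ?u') (gword A U \<xi> ?u') w x else 0) \<in> {0}"
    unfolding d using val_smult[OF U cl _ x] by simp
qed (rule subspace_single_0)

text \<open>The reduction concerns the word only, so one pair \<open>c\<close>, \<open>v\<close>
  serves all sections put in place of the generators; it is applied to \<open>\<eta>\<close> for
  linear parts and to \<open>xi\<close> for generation. Hence the order of the quantifiers.\<close>

lemma gword_normal_form:
  assumes "set u \<subseteq> gens n q"
  shows "\<exists>c v. (c = 0 \<or> v \<in> mons (wdeg u) \<and> length v = length u) \<and>
    (\<forall>U \<xi> m w x. openin X U \<longrightarrow> (\<forall>i\<in>{1..n}. \<forall>j<q i. \<xi> i j \<in> S i U) \<longrightarrow> x \<in> U \<longrightarrow> x \<in> Uc m \<longrightarrow>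
      w \<in> mons (wdeg u) \<longrightarrow> val m U (wdeg u) (gword A U \<xi> u) w x = c * val m U (wdeg u) (gword A U \<xi> v) w x)"
proof -
  obtain c v where c: "c = 0 \<or> v \<in> mons (wdeg u) \<and> length v = length u"
    "\<And>S (E :: _ \<Rightarrow> real). gcommuting n q S E \<Longrightarrow> E u - c *\<^sub>R E v \<in> S"
    by (rule normal_form[OF assms]) (rule that, assumption+)
  have "val m U (wdeg u) (gword A U \<xi> u) w x = c * val m U (wdeg u) (gword A U \<xi> v) w x"
    if *: "openin X U" "\<forall>i\<in>{1..n}. \<forall>j<q i. \<xi> i j \<in> S i U" "x \<in> U" "x \<in> Uc m" "w \<in> mons (wdeg u)"
    for U \<xi> m w x
  proof -
    have xi: "\<xi> i j \<in> S i U" if "i \<in> {1..n}" "j < q i" for i j using *(2) that by blast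
    have "c \<noteq> 0 \<Longrightarrow> wdeg v = wdeg u" using c(1) gmonomialsD(2) by blast
    then show ?thesis
      using c(2)[OF gcommuting_gword[where \<xi> = \<xi> and w = w, OF *(1) xi *(3,4)]] *(5) by (cases "c = 0") simp_all
  qed
  then show ?thesis using c(1) by (intro exI[of _ c] exI[of _ v]) simp
qed

subsection \<open>Linear parts\<close>

lemma gword_append:
  assumes U: "openin X U" "\<And>i j. i \<in> {1..n} \<Longrightarrow> j < q i \<Longrightarrow> \<xi> i j \<in> S i U" "set u \<subseteq> gens n q" "set v \<subseteq> gens n q"
  shows "gword A U \<xi> (u @ v) = gmul A (wdeg u) (wdeg v) U (gword A U \<xi> u) (gword A U \<xi> v)"
proof -
  let ?f = "\<lambda>(i, j). (i, \<xi> i j)"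
  have wd: "wdeg (map ?f w) = wdeg w" for w by (simp add: case_prod_unfold comp_def)
  have "set (map ?f w) \<subseteq> hom_sections U" if "set w \<subseteq> gens n q" for w
    using that assms(2) by (auto simp: hom_sections_def gens_def)
  then show ?thesis using gprod_append[OF U(1), of "map ?f u" "map ?f v"] assms(3,4)
    by (simp add: gword_eq_gprod wd)
qed

text \<open>It suffices to multiply monomials. Their concatenation has length at least two, sorting
  preserves the length or gives zero, and a sorted monomial of length at least two has coefficient 0
  at a single generator.\<close>

lemma val_gmul_linear_part:
  assumes U: "openin X U" and a: "a \<in> S k U" and b: "b \<in> S l U" and kl: "k \<ge> 1" "l \<ge> 1"
    and w: "[(k + l, j)] \<in> mons (k + l)" and x: "x \<in> U" "x \<in> Uc m"
  shows "val m U (k + l) (gmul A k l U a b) [(k + l, j)] x = 0"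
proof -
  have "eta_word_mult m k l u v [(k + l, j)] x = 0" if u: "u \<in> mons k" and v: "v \<in> mons l" for u v
  proof -
    have uv: "set u \<subseteq> gens n q" "set v \<subseteq> gens n q" "wdeg u = k" "wdeg v = l" "set (u @ v) \<subseteq> gens n q"
      using gmonomialsD u v by auto
    then have len: "length (u @ v) \<ge> 2" using kl by (cases u; cases v) auto
    obtain c s where c: "c = 0 \<or> s \<in> mons (wdeg (u @ v)) \<and> length s = length (u @ v)"
      "\<forall>U \<xi> m w x. openin X U \<longrightarrow> (\<forall>i\<in>{1..n}. \<forall>j<q i. \<xi> i j \<in> S i U) \<longrightarrow> x \<in> U \<longrightarrow> x \<in> Uc m \<longrightarrow>
      w \<in> mons (wdeg (u @ v)) \<longrightarrow> val m U (wdeg (u @ v)) (gword A U \<xi> (u @ v)) w x = c * val m U (wdeg (u @ v)) (gword A U \<xi> s) w x"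
      using gword_normal_form[OF uv(5)] by (elim exE conjE) (rule that)
    have eta: "\<forall>i\<in>{1..n}. \<forall>j<q i. \<eta> m i j \<in> S i (Uc m)" using chart.eta_closed by blast
    have d: "wdeg (u @ v) = k + l" using uv by simp
    have "eta_word_mult m k l u v [(k + l, j)] x = val m (Uc m) (k + l) (eta_word m (u @ v)) [(k + l, j)] x"
      unfolding eta_word_mult_def using gword_append[where \<xi> = "\<eta> m", OF Uc chart.eta_closed uv(1,2)] uv by simp
    also have "\<dots> = c * val m (Uc m) (k + l) (eta_word m s) [(k + l, j)] x"
      using c(2)[rule_format, of "Uc m" "\<eta> m" x m "[(k + l, j)]"] Uc eta x(2) w unfolding d by simp
    also have "\<dots> = 0"
    proof (cases "c = 0")
      case False
      then have "s \<in> mons (k + l)" "length s \<ge> 2" using c(1) len d by auto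
      then show ?thesis using val_eta_word[of s "k + l" "[(k + l, j)]" x m] w x by auto
    qed simp
    finally show ?thesis .
  qed
  then show ?thesis using val_gmul[OF U a b w x] by simp
qed

definition transition :: "nat \<Rightarrow> nat \<Rightarrow> nat \<Rightarrow> nat \<Rightarrow> nat \<Rightarrow> 'a \<Rightarrow> real" where
  "transition m m' i j j' x = val m' (Uc m) i (\<eta> m i j) [(i, j')] x"

lemma eta_word_singleton: "i \<in> {1..n} \<Longrightarrow> j < q i \<Longrightarrow> eta_word m [(i, j)] = \<eta> m i j"
  using mul_one[OF Uc chart.eta_closed] by simp

text \<open>In the change of charts the monomials of length at least two are products of sections of
  positive degree and do not contribute to linear parts. Hence linear parts transform among
  themselves, by the matrix \<open>transition\<close>.\<close>

lemma linear_part_change: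
  assumes U: "openin X U" and a: "a \<in> S i U" and i: "i \<in> {1..n}" and j': "j' < q i"
    and x: "x \<in> U" "x \<in> Uc m" "x \<in> Uc m'"
  shows "val m' U i a [(i, j')] x = (\<Sum>j<q i. val m U i a [(i, j)] x * transition m m' i j j' x)"
proof -
  note w' = mons_singleton[OF i j']
  let ?h = "\<lambda>w. val m U i a w x * val m' (Uc m) i (eta_word m w) [(i, j')] x"
  have zero: "?h w = 0" if w: "w \<in> mons i - (\<lambda>j. [(i, j)]) ` {..<q i}" for w
  proof -
    have "w \<in> mons i" "i \<ge> 1" using w i by auto
    then show ?thesis
    proof (cases rule: gmonomials_cases)
      case (1 j)
      then show ?thesis using w by auto
    next
      case (2 i' j1 w1)
      note e = chart.eta_closed[OF 2(3,4)]
      have w1: "eta_word m w1 \<in> S (i - i') (Uc m)" using eta_word_closed 2(6) by blast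
      have "eta_word m w = gmul A i' (i - i') (Uc m) (\<eta> m i' j1) (eta_word m w1)"
        using 2 gmonomialsD(2) by auto
      moreover have "val m' (Uc m) (i' + (i - i')) (gmul A i' (i - i') (Uc m) (\<eta> m i' j1) (eta_word m w1)) [(i' + (i - i'), j')] x = 0"
        by (rule val_gmul_linear_part[OF Uc e w1]) (use 2 w' x in auto)
      ultimately show ?thesis using 2 by simp
    qed
  qed
  have "val m' U i a [(i, j')] x = sum ?h (mons i)"
    by (rule val_change[OF U a x w'])
  also have "\<dots> = sum ?h ((\<lambda>j. [(i, j)]) ` {..<q i})"
    using zero mons_singleton[OF i] by (intro sum.mono_neutral_right) auto
  also have "\<dots> = (\<Sum>j<q i. ?h [(i, j)])"
    by (subst sum.reindex) (auto simp: inj_on_def)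
  also have "\<dots> = (\<Sum>j<q i. val m U i a [(i, j)] x * transition m m' i j j' x)"
    by (intro sum.cong refl) (simp only: transition_def eta_word_singleton[OF i] lessThan_iff)
  finally show ?thesis .
qed

text \<open>This is the transformation of linear parts applied to the generators of a third
  chart.\<close>

lemma trans_cocycle:
  assumes i: "i \<in> {1..n}" "j < q i" "j'' < q i" and x: "x \<in> Uc m" "x \<in> Uc m'" "x \<in> Uc m''"
  shows "transition m m'' i j j'' x = (\<Sum>j'<q i. transition m m' i j j' x * transition m' m'' i j' j'' x)"
  unfolding transition_def[of m] by (rule linear_part_change[OF Uc chart.eta_closed[OF i(1,2)] i(1,3) x])

lemma trans_self:
  assumes "i \<in> {1..n}" "j < q i" "j' < q i" "x \<in> Uc m"
  shows "transition m m i j j' x = (if j = j' then 1 else 0)"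
  unfolding transition_def
  using val_eta_word[OF mons_singleton[OF assms(1,2)] mons_singleton[OF assms(1,3)] assms(4)]
  by (simp add: eta_word_singleton[OF assms(1,2)] del: gword.simps)

lemma trans_smooth:
  assumes "i \<in> {1..n}" "j < q i" "j' < q i"
  shows "smooth_fun M (Uc m \<inter> Uc m') (transition m m' i j j')"
  unfolding transition_def using val_smooth[OF Uc chart.eta_closed[OF assms(1,2)] mons_singleton[OF assms(1,3)]]
  by simp

end

section \<open>Generators with linear transitions\<close>

text \<open>The rearrangement behind two product computations: \<open>h\<close> will be the
  structure constants, and the inner sums expand the factors.\<close>

lemma sum_bilinear:
  fixes h :: "'i \<Rightarrow> 'j \<Rightarrow> 'c::comm_semiring_0"
  shows "(\<Sum>u\<in>K. \<Sum>v\<in>L. (\<Sum>s\<in>I. a s * f s u) * (\<Sum>t\<in>J. b t * g t v) * h u v) =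
    (\<Sum>s\<in>I. \<Sum>t\<in>J. a s * b t * (\<Sum>u\<in>K. \<Sum>v\<in>L. f s u * g t v * h u v))"
proof -
  let ?e = "\<lambda>s t u v. a s * b t * (f s u * g t v * h u v)"
  have "(\<Sum>u\<in>K. \<Sum>v\<in>L. (\<Sum>s\<in>I. a s * f s u) * (\<Sum>t\<in>J. b t * g t v) * h u v) =
      (\<Sum>u\<in>K. \<Sum>v\<in>L. \<Sum>s\<in>I. \<Sum>t\<in>J. ?e s t u v)"
    unfolding sum_product unfolding sum_distrib_right by (simp only: ac_simps)
  also have "\<dots> = (\<Sum>u\<in>K. \<Sum>s\<in>I. \<Sum>v\<in>L. \<Sum>t\<in>J. ?e s t u v)"
    by (rule sum.cong[OF refl], rule sum.swap)
  also have "\<dots> = (\<Sum>s\<in>I. \<Sum>u\<in>K. \<Sum>v\<in>L. \<Sum>t\<in>J. ?e s t u v)"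
    by (rule sum.swap)
  also have "\<dots> = (\<Sum>s\<in>I. \<Sum>u\<in>K. \<Sum>t\<in>J. \<Sum>v\<in>L. ?e s t u v)"
    by (rule sum.cong[OF refl], rule sum.cong[OF refl], rule sum.swap)
  also have "\<dots> = (\<Sum>s\<in>I. \<Sum>t\<in>J. \<Sum>u\<in>K. \<Sum>v\<in>L. ?e s t u v)"
    by (rule sum.cong[OF refl], rule sum.swap)
  finally show ?thesis by (simp add: sum_distrib_left)
qed

context nmfd
begin

abbreviation rho_supp :: "'a \<Rightarrow> nat set" where
  "rho_supp y \<equiv> {l. \<rho> l y \<noteq> 0}"

lemma rho_supp_subset:
  assumes "\<forall>m. m \<notin> F \<longrightarrow> (\<forall>y\<in>N. \<rho> m y = 0)" "y \<in> N"
  shows "rho_supp y \<subseteq> F"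
  using assms by blast

lemma rho_supp:
  assumes "y \<in> topspace X"
  shows "finite (rho_supp y)" "(\<Sum>l\<in>rho_supp y. \<rho> l y) = 1" "l \<in> rho_supp y \<Longrightarrow> y \<in> Uc l"
proof -
  obtain N F where N: "y \<in> N" "finite F" "\<forall>m\<in>F. N \<subseteq> Uc m" "\<forall>m. m \<notin> F \<longrightarrow> (\<forall>y\<in>N. \<rho> m y = 0)"
    "\<forall>y\<in>N. (\<Sum>m\<in>F. \<rho> m y) = 1"
    using rho_local[OF assms] by blast
  note s = rho_supp_subset[OF N(4,1)]
  show "finite (rho_supp y)" using s N(2) finite_subset by blast
  show "l \<in> rho_supp y \<Longrightarrow> y \<in> Uc l" using s N(1,3) by blast
  have "(\<Sum>l\<in>rho_supp y. \<rho> l y) = (\<Sum>l\<in>F. \<rho> l y)"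
    using s N(2) by (intro sum.mono_neutral_left) auto
  then show "(\<Sum>l\<in>rho_supp y. \<rho> l y) = 1" using N(1,5) by simp
qed

text \<open>Values of the average \<open>\<Sum>\<^sub>l \<rho>\<^sub>l g\<^sub>m\<^sub>l \<eta>\<^sub>l\<close>; the product with \<open>\<rho>\<^sub>l\<close> extends by zero outside
  \<open>Uc l\<close>.\<close>

definition averaged :: "nat \<Rightarrow> nat \<Rightarrow> nat \<Rightarrow> nat \<Rightarrow> (nat \<times> nat) list \<Rightarrow> 'a \<Rightarrow> real" where
  "averaged m i j m' w y = (\<Sum>l\<in>rho_supp y. \<rho> l y *
     (\<Sum>j'<q i. transition m l i j j' y * val m' (Uc l) i (\<eta> l i j') w y))"

lemma averaged_section:
  assumes i: "i \<in> {1..n}" and j: "j < q i"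
  shows "\<exists>s. s \<in> S i (Uc m) \<and> (\<forall>y m' w. y \<in> Uc m \<longrightarrow> y \<in> Uc m' \<longrightarrow> w \<in> mons i \<longrightarrow>
     val m' (Uc m) i s w y = averaged m i j m' w y)"
proof -
  have "\<exists>N t. openin X N \<and> x \<in> N \<and> N \<subseteq> Uc m \<and> t \<in> S i N \<and>
      (\<forall>y\<in>N. \<forall>m'. True \<longrightarrow> y \<in> Uc m' \<longrightarrow> (\<forall>w\<in>mons i. val m' N i t w y = averaged m i j m' w y))"
    if x: "x \<in> Uc m" for x
  proof -
    have xt: "x \<in> topspace X" using x openin_subset[OF Uc] by blast
    obtain N0 F where N0: "openin X N0" "x \<in> N0" "finite F" "\<forall>m\<in>F. N0 \<subseteq> Uc m"
      "\<forall>m. m \<notin> F \<longrightarrow> (\<forall>y\<in>N0. \<rho> m y = 0)"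
      using rho_local[OF xt] by blast
    define N where "N = N0 \<inter> Uc m"
    have oN: "openin X N" unfolding N_def by (rule openin_Int[OF N0(1) Uc])
    have N: "openin X N" "x \<in> N" "N \<subseteq> Uc m" "N \<subseteq> topspace X"
      using oN N0(2) x openin_subset[OF oN] by (auto simp: N_def)
    have NF: "N \<subseteq> Uc l" if "l \<in> F" for l using N0(4) that by (auto simp: N_def)
    interpret G: abelian_group "sec A i N" by (rule sec_abelian[OF N(1)])
    \<comment> \<open>For l in F the neighbourhood lies in both \<open>Uc l\<close> and
      \<open>Uc m\<close>, so the transition function is smooth there and no extension by zero is
      required.\<close>
    define h where "h l j' = (\<lambda>y. \<rho> l y * transition m l i j j' y)" for l j'
    have hs: "smooth_fun M N (h l j')" if "l \<in> F" "j' < q i" for l j'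
      unfolding h_def
    proof (rule smooth_fun_mult[OF N(1)])
      show "smooth_fun M N (\<rho> l)" by (rule smooth_fun_mono[OF rho_smooth N(4)])
      show "smooth_fun M N (transition m l i j j')"
        by (rule smooth_fun_mono[OF trans_smooth[OF i j that(2)]]) (use N NF that in auto)
    qed
    have rs: "res A i (Uc l) N (\<eta> l i j') \<in> S i N" if "l \<in> F" "j' < q i" for l j'
      by (rule res_lin(1)[OF Uc N(1) NF[OF that(1)] chart.eta_closed[OF i that(2)]])
    define t1 where "t1 l = finsum (sec A i N) (\<lambda>j'. act i N (h l j') (res A i (Uc l) N (\<eta> l i j'))) {..<q i}" for l
    define t where "t = finsum (sec A i N) t1 F"
    have as: "act i N (h l j') (res A i (Uc l) N (\<eta> l i j')) \<in> S i N" if "l \<in> F" "j' < q i" for l j'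
      by (rule act_closed[OF N(1) hs[OF that] rs[OF that]])
    have t1: "t1 l \<in> S i N" if "l \<in> F" for l
      unfolding t1_def by (rule G.finsum_closed) (use as that in auto)
    have t: "t \<in> S i N" unfolding t_def by (rule G.finsum_closed) (use t1 in auto)
    have "val m' N i t w y = averaged m i j m' w y" if y: "y \<in> N" "y \<in> Uc m'" and w: "w \<in> mons i" for y m' w
    proof -
      have "val m' N i t w y = (\<Sum>l\<in>F. val m' N i (t1 l) w y)"
        unfolding t_def by (rule val_finsum[OF N(1) N0(3) t1 w y])
      also have "\<dots> = (\<Sum>l\<in>F. \<rho> l y * (\<Sum>j'<q i. transition m l i j j' y * val m' (Uc l) i (\<eta> l i j') w y))"
      proof (rule sum.cong[OF refl])
        fix l assume l: "l \<in> F"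
        have "val m' N i (t1 l) w y = (\<Sum>j'<q i. val m' N i (act i N (h l j') (res A i (Uc l) N (\<eta> l i j'))) w y)"
          unfolding t1_def by (rule val_finsum[OF N(1)]) (use as l w y in auto)
        also have "\<dots> = (\<Sum>j'<q i. h l j' y * val m' (Uc l) i (\<eta> l i j') w y)"
          using val_act[OF N(1) rs[OF l] hs[OF l] w y] val_res[OF Uc chart.eta_closed[OF i] N(1) NF[OF l] w y]
          by (intro sum.cong refl) simp
        finally show "val m' N i (t1 l) w y = \<rho> l y * (\<Sum>j'<q i. transition m l i j j' y * val m' (Uc l) i (\<eta> l i j') w y)"
          by (simp add: h_def sum_distrib_left mult.assoc)
      qed
      also have "\<dots> = averaged m i j m' w y"
        unfolding averaged_def
        using rho_supp_subset[OF N0(5)] y N0(3) by (intro sum.mono_neutral_right) (auto simp: N_def)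
      finally show ?thesis .
    qed
    then show ?thesis using N t by (intro exI[of _ N] exI[of _ t]) auto
  qed
  then obtain s where "s \<in> S i (Uc m)"
    "\<And>y m' w. y \<in> Uc m \<Longrightarrow> True \<Longrightarrow> y \<in> Uc m' \<Longrightarrow> w \<in> mons i \<Longrightarrow> val m' (Uc m) i s w y = averaged m i j m' w y"
    using sections_glue[OF Uc[of m], where D = "\<lambda>_ _. True" and k = i and v = "averaged m i j"] by metis
  then show ?thesis by blast
qed

definition xi :: "nat \<Rightarrow> nat \<Rightarrow> nat \<Rightarrow> 's" where
  "xi m i j = (SOME s. s \<in> S i (Uc m) \<and> (\<forall>y m' w. y \<in> Uc m \<longrightarrow> y \<in> Uc m' \<longrightarrow> w \<in> mons i \<longrightarrow>
     val m' (Uc m) i s w y = averaged m i j m' w y))"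

lemma xi:
  assumes "i \<in> {1..n}" "j < q i"
  shows "xi m i j \<in> S i (Uc m)"
    and "y \<in> Uc m \<Longrightarrow> y \<in> Uc m' \<Longrightarrow> w \<in> mons i \<Longrightarrow> val m' (Uc m) i (xi m i j) w y = averaged m i j m' w y"
  using someI_ex[OF averaged_section[OF assms, of m]] unfolding xi_def[symmetric] by blast+

text \<open>The weight \<open>\<rho> l\<close> does not depend on the chart being averaged, so the
  cocycle identity can be applied to each summand of the average separately.\<close>

lemma xi_trans:
  assumes i: "i \<in> {1..n}" and j: "j < q i" and w: "w \<in> mons i" and y: "y \<in> Uc m" "y \<in> Uc m'" "y \<in> Uc m''"
  shows "val m'' (Uc m) i (xi m i j) w y =
    (\<Sum>j'<q i. transition m m' i j j' y * val m'' (Uc m') i (xi m' i j') w y)"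
proof -
  have sp: "y \<in> topspace X" using y openin_subset[OF Uc] by blast
  let ?e = "\<lambda>l j''. val m'' (Uc l) i (\<eta> l i j'') w y"
  have "(\<Sum>j'<q i. transition m m' i j j' y * val m'' (Uc m') i (xi m' i j') w y) =
     (\<Sum>j'<q i. transition m m' i j j' y * (\<Sum>l\<in>rho_supp y. \<rho> l y * (\<Sum>j''<q i. transition m' l i j' j'' y * ?e l j'')))"
    using xi(2)[OF i _ y(2,3) w] by (intro sum.cong refl) (simp add: averaged_def)
  also have "\<dots> = (\<Sum>j'<q i. \<Sum>l\<in>rho_supp y. \<Sum>j''<q i. \<rho> l y * (transition m m' i j j' y * transition m' l i j' j'' y * ?e l j''))"
    by (simp add: sum_distrib_left algebra_simps)
  also have "\<dots> = (\<Sum>l\<in>rho_supp y. \<Sum>j'<q i. \<Sum>j''<q i. \<rho> l y * (transition m m' i j j' y * transition m' l i j' j'' y * ?e l j''))"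
    by (rule sum.swap)
  also have "\<dots> = (\<Sum>l\<in>rho_supp y. \<Sum>j''<q i. \<Sum>j'<q i. \<rho> l y * (transition m m' i j j' y * transition m' l i j' j'' y * ?e l j''))"
    by (intro sum.cong refl sum.swap)
  also have "\<dots> = averaged m i j m'' w y"
    unfolding averaged_def
  proof (rule sum.cong[OF refl])
    fix l assume "l \<in> rho_supp y"
    then have l: "y \<in> Uc l" using rho_supp(3)[OF sp] by blast
    have "(\<Sum>j''<q i. \<Sum>j'<q i. \<rho> l y * (transition m m' i j j' y * transition m' l i j' j'' y * ?e l j'')) =
      (\<Sum>j''<q i. \<rho> l y * ((\<Sum>j'<q i. transition m m' i j j' y * transition m' l i j' j'' y) * ?e l j''))"
      by (simp add: sum_distrib_left sum_distrib_right)
    also have "\<dots> = (\<Sum>j''<q i. \<rho> l y * (transition m l i j j'' y * ?e l j''))"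
      using trans_cocycle[OF i j _ y(1,2) l] by (intro sum.cong refl) simp
    finally show "(\<Sum>j''<q i. \<Sum>j'<q i. \<rho> l y * (transition m m' i j j' y * transition m' l i j' j'' y * ?e l j'')) =
      \<rho> l y * (\<Sum>j''<q i. transition m l i j j'' y * ?e l j'')" by (simp add: sum_distrib_left)
  qed
  finally show ?thesis using xi(2)[OF i j y(1,3) w] by simp
qed

text \<open>In chart m the l-th summand has linear part \<rho>_l times g_ml g_lm, which is \<rho>_l
  times the identity, and the weights add up to 1.\<close>

lemma xi_linear_part:
  assumes i: "i \<in> {1..n}" and j: "j < q i" "j' < q i" and y: "y \<in> Uc m"
  shows "val m (Uc m) i (xi m i j) [(i, j')] y = (if j = j' then 1 else 0)"
proof -
  have sp: "y \<in> topspace X" using y openin_subset[OF Uc] by blast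
  have "val m (Uc m) i (xi m i j) [(i, j')] y =
    (\<Sum>l\<in>rho_supp y. \<rho> l y * (\<Sum>j''<q i. transition m l i j j'' y * transition l m i j'' j' y))"
    using xi(2)[OF i j(1) y y mons_singleton[OF i j(2)]] by (simp add: averaged_def transition_def)
  also have "\<dots> = (\<Sum>l\<in>rho_supp y. \<rho> l y * transition m m i j j' y)"
    using trans_cocycle[OF i j y _ y, symmetric] rho_supp(3)[OF sp] by (intro sum.cong refl) simp
  also have "\<dots> = (if j = j' then 1 else 0)"
    using rho_supp(2)[OF sp] trans_self[OF i j y] by (simp flip: sum_distrib_right)
  finally show ?thesis .
qed

subsection \<open>The new generators generate\<close>

abbreviation xword where "xword m w \<equiv> gword A (Uc m) (xi m) w"

lemma xi_all: "\<forall>i\<in>{1..n}. \<forall>j<q i. xi m i j \<in> S i (Uc m)"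
  using xi(1) by blast

lemma xword_closed: "set w \<subseteq> gens n q \<Longrightarrow> xword m w \<in> S (wdeg w) (Uc m)"
  by (rule gword_closed[where n = n and q = q and \<xi> = "xi m", OF Uc xi(1)])

lemma xword_mons_closed: "w \<in> mons k \<Longrightarrow> xword m w \<in> S k (Uc m)"
  using xword_closed[OF gmonomialsD(1)] gmonomialsD(2) by metis

lemma xword_singleton: "i \<in> {1..n} \<Longrightarrow> j < q i \<Longrightarrow> xword m [(i, j)] = xi m i j"
  using mul_one[OF Uc xi(1)] by simp

text \<open>\<open>f\<close> is any family of functions indexed by monomials, thought of as the
  coefficients of a section. Linear combinations can thus be formed without constructing the
  sections they come from.\<close>

definition in_span :: "nat \<Rightarrow> nat \<Rightarrow> ((nat \<times> nat) list \<Rightarrow> 'a \<Rightarrow> real) \<Rightarrow> bool" where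
  "in_span m k f \<longleftrightarrow> (\<exists>P. (\<forall>w\<in>mons k. smooth_fun M (Uc m) (P w)) \<and>
     (\<forall>x\<in>Uc m. \<forall>u\<in>mons k. f u x = (\<Sum>w\<in>mons k. P w x * val m (Uc m) k (xword m w) u x)))"

lemma in_span_lincomb:
  assumes f: "\<And>i. i \<in> I \<Longrightarrow> in_span m k (f i)" and h: "\<And>i. i \<in> I \<Longrightarrow> smooth_fun M (Uc m) (h i)"
    and g: "\<And>x u. x \<in> Uc m \<Longrightarrow> u \<in> mons k \<Longrightarrow> g u x = (\<Sum>i\<in>I. h i x * f i u x)"
  shows "in_span m k g"
proof -
  have "\<forall>i\<in>I. \<exists>P. (\<forall>w\<in>mons k. smooth_fun M (Uc m) (P w)) \<and>
     (\<forall>x\<in>Uc m. \<forall>u\<in>mons k. f i u x = (\<Sum>w\<in>mons k. P w x * val m (Uc m) k (xword m w) u x))"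
    using f unfolding in_span_def by blast
  from bchoice[OF this] obtain P where P0: "\<forall>i\<in>I. (\<forall>w\<in>mons k. smooth_fun M (Uc m) (P i w)) \<and>
     (\<forall>x\<in>Uc m. \<forall>u\<in>mons k. f i u x = (\<Sum>w\<in>mons k. P i w x * val m (Uc m) k (xword m w) u x))"
    by (elim exE) (rule that)
  have P: "\<And>i w. i \<in> I \<Longrightarrow> w \<in> mons k \<Longrightarrow> smooth_fun M (Uc m) (P i w)"
    "\<And>i x u. i \<in> I \<Longrightarrow> x \<in> Uc m \<Longrightarrow> u \<in> mons k \<Longrightarrow> f i u x = (\<Sum>w\<in>mons k. P i w x * val m (Uc m) k (xword m w) u x)"
    using P0 by blast+
  have "g u x = (\<Sum>w\<in>mons k. (\<Sum>i\<in>I. h i x * P i w x) * val m (Uc m) k (xword m w) u x)"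
    if "x \<in> Uc m" "u \<in> mons k" for x u
  proof -
    have "g u x = (\<Sum>i\<in>I. \<Sum>w\<in>mons k. h i x * P i w x * val m (Uc m) k (xword m w) u x)"
      using g[OF that] P(2)[OF _ that] by (simp add: sum_distrib_left mult.assoc)
    also have "\<dots> = (\<Sum>w\<in>mons k. \<Sum>i\<in>I. h i x * P i w x * val m (Uc m) k (xword m w) u x)"
      by (rule sum.swap)
    finally show ?thesis by (simp add: sum_distrib_right)
  qed
  moreover have "smooth_fun M (Uc m) (\<lambda>x. \<Sum>i\<in>I. h i x * P i w x)" if "w \<in> mons k" for w
    using P(1) h that by (intro smooth_fun_sum smooth_fun_mult Uc)
  ultimately show ?thesis unfolding in_span_def
    by (intro exI[of _ "\<lambda>w x. \<Sum>i\<in>I. h i x * P i w x"]) blast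
qed

lemma in_span_xword:
  assumes "set s \<subseteq> gens n q"
  shows "in_span m (wdeg s) (val m (Uc m) (wdeg s) (xword m s))"
proof -
  obtain c v where c: "c = 0 \<or> v \<in> mons (wdeg s) \<and> length v = length s"
    "\<forall>U \<xi> m w x. openin X U \<longrightarrow> (\<forall>i\<in>{1..n}. \<forall>j<q i. \<xi> i j \<in> S i U) \<longrightarrow> x \<in> U \<longrightarrow> x \<in> Uc m \<longrightarrow>
      w \<in> mons (wdeg s) \<longrightarrow> val m U (wdeg s) (gword A U \<xi> s) w x = c * val m U (wdeg s) (gword A U \<xi> v) w x"
    using gword_normal_form[OF assms] by (elim exE conjE) (rule that)
  have "val m (Uc m) (wdeg s) (xword m s) u x = (\<Sum>w\<in>mons (wdeg s). (if w = v then c else 0) * val m (Uc m) (wdeg s) (xword m w) u x)"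
    if "x \<in> Uc m" "u \<in> mons (wdeg s)" for x u
  proof -
    have "val m (Uc m) (wdeg s) (xword m s) u x = c * val m (Uc m) (wdeg s) (xword m v) u x"
      using c(2)[rule_format, of "Uc m" "xi m" x m u] Uc xi_all that by blast
    also have "\<dots> = (\<Sum>w\<in>mons (wdeg s). (if w = v then c * val m (Uc m) (wdeg s) (xword m w) u x else 0))"
      using c(1) by (auto simp: sum.delta)
    finally show ?thesis by (simp add: if_distrib[of "\<lambda>t. t * _"] cong: if_cong)
  qed
  then show ?thesis unfolding in_span_def
    using smooth_fun_const by (intro exI[of _ "\<lambda>w _. if w = v then c else 0"]) blast
qed

text \<open>By bilinearity the product is a combination of words \<open>s @ t\<close> in the new
  generators. These need not be sorted, and \<open>in_span_xword\<close> brings them back to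
  monomials.\<close>

lemma in_span_gmul:
  assumes a: "a \<in> S k (Uc m)" "in_span m k (val m (Uc m) k a)"
    and b: "b \<in> S l (Uc m)" "in_span m l (val m (Uc m) l b)"
  shows "in_span m (k + l) (val m (Uc m) (k + l) (gmul A k l (Uc m) a b))"
proof -
  obtain P where P: "\<And>w. w \<in> mons k \<Longrightarrow> smooth_fun M (Uc m) (P w)"
     "\<And>x u. x \<in> Uc m \<Longrightarrow> u \<in> mons k \<Longrightarrow> val m (Uc m) k a u x = (\<Sum>w\<in>mons k. P w x * val m (Uc m) k (xword m w) u x)"
    using a(2) unfolding in_span_def by blast
  obtain Q where Q: "\<And>w. w \<in> mons l \<Longrightarrow> smooth_fun M (Uc m) (Q w)"
     "\<And>x u. x \<in> Uc m \<Longrightarrow> u \<in> mons l \<Longrightarrow> val m (Uc m) l b u x = (\<Sum>w\<in>mons l. Q w x * val m (Uc m) l (xword m w) u x)"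
    using b(2) unfolding in_span_def by blast
  let ?v = "\<lambda>k s. val m (Uc m) k (xword m s)"
  show ?thesis
  proof (rule in_span_lincomb[where I = "mons k \<times> mons l" and h = "\<lambda>(s, t) x. P s x * Q t x"
        and f = "\<lambda>(s, t). ?v (k + l) (s @ t)"])
    show "in_span m (k + l) (case st of (s, t) \<Rightarrow> ?v (k + l) (s @ t))" if st: "st \<in> mons k \<times> mons l" for st
    proof -
      obtain s t where e: "st = (s, t)" "s \<in> mons k" "t \<in> mons l" using st by auto
      have "set (s @ t) \<subseteq> gens n q" "wdeg (s @ t) = k + l" using gmonomialsD e by auto
      then show ?thesis using in_span_xword[of "s @ t" m] e by simp
    qed
    show "smooth_fun M (Uc m) ((\<lambda>(s, t) x. P s x * Q t x) st)" if "st \<in> mons k \<times> mons l" for st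
      using that P(1) Q(1) smooth_fun_mult[OF Uc] by auto
    fix x w assume x: "x \<in> Uc m" and w: "w \<in> mons (k + l)"
    have "val m (Uc m) (k + l) (gmul A k l (Uc m) a b) w x =
       (\<Sum>u\<in>mons k. \<Sum>v\<in>mons l. (\<Sum>s\<in>mons k. P s x * ?v k s u x) * (\<Sum>t\<in>mons l. Q t x * ?v l t v x) * eta_word_mult m k l u v w x)"
      using val_gmul[OF Uc a(1) b(1) w x x] P(2)[OF x] Q(2)[OF x] by simp
    also have "\<dots> = (\<Sum>s\<in>mons k. \<Sum>t\<in>mons l. P s x * Q t x *
        (\<Sum>u\<in>mons k. \<Sum>v\<in>mons l. ?v k s u x * ?v l t v x * eta_word_mult m k l u v w x))"
      by (rule sum_bilinear)
    also have "\<dots> = (\<Sum>s\<in>mons k. \<Sum>t\<in>mons l. P s x * Q t x * ?v (k + l) (s @ t) w x)"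
    proof (intro sum.cong refl)
      fix s t assume st: "s \<in> mons k" "t \<in> mons l"
      note d = gmonomialsD[OF st(1)] gmonomialsD[OF st(2)]
      have "xword m (s @ t) = gmul A k l (Uc m) (xword m s) (xword m t)"
        using gword_append[where \<xi> = "xi m", OF Uc xi(1) d(1,3)] d by simp
      then have "?v (k + l) (s @ t) w x = (\<Sum>u\<in>mons k. \<Sum>v\<in>mons l. ?v k s u x * ?v l t v x * eta_word_mult m k l u v w x)"
        using val_gmul[OF Uc xword_mons_closed[OF st(1)] xword_mons_closed[OF st(2)] w x x] by simp
      then show "P s x * Q t x * (\<Sum>u\<in>mons k. \<Sum>v\<in>mons l. ?v k s u x * ?v l t v x * eta_word_mult m k l u v w x) =
          P s x * Q t x * ?v (k + l) (s @ t) w x"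
        by simp
    qed
    finally show "val m (Uc m) (k + l) (gmul A k l (Uc m) a b) w x =
        (\<Sum>st\<in>mons k \<times> mons l. (\<lambda>(s, t) x. P s x * Q t x) st x * (case st of (s, t) \<Rightarrow> ?v (k + l) (s @ t)) w x)"
      by (simp add: sum.cartesian_product case_prod_unfold)
  qed
qed

text \<open>Induction on the degree: a monomial of length at least two is a product of factors of lower
  degree, and \<open>\<eta>\<^sub>m - \<xi>\<^sub>m\<close> is a combination of such monomials.\<close>

lemma in_span_eta_word: "w \<in> mons k \<Longrightarrow> in_span m k (val m (Uc m) k (eta_word m w))"
proof (induction k arbitrary: w rule: less_induct)
  case (less k)
  show ?case
  proof (cases "k = 0")
    case True
    then have "w = []" using less.prems by (simp add: gmonomials_0)
    then show ?thesis using in_span_xword[of "[]" m] True by simp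
  next
    case False
    then have k: "k \<ge> 1" by simp
    \<comment> \<open>The monomials of length one, of which there are none in degrees above
      n.\<close>
    define L where "L = (\<lambda>j. [(k, j)]) ` {j. k \<in> {1..n} \<and> j < q k}"
    have nonlin: "in_span m k (val m (Uc m) k (eta_word m w))" if w: "w \<in> mons k" "w \<notin> L" for w
      using w(1) k
    proof (cases rule: gmonomials_cases)
      case (1 j)
      then show ?thesis using w(2) by (auto simp: L_def)
    next
      case (2 i j w1)
      have i: "i < k" "k - i < k" "[(i, j)] \<in> mons i" using 2 mons_singleton by auto
      have e: "in_span m i (val m (Uc m) i (\<eta> m i j))"
        using less.IH[OF i(1,3)] eta_word_singleton[OF 2(3,4)] by simp
      have "in_span m (i + (k - i)) (val m (Uc m) (i + (k - i)) (gmul A i (k - i) (Uc m) (\<eta> m i j) (eta_word m w1)))"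
        by (rule in_span_gmul[OF chart.eta_closed[OF 2(3,4)] e eta_word_closed[OF 2(6)] less.IH[OF i(2) 2(6)]])
      moreover have "eta_word m w = gmul A i (k - i) (Uc m) (\<eta> m i j) (eta_word m w1)"
        using 2 gmonomialsD(2)[OF 2(6)] by simp
      ultimately show ?thesis using 2(5) by simp
    qed
    show ?thesis
    proof (cases "w \<in> L")
      case False
      then show ?thesis using nonlin less.prems by blast
    next
      case True
      then obtain j where j: "w = [(k, j)]" "k \<in> {1..n}" "j < q k" by (auto simp: L_def)
      let ?x = "val m (Uc m) k (xi m k j)"
      \<comment> \<open>The combination is \<xi>_j minus the nonlinear part of \<xi>_j:
        \<open>None\<close> indexes \<xi>_j itself, and \<open>Some v\<close> the nonlinear monomial
        \<open>v\<close> with minus the coefficient of \<xi>_j at \<open>v\<close>.\<close>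
      let ?I = "insert None (Some ` (mons k - L))"
      show ?thesis
      proof (rule in_span_lincomb[where I = ?I
            and h = "\<lambda>o'. case o' of None \<Rightarrow> (\<lambda>_. 1) | Some v \<Rightarrow> (\<lambda>x. (- 1) * ?x v x)"
            and f = "\<lambda>o'. case o' of None \<Rightarrow> ?x | Some v \<Rightarrow> val m (Uc m) k (eta_word m v)"])
        show "in_span m k (case o' of None \<Rightarrow> ?x | Some v \<Rightarrow> val m (Uc m) k (eta_word m v))" if o': "o' \<in> ?I" for o'
        proof (cases o')
          case None
          have "set [(k, j)] \<subseteq> gens n q" using j by (simp add: gens_def)
          then show ?thesis using in_span_xword[of "[(k, j)]" m] None xword_singleton[OF j(2,3)] by (simp del: gword.simps)
        next
          case (Some v)
          then show ?thesis using o' nonlin by auto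
        qed
        show "smooth_fun M (Uc m) (case o' of None \<Rightarrow> (\<lambda>_. 1) | Some v \<Rightarrow> (\<lambda>x. (- 1) * ?x v x))" if o': "o' \<in> ?I" for o'
        proof (cases o')
          case None
          then show ?thesis using smooth_fun_const by simp
        next
          case (Some v)
          then have "v \<in> mons k" using o' by auto
          then have "smooth_fun M (Uc m) (?x v)" using val_smooth[OF Uc xi(1)[OF j(2,3)], of v m m] by simp
          then have "smooth_fun M (Uc m) (\<lambda>x. (- 1) * ?x v x)" by (intro smooth_fun_mult[OF Uc] smooth_fun_const)
          then show ?thesis using Some by simp
        qed
        fix x u assume x: "x \<in> Uc m" and u: "u \<in> mons k"
        have vm: "val m (Uc m) k (eta_word m v) u x = (if u = v then 1 else 0)" if "v \<in> mons k" for v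
          using val_eta_word[OF that u x] .
        have "(\<Sum>v\<in>mons k - L. ((- 1) * ?x v x) * val m (Uc m) k (eta_word m v) u x) = (\<Sum>v\<in>mons k - L. if v = u then - ?x v x else 0)"
          using vm by (intro sum.cong refl) auto
        also have "\<dots> = (if u \<in> mons k - L then - ?x u x else 0)"
          by (simp add: sum.delta)
        finally have s: "(\<Sum>v\<in>mons k - L. ((- 1) * ?x v x) * val m (Uc m) k (eta_word m v) u x) =
            (if u \<in> mons k - L then - ?x u x else 0)" .
        \<comment> \<open>Here the linear part being the identity is used: once the nonlinear part
          is subtracted, only the generator itself remains.\<close>
        have "?x u x = (if u = w then 1 else 0)" if "u \<in> L"
          using that xi_linear_part[OF j(2,3) _ x] j(1) by (auto simp: L_def split: if_splits)
        then have "val m (Uc m) k (eta_word m w) u x =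
          ?x u x + (\<Sum>v\<in>mons k - L. ((- 1) * ?x v x) * val m (Uc m) k (eta_word m v) u x)"
          unfolding s using vm[OF less.prems] u True by auto
        then show "val m (Uc m) k (eta_word m w) u x =
          (\<Sum>o'\<in>?I. (case o' of None \<Rightarrow> (\<lambda>_. 1) | Some v \<Rightarrow> (\<lambda>x. (- 1) * ?x v x)) x *
            (case o' of None \<Rightarrow> ?x | Some v \<Rightarrow> val m (Uc m) k (eta_word m v)) u x)"
          by (subst sum.insert) (auto simp: sum.reindex)
      qed
    qed
  qed
qed

text \<open>The second claim says that \<open>P\<close> is a left inverse of the matrix expanding
  \<xi>-monomials in \<eta>-monomials, since the latter have unit coefficients.\<close>

lemma eta_words_in_xwords:
  obtains P where "\<And>w v. w \<in> mons k \<Longrightarrow> v \<in> mons k \<Longrightarrow> smooth_fun M (Uc m) (P w v)"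
    "\<And>w u x. w \<in> mons k \<Longrightarrow> u \<in> mons k \<Longrightarrow> x \<in> Uc m \<Longrightarrow>
      (\<Sum>v\<in>mons k. P w v x * val m (Uc m) k (xword m v) u x) = (if w = u then 1 else 0)"
proof -
  have "\<forall>w\<in>mons k. \<exists>P. (\<forall>v\<in>mons k. smooth_fun M (Uc m) (P v)) \<and>
     (\<forall>x\<in>Uc m. \<forall>u\<in>mons k. val m (Uc m) k (eta_word m w) u x = (\<Sum>v\<in>mons k. P v x * val m (Uc m) k (xword m v) u x))"
    using in_span_eta_word[of _ k m] unfolding in_span_def by blast
  from bchoice[OF this] obtain P where P0: "\<forall>w\<in>mons k. (\<forall>v\<in>mons k. smooth_fun M (Uc m) (P w v)) \<and>
     (\<forall>x\<in>Uc m. \<forall>u\<in>mons k. val m (Uc m) k (eta_word m w) u x = (\<Sum>v\<in>mons k. P w v x * val m (Uc m) k (xword m v) u x))"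
    by (elim exE) (rule that)
  have P: "\<And>w v. w \<in> mons k \<Longrightarrow> v \<in> mons k \<Longrightarrow> smooth_fun M (Uc m) (P w v)"
    "\<And>w u x. w \<in> mons k \<Longrightarrow> u \<in> mons k \<Longrightarrow> x \<in> Uc m \<Longrightarrow>
      val m (Uc m) k (eta_word m w) u x = (\<Sum>v\<in>mons k. P w v x * val m (Uc m) k (xword m v) u x)"
    using P0 by blast+
  show thesis
    by (rule that[of P]) (use P(1) in blast, simp add: P(2)[symmetric] val_eta_word eq_commute)
qed

text \<open>Both families of monomials are indexed by \<open>mons k\<close>, so the matrix is
  square, and its left inverse makes its rows independent. Generation thus yields independence
  without a second induction.\<close>

lemma xwords_independent:
  assumes x: "x \<in> Uc m" and c: "\<And>u. u \<in> mons k \<Longrightarrow> (\<Sum>w\<in>mons k. c w * val m (Uc m) k (xword m w) u x) = 0"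
    and w: "w \<in> mons k"
  shows "c w = 0"
proof -
  obtain P where P: "\<And>w v. w \<in> mons k \<Longrightarrow> v \<in> mons k \<Longrightarrow> smooth_fun M (Uc m) (P w v)"
    "\<And>w u x. w \<in> mons k \<Longrightarrow> u \<in> mons k \<Longrightarrow> x \<in> Uc m \<Longrightarrow>
      (\<Sum>v\<in>mons k. P w v x * val m (Uc m) k (xword m v) u x) = (if w = u then 1 else 0)"
    by (rule eta_words_in_xwords[of k m]) (rule that, assumption+)
  show ?thesis
    by (rule finite_matrix_left_inverse[of "mons k" "\<lambda>w v. P w v x" "\<lambda>v u. val m (Uc m) k (xword m v) u x"])
      (use P(2) x c w in auto)
qed

text \<open>The coefficients of \<open>a\<close> in the old monomials, multiplied by the matrix
  \<open>P\<close>, are its coefficients in the new ones; both factors are smooth.\<close>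

lemma xwords_generate:
  assumes U: "openin X U" and a: "a \<in> S k U"
  obtains f where "\<And>w. w \<in> mons k \<Longrightarrow> smooth_fun M (U \<inter> Uc m) (f w)"
    "\<And>x u. x \<in> U \<Longrightarrow> x \<in> Uc m \<Longrightarrow> u \<in> mons k \<Longrightarrow>
      val m U k a u x = (\<Sum>w\<in>mons k. f w x * val m (Uc m) k (xword m w) u x)"
proof -
  obtain P where P: "\<And>w v. w \<in> mons k \<Longrightarrow> v \<in> mons k \<Longrightarrow> smooth_fun M (Uc m) (P w v)"
    "\<And>w u x. w \<in> mons k \<Longrightarrow> u \<in> mons k \<Longrightarrow> x \<in> Uc m \<Longrightarrow>
      (\<Sum>v\<in>mons k. P w v x * val m (Uc m) k (xword m v) u x) = (if w = u then 1 else 0)"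
    by (rule eta_words_in_xwords[of k m]) (rule that, assumption+)
  show thesis
  proof (rule that[of "\<lambda>v x. \<Sum>w\<in>mons k. val m U k a w x * P w v x"])
    note inter_Uc = inter_Uc[OF U, of m]
    show "smooth_fun M (U \<inter> Uc m) (\<lambda>x. \<Sum>w\<in>mons k. val m U k a w x * P w v x)" if v: "v \<in> mons k" for v
    proof (intro smooth_fun_sum[OF inter_Uc(1)] smooth_fun_mult[OF inter_Uc(1)])
      fix w assume w: "w \<in> mons k"
      show "smooth_fun M (U \<inter> Uc m) (val m U k a w)" by (rule val_smooth[OF U a w])
      show "smooth_fun M (U \<inter> Uc m) (P w v)" by (rule smooth_fun_mono[OF P(1)[OF w v] inter_Uc(3)])
    qed
    fix x u assume x: "x \<in> U" "x \<in> Uc m" and u: "u \<in> mons k"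
    have "(\<Sum>v\<in>mons k. (\<Sum>w\<in>mons k. val m U k a w x * P w v x) * val m (Uc m) k (xword m v) u x) =
       (\<Sum>w\<in>mons k. val m U k a w x * (\<Sum>v\<in>mons k. P w v x * val m (Uc m) k (xword m v) u x))"
      by (simp add: sum_distrib_left sum_distrib_right mult.assoc) (rule sum.swap)
    also have "\<dots> = (\<Sum>w\<in>mons k. if w = u then val m U k a w x else 0)"
      using P(2)[OF _ u x(2)] by (intro sum.cong refl) simp
    also have "\<dots> = val m U k a u x" using u by (simp add: sum.delta)
    finally show "val m U k a u x = (\<Sum>v\<in>mons k. (\<Sum>w\<in>mons k. val m U k a w x * P w v x) * val m (Uc m) k (xword m v) u x)"
      by simp
  qed
qed

end

section \<open>Representing sections by elements of the symmetric algebras of the fibres\<close>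

context nmfd
begin

definition ch :: "'a \<Rightarrow> nat" where
  "ch x = (SOME m. x \<in> Uc m)"

lemma ch: "x \<in> topspace X \<Longrightarrow> x \<in> Uc (ch x)"
  unfolding ch_def using cover by (rule someI_ex)

abbreviation W where "W \<equiv> dual_letters q"

text \<open>The linear substitution of the new generators of chart m for the dual basis: a dual
  vector becomes a section with constant coefficients.\<close>

definition lsec :: "nat \<Rightarrow> nat \<Rightarrow> ((nat \<Rightarrow>\<^sub>0 real) \<Rightarrow> real) \<Rightarrow> 's" where
  "lsec m i a = finsum (sec A i (Uc m)) (\<lambda>j. a (basis_vec j) \<odot>\<^bsub>sec A i (Uc m)\<^esub> xi m i j) {..<q i}"

lemma lsec_closed: "i \<in> {1..n} \<Longrightarrow> lsec m i a \<in> S i (Uc m)"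
  unfolding lsec_def
  by (rule abelian_monoid.finsum_closed[OF abelian_group.axioms(1)[OF sec_abelian[OF Uc]]])
    (auto intro!: smult_closed[OF Uc] xi(1))

lemma val_lsec:
  assumes "i \<in> {1..n}" "w \<in> mons i" "x \<in> Uc m" "x \<in> Uc m'"
  shows "val m' (Uc m) i (lsec m i a) w x = (\<Sum>j<q i. a (basis_vec j) * val m' (Uc m) i (xi m i j) w x)"
proof -
  have "val m' (Uc m) i (lsec m i a) w x =
      (\<Sum>j<q i. val m' (Uc m) i (a (basis_vec j) \<odot>\<^bsub>sec A i (Uc m)\<^esub> xi m i j) w x)"
    unfolding lsec_def by (rule val_finsum[OF Uc]) (use assms in \<open>auto intro!: smult_closed[OF Uc] xi(1)\<close>)
  also have "\<dots> = (\<Sum>j<q i. a (basis_vec j) * val m' (Uc m) i (xi m i j) w x)"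
    using val_smult[OF Uc xi(1)[OF assms(1)] assms(2,3,4)] by (intro sum.cong refl) simp
  finally show ?thesis .
qed

lemma lsec_eqI:
  assumes "i \<in> {1..n}" "b \<in> S i (Uc m)"
    "\<And>x w. x \<in> Uc m \<Longrightarrow> w \<in> mons i \<Longrightarrow> val m (Uc m) i b w x = (\<Sum>j<q i. a (basis_vec j) * val m (Uc m) i (xi m i j) w x)"
  shows "lsec m i a = b"
proof (rule val_inj[OF Uc lsec_closed[OF assms(1)] assms(2)])
  fix x assume "x \<in> Uc m"
  then show "\<exists>m'. x \<in> Uc m' \<and> (\<forall>w\<in>mons i. val m' (Uc m) i (lsec m i a) w x = val m' (Uc m) i b w x)"
    using assms(3) val_lsec[OF assms(1)] by (intro exI[of _ m]) simp
qed

lemma basis_vec_in: "j < r \<Longrightarrow> basis_vec j \<in> seq_space r"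
  by (auto simp: seq_space_def)

lemma lsec_add:
  assumes "i \<in> {1..n}"
  shows "lsec m i (a \<oplus>\<^bsub>W i\<^esub> b) = lsec m i a \<oplus>\<^bsub>sec A i (Uc m)\<^esub> lsec m i b"
proof (rule lsec_eqI[OF assms add_closed[OF Uc lsec_closed[OF assms] lsec_closed[OF assms]]])
  fix x w assume xw: "x \<in> Uc m" "w \<in> mons i"
  have "val m (Uc m) i (lsec m i a \<oplus>\<^bsub>sec A i (Uc m)\<^esub> lsec m i b) w x =
     (\<Sum>j<q i. (a (basis_vec j) + b (basis_vec j)) * val m (Uc m) i (xi m i j) w x)"
    using val_add[OF Uc lsec_closed[OF assms] lsec_closed[OF assms] xw(2,1,1)] val_lsec[OF assms xw(2,1,1)]
    by (simp add: distrib_right sum.distrib)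
  then show "val m (Uc m) i (lsec m i a \<oplus>\<^bsub>sec A i (Uc m)\<^esub> lsec m i b) w x =
     (\<Sum>j<q i. (a \<oplus>\<^bsub>W i\<^esub> b) (basis_vec j) * val m (Uc m) i (xi m i j) w x)"
    by (simp add: dual_letters_def dual_space_def basis_vec_in)
qed

lemma lsec_smult:
  assumes "i \<in> {1..n}"
  shows "lsec m i (c \<odot>\<^bsub>W i\<^esub> a) = c \<odot>\<^bsub>sec A i (Uc m)\<^esub> lsec m i a"
proof (rule lsec_eqI[OF assms smult_closed[OF Uc lsec_closed[OF assms]]])
  fix x w assume xw: "x \<in> Uc m" "w \<in> mons i"
  have "val m (Uc m) i (c \<odot>\<^bsub>sec A i (Uc m)\<^esub> lsec m i a) w x =
     (\<Sum>j<q i. (c * a (basis_vec j)) * val m (Uc m) i (xi m i j) w x)"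
    using val_smult[OF Uc lsec_closed[OF assms] xw(2,1,1)] val_lsec[OF assms xw(2,1,1)]
    by (simp add: sum_distrib_left mult.assoc)
  then show "val m (Uc m) i (c \<odot>\<^bsub>sec A i (Uc m)\<^esub> lsec m i a) w x =
     (\<Sum>j<q i. (c \<odot>\<^bsub>W i\<^esub> a) (basis_vec j) * val m (Uc m) i (xi m i j) w x)"
    by (simp add: dual_letters_def dual_space_def basis_vec_in)
qed

lemma lsec_coord:
  assumes "i \<in> {1..n}" "j < q i"
  shows "lsec m i (coord (q i) j) = xi m i j"
proof (rule lsec_eqI[OF assms(1) xi(1)[OF assms]])
  fix x w assume xw: "x \<in> Uc m" "w \<in> mons i"
  have "(\<Sum>j'<q i. coord (q i) j (basis_vec j') * val m (Uc m) i (xi m i j') w x) =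
     (\<Sum>j'<q i. if j' = j then val m (Uc m) i (xi m i j') w x else 0)"
    by (intro sum.cong refl) (auto simp: coord_def basis_vec_in lookup_single when_def)
  then show "val m (Uc m) i (xi m i j) w x = (\<Sum>j'<q i. coord (q i) j (basis_vec j') * val m (Uc m) i (xi m i j') w x)"
    using assms(2) by (simp add: sum.delta)
qed

section \<open>Words in dual vectors evaluated as sections\<close>

definition lword :: "nat \<Rightarrow> (nat \<times> ((nat \<Rightarrow>\<^sub>0 real) \<Rightarrow> real)) list \<Rightarrow> 's" where
  "lword m u = gprod A (Uc m) (map (\<lambda>(i, a). (i, lsec m i a)) u)"

lemma wdeg_map_lsec [simp]: "wdeg (map (\<lambda>(i, a). (i, lsec m i a)) u) = wdeg u"
  by (simp add: case_prod_unfold comp_def)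

lemma map_lsec_hom:
  assumes "u \<in> lists (letters n W)"
  shows "set (map (\<lambda>(i, a). (i, lsec m i a)) u) \<subseteq> hom_sections (Uc m)"
proof -
  have "lsec m i a \<in> S i (Uc m)" if "(i, a) \<in> set u" for i a
    using that assms lsec_closed by (auto simp: letters_def in_lists_conv_set)
  then show ?thesis by (auto simp: hom_sections_def)
qed

lemma lword_closed: "u \<in> lists (letters n W) \<Longrightarrow> lword m u \<in> S (wdeg u) (Uc m)"
  unfolding lword_def using gprod_closed[OF Uc map_lsec_hom[of u m]] by (simp only: wdeg_map_lsec)

lemma lword_append:
  "u \<in> lists (letters n W) \<Longrightarrow> v \<in> lists (letters n W) \<Longrightarrow>
    lword m (u @ v) = gmul A (wdeg u) (wdeg v) (Uc m) (lword m u) (lword m v)"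
  unfolding lword_def using gprod_append[OF Uc map_lsec_hom[of u m] map_lsec_hom[of v m]]
  by (simp only: wdeg_map_lsec map_append)

lemma lword_coord:
  assumes "set w \<subseteq> gens n q"
  shows "lword m (coord_word q w) = xword m w"
proof -
  have "map (\<lambda>(i, a). (i, lsec m i a)) (coord_word q w) = map (\<lambda>(i, j). (i, xi m i j)) w"
    using assms lsec_coord by (auto simp: coord_word_def gens_def)
  then show ?thesis unfolding lword_def gword_eq_gprod by simp
qed

lemma lword_add:
  assumes "u \<in> lists (letters n W)" "v \<in> lists (letters n W)" and i: "i \<in> {1..n}"
  shows "lword m (u @ [(i, a \<oplus>\<^bsub>W i\<^esub> b)] @ v) =
    lword m (u @ [(i, a)] @ v) \<oplus>\<^bsub>sec A (wdeg (u @ [(i, a)] @ v)) (Uc m)\<^esub> lword m (u @ [(i, b)] @ v)"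
  using gprod_add[OF Uc map_lsec_hom[OF assms(1)] map_lsec_hom[OF assms(2)] lsec_closed[OF i] lsec_closed[OF i], of m a b]
  by (simp add: lword_def lsec_add[OF i])

lemma lword_smult:
  assumes "u \<in> lists (letters n W)" "v \<in> lists (letters n W)" and i: "i \<in> {1..n}"
  shows "lword m (u @ [(i, c \<odot>\<^bsub>W i\<^esub> a)] @ v) =
    c \<odot>\<^bsub>sec A (wdeg (u @ [(i, a)] @ v)) (Uc m)\<^esub> lword m (u @ [(i, a)] @ v)"
  using gprod_smult[OF Uc map_lsec_hom[OF assms(1)] map_lsec_hom[OF assms(2)] lsec_closed[OF i], of m c a]
  by (simp add: lword_def lsec_smult[OF i])

lemma lword_swap:
  assumes "u @ [(i, a), (j, b)] @ v \<in> lists (letters n W)"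
  shows "lword m (u @ [(i, a), (j, b)] @ v) =
    (- 1) ^ (i * j) \<odot>\<^bsub>sec A (wdeg (u @ [(i, a), (j, b)] @ v)) (Uc m)\<^esub> lword m (u @ [(j, b), (i, a)] @ v)"
  using gprod_swap[OF Uc, of "map (\<lambda>(i, a). (i, lsec m i a)) u" i "lsec m i a" j "lsec m j b"
      "map (\<lambda>(i, a). (i, lsec m i a)) v" m] map_lsec_hom[OF assms, of m]
  by (simp add: lword_def)

text \<open>The coefficient at \<open>w\<close>, in chart m at x, of the section obtained by
  substituting generators into a formal word. Words of another degree are sent to 0, which makes it
  a linear functional on all formal combinations.\<close>

definition ev :: "nat \<Rightarrow> nat \<Rightarrow> 'a \<Rightarrow> (nat \<times> nat) list \<Rightarrow> ((nat \<Rightarrow>\<^sub>0 real) \<Rightarrow> real) words \<Rightarrow> real" where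
  "ev m k x w = linear_ext (\<lambda>u. if wdeg u = k then val m (Uc m) k (lword m u) w x else 0)"

lemma linear_ev: "linear (ev m k x w)"
  unfolding ev_def by (rule linear_linear_ext)

lemma ev_word: "wdeg u = k \<Longrightarrow> ev m k x w (word u) = val m (Uc m) k (lword m u) w x"
  by (simp add: ev_def)

text \<open>Multilinearity and graded commutativity hold in the sheaf, so evaluation kills the
  relations and descends to the symmetric algebra.\<close>

lemma ev_ideal:
  assumes x: "x \<in> Uc m" and w: "w \<in> mons k" and h: "h \<in> gsym_ideal n W"
  shows "ev m k x w h = 0"
proof -
  let ?L = "lists (letters n W)"
  have iL: "i \<in> {1..n}" if "(i, a) \<in> letters n W" for i a using that by (auto simp: letters_def)
  have "ev m k x w h \<in> {0}"
  proof (rule gsym_ideal_linear_image[OF linear_ev subspace_single_0 _ _ _ h])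
    fix u v i a b
    assume uv: "u \<in> ?L" "v \<in> ?L" and ab: "(i, a) \<in> letters n W" "(i, b) \<in> letters n W"
    have l: "u @ [(i, a)] @ v \<in> ?L" "u @ [(i, b)] @ v \<in> ?L" using uv ab by auto
    show "ev m k x w (word (u @ [(i, a \<oplus>\<^bsub>W i\<^esub> b)] @ v)) - ev m k x w (word (u @ [(i, a)] @ v)) -
        ev m k x w (word (u @ [(i, b)] @ v)) \<in> {0}"
    proof (cases "wdeg (u @ [(i, a)] @ v) = k")
      case True
      then have d: "wdeg (u @ [(i, c)] @ v) = k" for c :: "(nat \<Rightarrow>\<^sub>0 real) \<Rightarrow> real" by simp
      have "lword m (u @ [(i, a \<oplus>\<^bsub>W i\<^esub> b)] @ v) = lword m (u @ [(i, a)] @ v) \<oplus>\<^bsub>sec A k (Uc m)\<^esub> lword m (u @ [(i, b)] @ v)"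
        using lword_add[OF uv iL[OF ab(1)], of m a b] unfolding True .
      then show ?thesis
        unfolding ev_word[OF d]
        using val_add[OF Uc lword_closed[OF l(1), unfolded d] lword_closed[OF l(2), unfolded d] w x x] by simp
    qed (simp add: ev_def)
  next
    fix u v i c a
    assume uv: "u \<in> ?L" "v \<in> ?L" and a: "(i, a) \<in> letters n W"
    have l: "u @ [(i, a)] @ v \<in> ?L" using uv a by auto
    show "ev m k x w (word (u @ [(i, c \<odot>\<^bsub>W i\<^esub> a)] @ v)) - c *\<^sub>R ev m k x w (word (u @ [(i, a)] @ v)) \<in> {0}"
    proof (cases "wdeg (u @ [(i, a)] @ v) = k")
      case True
      then have d: "wdeg (u @ [(i, c)] @ v) = k" for c :: "(nat \<Rightarrow>\<^sub>0 real) \<Rightarrow> real" by simp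
      have "lword m (u @ [(i, c \<odot>\<^bsub>W i\<^esub> a)] @ v) = c \<odot>\<^bsub>sec A k (Uc m)\<^esub> lword m (u @ [(i, a)] @ v)"
        using lword_smult[OF uv iL[OF a], of m c a] unfolding True .
      then show ?thesis
        unfolding ev_word[OF d]
        using val_smult[OF Uc lword_closed[OF l(1), unfolded d] w x x] by simp
    qed (simp add: ev_def)
  next
    fix u v i a j b
    assume uv: "u \<in> ?L" "v \<in> ?L" and ab: "(i, a) \<in> letters n W" "(j, b) \<in> letters n W"
    have l: "u @ [(i, a), (j, b)] @ v \<in> ?L" "u @ [(j, b), (i, a)] @ v \<in> ?L" using uv ab by auto
    show "ev m k x w (word (u @ [(i, a), (j, b)] @ v)) -
        (- 1) ^ (i * j) *\<^sub>R ev m k x w (word (u @ [(j, b), (i, a)] @ v)) \<in> {0}"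
    proof (cases "wdeg (u @ [(i, a), (j, b)] @ v) = k")
      case True
      have d: "wdeg (u @ [(j, b), (i, a)] @ v) = k" using True by simp
      have "lword m (u @ [(i, a), (j, b)] @ v) = (- 1) ^ (i * j) \<odot>\<^bsub>sec A k (Uc m)\<^esub> lword m (u @ [(j, b), (i, a)] @ v)"
        using lword_swap[OF l(1), of m] unfolding True .
      then show ?thesis
        unfolding ev_word[OF d] ev_word[OF True]
        using val_smult[OF Uc lword_closed[OF l(2), unfolded d] w x x] by simp
    qed (simp add: ev_def add.left_commute)
  qed
  then show ?thesis by simp
qed

lemma ev_deg_words:
  assumes "f \<in> deg_words n W k"
  shows "ev m k x w f = (\<Sum>u\<in>Poly_Mapping.keys f. Poly_Mapping.lookup f u * val m (Uc m) k (lword m u) w x)"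
  unfolding ev_def linear_ext_def using assms by (intro sum.cong refl) (auto simp: deg_words_def)

text \<open>The structure constants are those of \<open>val_gmul\<close>: evaluation at x turns
  products of words into products of values.\<close>

lemma ev_mult:
  assumes f: "f \<in> deg_words n W k" and g: "g \<in> deg_words n W l" and x: "x \<in> Uc m" and w: "w \<in> mons (k + l)"
  shows "ev m (k + l) x w (words_mult f g) =
    (\<Sum>u\<in>mons k. \<Sum>v\<in>mons l. ev m k x u f * ev m l x v g * eta_word_mult m k l u v w x)"
proof -
  let ?K = "Poly_Mapping.keys" and ?l = "Poly_Mapping.lookup"
  let ?v = "\<lambda>k s u. val m (Uc m) k (lword m s) u x"
  have sL: "s \<in> lists (letters n W)" "wdeg s = k" if "s \<in> ?K f" for s using f that by (auto simp: deg_words_def)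
  have tL: "t \<in> lists (letters n W)" "wdeg t = l" if "t \<in> ?K g" for t using g that by (auto simp: deg_words_def)
  have "ev m (k + l) x w (words_mult f g) =
      (\<Sum>s\<in>?K f. \<Sum>t\<in>?K g. ev m (k + l) x w (Poly_Mapping.single (s @ t) (?l f s * ?l g t)))"
    unfolding words_mult_def by (simp add: linear_sum[OF linear_ev])
  also have "\<dots> = (\<Sum>s\<in>?K f. \<Sum>t\<in>?K g. ?l f s * ?l g t *
      (\<Sum>u\<in>mons k. \<Sum>v\<in>mons l. ?v k s u * ?v l t v * eta_word_mult m k l u v w x))"
  proof (intro sum.cong refl)
    fix s t assume st: "s \<in> ?K f" "t \<in> ?K g"
    note s = sL[OF st(1)] and t = tL[OF st(2)]
    have "Poly_Mapping.single (s @ t) (?l f s * ?l g t) = (?l f s * ?l g t) *\<^sub>R word (s @ t)"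
      by (simp add: scaleR_single)
    then have "ev m (k + l) x w (Poly_Mapping.single (s @ t) (?l f s * ?l g t)) = ?l f s * ?l g t * ?v (k + l) (s @ t) w"
      using ev_word[of "s @ t" "k + l" m x w] s t by (simp add: linear_cmul[OF linear_ev])
    also have "?v (k + l) (s @ t) w = (\<Sum>u\<in>mons k. \<Sum>v\<in>mons l. ?v k s u * ?v l t v * eta_word_mult m k l u v w x)"
      using val_gmul[OF Uc lword_closed[OF s(1), unfolded s(2)] lword_closed[OF t(1), unfolded t(2)] w x x]
        lword_append[OF s(1) t(1), of m] s t by simp
    finally show "ev m (k + l) x w (Poly_Mapping.single (s @ t) (?l f s * ?l g t)) = ?l f s * ?l g t *
        (\<Sum>u\<in>mons k. \<Sum>v\<in>mons l. ?v k s u * ?v l t v * eta_word_mult m k l u v w x)" .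
  qed
  also have "\<dots> = (\<Sum>u\<in>mons k. \<Sum>v\<in>mons l. (\<Sum>s\<in>?K f. ?l f s * ?v k s u) * (\<Sum>t\<in>?K g. ?l g t * ?v l t v) *
      eta_word_mult m k l u v w x)"
    by (rule sum_bilinear[symmetric])
  finally show ?thesis by (simp add: ev_deg_words[OF f] ev_deg_words[OF g])
qed

lemma ev_coord_words:
  "ev m k x u (\<Sum>w\<in>mons k. c w *\<^sub>R word (coord_word q w)) = (\<Sum>w\<in>mons k. c w * val m (Uc m) k (xword m w) u x)"
proof -
  have "ev m k x u (word (coord_word q w)) = val m (Uc m) k (xword m w) u x" if "w \<in> mons k" for w
    using ev_word[of "coord_word q w" k m x u] lword_coord[OF gmonomialsD(1)[OF that]] gmonomialsD(2)[OF that] by simp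
  then show ?thesis by (simp add: linear_sum[OF linear_ev] linear_cmul[OF linear_ev])
qed

text \<open>Modulo the ideal \<open>f\<close> is a combination of sorted coordinate words. These
  evaluate to the monomials in \<open>xi\<close>, whose values at x are independent, so all
  coefficients vanish. Together with \<open>ev_ideal\<close> this identifies the kernel of the
  evaluations with the degree k part of the ideal.\<close>

lemma ev_injective:
  assumes f: "f \<in> deg_words n W k" and x: "x \<in> Uc m" and 0: "\<And>u. u \<in> mons k \<Longrightarrow> ev m k x u f = 0"
  shows "f \<in> gsym_ideal n W"
proof -
  obtain c where c: "f - (\<Sum>w\<in>mons k. c w *\<^sub>R word (coord_word q w)) \<in> gsym_ideal n W"
    using coord_words_span[OF f] by blast
  have "(\<Sum>w\<in>mons k. c w * val m (Uc m) k (xword m w) u x) = 0" if "u \<in> mons k" for u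
    using ev_ideal[OF x that c] 0[OF that] by (simp add: linear_diff[OF linear_ev] ev_coord_words)
  then have "c w = 0" if "w \<in> mons k" for w using xwords_independent[OF x _ that] by blast
  then show ?thesis using c by simp
qed

section \<open>Formal words representing a section at a point\<close>

text \<open>\<open>f\<close> represents the section \<open>a\<close> at the point \<open>x\<close>. The chart \<open>ch x\<close> used to compare the two is
  arbitrary but fixed at each point, because it identifies the constant model fibre with the fibre
  of the bundle over \<open>x\<close>.\<close>

definition rep :: "nat \<Rightarrow> 'a \<Rightarrow> ((nat \<Rightarrow>\<^sub>0 real) \<Rightarrow> real) words \<Rightarrow> 'a set \<Rightarrow> 's \<Rightarrow> bool" where
  "rep k x f U a \<longleftrightarrow> f \<in> deg_words n W k \<and> (\<forall>w\<in>mons k. ev (ch x) k x w f = val (ch x) U k a w x)"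

text \<open>One direction is the vanishing of evaluations on the ideal, the other their injectivity
  modulo it. Consequently the class at x and the value at x determine each other.\<close>

lemma rep_class_eq_iff:
  assumes "rep k x f U a" "rep k x g V b" and x: "x \<in> topspace X"
  shows "gsym_class n W f = gsym_class n W g \<longleftrightarrow> (\<forall>w\<in>mons k. val (ch x) U k a w x = val (ch x) V k b w x)"
proof
  assume "gsym_class n W f = gsym_class n W g"
  then have "f - g \<in> gsym_ideal n W" by (simp add: gsym_class_eq_iff)
  then have "ev (ch x) k x w f = ev (ch x) k x w g" if "w \<in> mons k" for w
    using ev_ideal[OF ch[OF x] that] linear_diff[OF linear_ev, of "ch x" k x w f g] by simp
  then show "\<forall>w\<in>mons k. val (ch x) U k a w x = val (ch x) V k b w x"
    using assms(1,2) by (simp add: rep_def)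
next
  assume eq: "\<forall>w\<in>mons k. val (ch x) U k a w x = val (ch x) V k b w x"
  have "f - g \<in> deg_words n W k" using assms(1,2) subspace_diff[OF subspace_deg_words] by (auto simp: rep_def)
  then have "f - g \<in> gsym_ideal n W"
    by (rule ev_injective[OF _ ch[OF x]]) (use eq assms(1,2) in \<open>auto simp: rep_def linear_diff[OF linear_ev]\<close>)
  then show "gsym_class n W f = gsym_class n W g" by (simp add: gsym_class_eq_iff)
qed

lemma rep_lincomb:
  assumes "\<And>i. i \<in> I \<Longrightarrow> rep k x (f i) (V i) (b i)"
    "\<And>w. w \<in> mons k \<Longrightarrow> val (ch x) U k a w x = (\<Sum>i\<in>I. c i * val (ch x) (V i) k (b i) w x)"
  shows "rep k x (\<Sum>i\<in>I. c i *\<^sub>R f i) U a"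
  unfolding rep_def
proof (intro conjI ballI)
  show "(\<Sum>i\<in>I. c i *\<^sub>R f i) \<in> deg_words n W k"
    using assms(1) by (intro subspace_sum subspace_scale subspace_deg_words) (simp add: rep_def)
  show "ev (ch x) k x w (\<Sum>i\<in>I. c i *\<^sub>R f i) = val (ch x) U k a w x" if w: "w \<in> mons k" for w
    unfolding assms(2)[OF w] linear_sum[OF linear_ev] linear_cmul[OF linear_ev]
    using assms(1) w by (intro sum.cong refl) (simp add: rep_def)
qed

context
  fixes U x assumes U: "openin X U" and x: "x \<in> U"
begin

lemma point_in_chart: "x \<in> topspace X" "x \<in> Uc (ch x)"
  using x openin_subset[OF U] ch by blast+

text \<open>Surjectivity of the evaluation at x: the coefficients of \<open>a\<close> in the
  generators of chart \<open>ch x\<close>, frozen at x, are put in front of the coordinate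
  words.\<close>

lemma rep_exists:
  assumes a: "a \<in> S k U"
  shows "\<exists>f. rep k x f U a"
proof -
  obtain f where f: "\<And>w. w \<in> mons k \<Longrightarrow> smooth_fun M (U \<inter> Uc (ch x)) (f w)"
    "\<And>y u. y \<in> U \<Longrightarrow> y \<in> Uc (ch x) \<Longrightarrow> u \<in> mons k \<Longrightarrow>
      val (ch x) U k a u y = (\<Sum>w\<in>mons k. f w y * val (ch x) (Uc (ch x)) k (xword (ch x) w) u y)"
    by (rule xwords_generate[OF U a, of "ch x"]) (rule that, assumption+)
  have "rep k x (\<Sum>w\<in>mons k. f w x *\<^sub>R word (coord_word q w)) U a"
    unfolding rep_def
  proof (intro conjI ballI)
    have "word (coord_word q w) \<in> deg_words n W k" if "w \<in> mons k" for w
      using word_in_deg_words[OF coord_word_lists[OF gmonomialsD(1)[OF that]]] gmonomialsD(2)[OF that] by simp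
    then show "(\<Sum>w\<in>mons k. f w x *\<^sub>R word (coord_word q w)) \<in> deg_words n W k"
      by (intro subspace_sum subspace_scale subspace_deg_words)
    show "ev (ch x) k x u (\<Sum>w\<in>mons k. f w x *\<^sub>R word (coord_word q w)) = val (ch x) U k a u x" if "u \<in> mons k" for u
      using f(2)[OF x point_in_chart(2) that] by (simp add: ev_coord_words)
  qed
  then show ?thesis by blast
qed

lemma rep_add:
  assumes "a \<in> S k U" "b \<in> S k U" "rep k x f U a" "rep k x g U b"
  shows "rep k x (f + g) U (a \<oplus>\<^bsub>sec A k U\<^esub> b)"
  using assms(3,4) val_add[OF U assms(1,2) _ x point_in_chart(2)] subspace_add[OF subspace_deg_words, of f n W k g]
  by (simp add: rep_def linear_add[OF linear_ev])

lemma rep_smult: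
  assumes "a \<in> S k U" "rep k x f U a"
  shows "rep k x (c *\<^sub>R f) U (c \<odot>\<^bsub>sec A k U\<^esub> a)"
  using assms(2) val_smult[OF U assms(1) _ x point_in_chart(2)] subspace_scale[OF subspace_deg_words, of f n W k c]
  by (simp add: rep_def linear_cmul[OF linear_ev])

lemma rep_mult:
  assumes "a \<in> S k U" "b \<in> S l U" "rep k x f U a" "rep l x g U b"
  shows "rep (k + l) x (words_mult f g) U (gmul A k l U a b)"
  unfolding rep_def
proof (intro conjI ballI)
  have fg: "f \<in> deg_words n W k" "g \<in> deg_words n W l" using assms(3,4) by (auto simp: rep_def)
  then show "words_mult f g \<in> deg_words n W (k + l)" by (rule words_mult_deg_words)
  fix w assume w: "w \<in> mons (k + l)"
  show "ev (ch x) (k + l) x w (words_mult f g) = val (ch x) U (k + l) (gmul A k l U a b) w x"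
    unfolding ev_mult[OF fg point_in_chart(2) w] val_gmul[OF U assms(1,2) w x point_in_chart(2)]
    using assms(3,4) by (intro sum.cong refl) (simp add: rep_def)
qed

lemma rep_res:
  assumes "a \<in> S k U" "rep k x f U a" "openin X V" "V \<subseteq> U" "x \<in> V"
  shows "rep k x f V (res A k U V a)"
  using assms(2) val_res[OF U assms(1,3,4) _ assms(5) point_in_chart(2)] by (simp add: rep_def)

lemma rep_one: "rep 0 x (word []) U (gone A U)"
proof -
  have g: "gone A (Uc (ch x)) \<in> S 0 (Uc (ch x))" using one_closed Uc by blast
  have i: "openin X (U \<inter> Uc (ch x))" "U \<inter> Uc (ch x) \<subseteq> U" "U \<inter> Uc (ch x) \<subseteq> Uc (ch x)"
    using U Uc by auto
  have "val (ch x) (Uc (ch x)) 0 (gone A (Uc (ch x))) w x = val (ch x) U 0 (gone A U) w x" if w: "w \<in> mons 0" for w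
    using val_res[OF Uc g i(1,3) w _ point_in_chart(2)] val_res[OF U one_closed[OF U] i(1,2) w _ point_in_chart(2)]
      res_one[OF Uc i(1,3)] res_one[OF U i(1,2)] x point_in_chart(2) by simp
  moreover have "word [] \<in> deg_words n W 0" by (rule word_in_deg_words) auto
  ultimately show ?thesis using ev_word[of "[]" 0 "ch x" x] by (simp add: rep_def lword_def)
qed

lemma rep_gword:
  assumes "\<And>i j. i \<in> {1..n} \<Longrightarrow> j < q i \<Longrightarrow> \<xi> i j \<in> S i U"
    "\<And>i j. i \<in> {1..n} \<Longrightarrow> j < q i \<Longrightarrow> rep i x (word [(i, \<alpha> i j)]) U (\<xi> i j)" "set w \<subseteq> gens n q"
  shows "rep (wdeg w) x (word (map (\<lambda>(i, j). (i, \<alpha> i j)) w)) U (gword A U \<xi> w)"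
  using assms(3)
proof (induction w)
  case Nil
  then show ?case using rep_one by simp
next
  case (Cons y w)
  obtain i j where y: "y = (i, j)" by fastforce
  then have ij: "i \<in> {1..n}" "j < q i" using Cons.prems by (auto simp: gens_def)
  have "gword A U \<xi> w \<in> S (wdeg w) U"
    by (rule gword_closed[where n = n and q = q and \<xi> = \<xi>, OF U assms(1)]) (use Cons.prems in auto)
  then have "rep (i + wdeg w) x (words_mult (word [(i, \<alpha> i j)]) (word (map (\<lambda>(i, j). (i, \<alpha> i j)) w))) U
      (gmul A i (wdeg w) U (\<xi> i j) (gword A U \<xi> w))"
    using Cons assms(1,2)[OF ij] by (intro rep_mult) auto
  then show ?case by (simp add: words_mult_word y)
qed

end

section \<open>The vector bundles\<close>

text \<open>The model fibre over x carries the frame of chart \<open>ch x\<close>, so the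
  trivialization of chart m is the transition matrix from m to \<open>ch x\<close>. The choice of
  \<open>ch x\<close> may jump from point to point, but it cancels in the comparison of two
  trivializations, which is all that has to be smooth.\<close>

definition phi :: "nat \<Rightarrow> nat \<Rightarrow> 'a \<Rightarrow> (nat \<Rightarrow>\<^sub>0 real) \<Rightarrow> nat \<Rightarrow> real" where
  "phi m i x v j = (if j < q i then \<Sum>j'<q i. transition m (ch x) i j j' x * Poly_Mapping.lookup v j' else 0)"

definition split_bundle :: "nat \<Rightarrow> ('a, nat \<Rightarrow>\<^sub>0 real) vbundle" where
  "split_bundle i = \<lparr>vrank = q i, vfib = (\<lambda>_. seq_space (q i)), vtriv = range (\<lambda>m. (Uc m, phi m i))\<rparr>"

definition phi_inv :: "nat \<Rightarrow> nat \<Rightarrow> 'a \<Rightarrow> (nat \<Rightarrow> real) \<Rightarrow> nat \<Rightarrow>\<^sub>0 real" where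
  "phi_inv m i x y = (\<Sum>j'<q i. (\<Sum>j<q i. transition (ch x) m i j' j x * y j) *\<^sub>R basis_vec j')"

lemma lookup_phi_inv:
  "Poly_Mapping.lookup (phi_inv m i x y) j' = (if j' < q i then \<Sum>j<q i. transition (ch x) m i j' j x * y j else 0)"
proof -
  have "Poly_Mapping.lookup (phi_inv m i x y) j' =
    (\<Sum>s<q i. if s = j' then \<Sum>j<q i. transition (ch x) m i s j x * y j else 0)"
    unfolding phi_inv_def lookup_sum by (intro sum.cong refl) (auto simp: lookup_single when_def)
  then show ?thesis by (simp add: sum.delta)
qed

lemma phi_inv_in: "phi_inv m i x y \<in> seq_space (q i)"
  by (auto simp: seq_space_def in_keys_iff lookup_phi_inv split: if_splits)

text \<open>The cocycle identity removes the intermediate chart \<open>ch x\<close>.\<close>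

lemma phi_phi_inv:
  assumes i: "i \<in> {1..n}" and x: "x \<in> Uc m" "x \<in> Uc m'" and j: "j < q i"
  shows "phi m' i x (phi_inv m i x y) j = (\<Sum>j''<q i. transition m' m i j j'' x * y j'')"
proof -
  have "x \<in> topspace X" using x openin_subset[OF Uc] by blast
  note c = ch[OF this]
  have "phi m' i x (phi_inv m i x y) j =
     (\<Sum>j'<q i. \<Sum>j''<q i. transition m' (ch x) i j j' x * transition (ch x) m i j' j'' x * y j'')"
    using j by (simp add: phi_def lookup_phi_inv sum_distrib_left mult.assoc)
  also have "\<dots> = (\<Sum>j''<q i. \<Sum>j'<q i. transition m' (ch x) i j j' x * transition (ch x) m i j' j'' x * y j'')"
    by (rule sum.swap)
  also have "\<dots> = (\<Sum>j''<q i. transition m' m i j j'' x * y j'')"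
    using trans_cocycle[OF i j _ x(2) c x(1)] by (intro sum.cong refl) (simp add: sum_distrib_right)
  finally show ?thesis .
qed

lemma sum_delta_mult: "j < (r::nat) \<Longrightarrow> (\<Sum>j'<r. (if j = j' then 1 else 0) * y j') = (y j :: real)"
  by (simp add: if_distrib[of "\<lambda>t. t * _"] sum.delta cong: if_cong)

lemma phi_inv_phi:
  assumes i: "i \<in> {1..n}" and x: "x \<in> Uc m" and v: "v \<in> seq_space (q i)"
  shows "phi_inv m i x (phi m i x v) = v"
proof (rule poly_mapping_eqI)
  fix j'
  have "x \<in> topspace X" using x openin_subset[OF Uc] by blast
  note c = ch[OF this]
  show "Poly_Mapping.lookup (phi_inv m i x (phi m i x v)) j' = Poly_Mapping.lookup v j'"
  proof (cases "j' < q i")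
    case True
    have "(\<Sum>j<q i. transition (ch x) m i j' j x * phi m i x v j) =
       (\<Sum>j<q i. \<Sum>j''<q i. transition (ch x) m i j' j x * transition m (ch x) i j j'' x * Poly_Mapping.lookup v j'')"
      by (simp add: phi_def sum_distrib_left mult.assoc)
    also have "\<dots> = (\<Sum>j''<q i. \<Sum>j<q i. transition (ch x) m i j' j x * transition m (ch x) i j j'' x * Poly_Mapping.lookup v j'')"
      by (rule sum.swap)
    also have "\<dots> = (\<Sum>j''<q i. (if j' = j'' then 1 else 0) * Poly_Mapping.lookup v j'')"
      using trans_cocycle[OF i True _ c x c] trans_self[OF i True _ c]
      by (intro sum.cong refl) (simp add: sum_distrib_right[symmetric])
    finally show ?thesis using True by (simp add: lookup_phi_inv sum_delta_mult)
  next
    case False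
    then have "Poly_Mapping.lookup v j' = 0"
      using v by (auto simp: seq_space_def in_keys_iff subset_iff)
    then show ?thesis using False by (simp add: lookup_phi_inv)
  qed
qed

lemma phi_bij:
  assumes i: "i \<in> {1..n}" and x: "x \<in> Uc m"
  shows "bij_betw (phi m i x) (seq_space (q i)) (topspace (Euclidean_space (q i)))"
proof (rule bij_betw_byWitness[where f' = "phi_inv m i x"])
  show "\<forall>v\<in>seq_space (q i). phi_inv m i x (phi m i x v) = v" using phi_inv_phi[OF i x] by blast
  show "\<forall>y\<in>topspace (Euclidean_space (q i)). phi m i x (phi_inv m i x y) = y"
  proof (intro ballI ext)
    fix y j assume y: "y \<in> topspace (Euclidean_space (q i))"
    show "phi m i x (phi_inv m i x y) j = y j"
    proof (cases "j < q i")
      case True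
      have "(\<Sum>j''<q i. transition m m i j j'' x * y j'') = (\<Sum>j''<q i. (if j = j'' then 1 else 0) * y j'')"
        using trans_self[OF i True _ x] by (intro sum.cong refl) simp
      then show ?thesis using phi_phi_inv[OF i x x True] sum_delta_mult[OF True] by simp
    next
      case False
      then show ?thesis using y by (simp add: phi_def topspace_Euclidean_space)
    qed
  qed
  show "phi m i x ` seq_space (q i) \<subseteq> topspace (Euclidean_space (q i))"
    by (auto simp: phi_def topspace_Euclidean_space)
  show "phi_inv m i x ` topspace (Euclidean_space (q i)) \<subseteq> seq_space (q i)"
    using phi_inv_in by blast
qed

lemma split_bundle_smooth:
  assumes i: "i \<in> {1..n}"
  shows "smooth_vector_bundle M (split_bundle i)"
proof -
  have lin: "phi m i x (v + w) j = phi m i x v j + phi m i x w j" "phi m i x (c *\<^sub>R v) j = c * phi m i x v j" for m x v w c j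
    by (auto simp: phi_def lookup_add distrib_left sum.distrib sum_distrib_left mult.left_commute)
  have tr: "smooth_fun M (Uc m \<inter> Uc m') (\<lambda>x. phi m' i x (inv_into (seq_space (q i)) (phi m i x) (unit_vec s)) t)"
    if st: "s < q i" "t < q i" for m m' s t
  proof -
    have o: "openin X (Uc m \<inter> Uc m')" using Uc by blast
    have "phi m' i x (inv_into (seq_space (q i)) (phi m i x) (unit_vec s)) t = transition m' m i t s x"
      if x: "x \<in> Uc m \<inter> Uc m'" for x
    proof -
      have u: "unit_vec s \<in> topspace (Euclidean_space (q i))"
        using st by (auto simp: unit_vec_def topspace_Euclidean_space)
      have "phi m i x (phi_inv m i x (unit_vec s)) = unit_vec s"
      proof
        fix j show "phi m i x (phi_inv m i x (unit_vec s)) j = unit_vec s j"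
        proof (cases "j < q i")
          case True
          have "(\<Sum>j''<q i. transition m m i j j'' x * unit_vec s j'') = (\<Sum>j''<q i. (if j = j'' then 1 else 0) * unit_vec s j'')"
            using trans_self[OF i True, of _ x m] x by (intro sum.cong refl) simp
          then show ?thesis using phi_phi_inv[OF i, of x m m j] x True sum_delta_mult[OF True] by simp
        next
          case False
          then show ?thesis using st by (simp add: phi_def unit_vec_def)
        qed
      qed
      then have "inv_into (seq_space (q i)) (phi m i x) (unit_vec s) = phi_inv m i x (unit_vec s)"
        using phi_bij[OF i, of x m] x phi_inv_in by (intro inv_into_f_eq) (auto simp: bij_betw_def)
      then have "phi m' i x (inv_into (seq_space (q i)) (phi m i x) (unit_vec s)) t =
          (\<Sum>j''<q i. transition m' m i t j'' x * unit_vec s j'')"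
        using phi_phi_inv[OF i, of x m m' t] x st by simp
      also have "\<dots> = transition m' m i t s x"
        using st by (simp add: unit_vec_def if_distrib[of "\<lambda>z. _ * z"] sum.delta' cong: if_cong)
      finally show ?thesis .
    qed
    moreover have "smooth_fun M (Uc m \<inter> Uc m') (transition m' m i t s)"
      using trans_smooth[OF i st(2,1), of m' m] by (simp add: Int_commute)
    ultimately show ?thesis
      using smooth_fun_cong[OF o, of "\<lambda>x. phi m' i x (inv_into (seq_space (q i)) (phi m i x) (unit_vec s)) t" "transition m' m i t s"]
      by blast
  qed
  have cov: "\<exists>m. x \<in> Uc m" if "x \<in> topspace X" for x using cover that by blast
  show ?thesis
    unfolding smooth_vector_bundle_def split_bundle_def
    using cov subspace_seq_space Uc phi_bij[OF i] lin tr by auto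
qed

text \<open>The place where bundle and sheaf meet. The j-th coordinate functional of trivialization
  m has the coefficients \<open>transition m (ch x) i j j' x\<close> in the dual basis of the model
  fibre; by \<open>xi_trans\<close> the section \<open>xi m i j\<close> has the same coefficients in
  the generators of chart \<open>ch x\<close>, to which the dual basis evaluates.\<close>

lemma rep_frame:
  assumes i: "i \<in> {1..n}" and j: "j < q i" and x: "x \<in> Uc m"
  shows "rep i x (word [(i, \<lambda>v\<in>seq_space (q i). phi m i x v j)]) (Uc m) (xi m i j)"
proof -
  let ?a = "\<lambda>v\<in>seq_space (q i). phi m i x v j"
  have xt: "x \<in> topspace X" using x openin_subset[OF Uc] by blast
  note c = ch[OF xt]
  have "phi m i x (v + w) j = phi m i x v j + phi m i x w j" "phi m i x (b *\<^sub>R v) j = b * phi m i x v j" for v w b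
    by (auto simp: phi_def lookup_add distrib_left sum.distrib sum_distrib_left mult.left_commute)
  then have "?a \<in> carrier (dual_space (seq_space (q i)))"
    using subspace_add[OF subspace_seq_space] subspace_scale[OF subspace_seq_space] by (auto simp: dual_space_def)
  then have l: "[(i, ?a)] \<in> lists (letters n W)" using i by (simp add: letters_def dual_letters_def)
  have ab: "?a (basis_vec j') = transition m (ch x) i j j' x" if "j' < q i" for j'
  proof -
    have "(\<Sum>s<q i. transition m (ch x) i j s x * Poly_Mapping.lookup (basis_vec j') s) =
       (\<Sum>s<q i. if s = j' then transition m (ch x) i j s x else 0)"
      by (intro sum.cong refl) (auto simp: lookup_single when_def)
    then show ?thesis using that j by (simp add: basis_vec_in phi_def sum.delta)
  qed
  have lw: "lword (ch x) [(i, ?a)] = lsec (ch x) i ?a"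
    unfolding lword_def using mul_one[OF Uc lsec_closed[OF i]] by simp
  have "ev (ch x) i x w (word [(i, ?a)]) = val (ch x) (Uc m) i (xi m i j) w x" if w: "w \<in> mons i" for w
  proof -
    have "ev (ch x) i x w (word [(i, ?a)]) = val (ch x) (Uc (ch x)) i (lsec (ch x) i ?a) w x"
      using ev_word[of "[(i, ?a)]" i "ch x" x w] unfolding lw by simp
    also have "\<dots> = (\<Sum>j'<q i. transition m (ch x) i j j' x * val (ch x) (Uc (ch x)) i (xi (ch x) i j') w x)"
      unfolding val_lsec[OF i w c c] using ab by (intro sum.cong refl) simp
    also have "\<dots> = val (ch x) (Uc m) i (xi m i j) w x"
      using xi_trans[OF i j w x c c] by simp
    finally show ?thesis .
  qed
  moreover have "word [(i, ?a)] \<in> deg_words n W i" using word_in_deg_words[OF l] by simp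
  ultimately show ?thesis unfolding rep_def by blast
qed

lemma dual_fibre_split_bundle: "dual_fibre split_bundle x = W"
  by (auto simp: dual_fibre_def split_bundle_def dual_letters_def)

section \<open>The isomorphism\<close>

text \<open>The choice is harmless, as all words representing \<open>a\<close> at x have the same
  class. Starting from the sheaf leaves smoothness to be checked for \<open>Psi\<close> alone; the
  map in the other direction is its inverse.\<close>

definition Psi :: "nat \<Rightarrow> 'a set \<Rightarrow> 's \<Rightarrow> 'a \<Rightarrow> ((nat \<Rightarrow>\<^sub>0 real) \<Rightarrow> real) words set" where
  "Psi k U a = (\<lambda>x\<in>U. gsym_class n W (SOME f. rep k x f U a))"

lemma Psi_eq:
  assumes U: "openin X U" and x: "x \<in> U" and r: "rep k x f U a"
  shows "Psi k U a x = gsym_class n W f"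
proof -
  have "rep k x (SOME f. rep k x f U a) U a" using r by (rule someI)
  then show ?thesis using rep_class_eq_iff[OF _ r point_in_chart(1)[OF U x]] x by (simp add: Psi_def)
qed

lemma Psi_rep:
  assumes U: "openin X U" and x: "x \<in> U" and a: "a \<in> S k U"
  obtains f where "rep k x f U a" "Psi k U a x = gsym_class n W f"
  using rep_exists[OF U x a] Psi_eq[OF U x] by blast

abbreviation Bs where "Bs k U \<equiv> smooth_gsym_sections n M split_bundle k U"

lemma frame_word_split_bundle:
  "frame_word split_bundle \<Phi> y w = map (\<lambda>(i, j). (i, \<lambda>v\<in>seq_space (q i). \<Phi> i y v j)) w"
  by (simp add: frame_word_def split_bundle_def)

text \<open>A smooth section of the symmetric algebra bundle may use trivializations of different
  charts for different degrees, hence one chart \<open>mm i\<close> for each i and generators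
  restricted to the common domain \<open>V\<close>.\<close>

lemma rep_frame_word:
  assumes V: "openin X V" and y: "y \<in> V" and mm: "\<And>i. i \<in> {1..n} \<Longrightarrow> V \<subseteq> Uc (mm i) \<and> \<Phi> i = phi (mm i) i"
    and w: "w \<in> mons k"
  shows "rep k y (word (frame_word split_bundle \<Phi> y w)) V (gword A V (\<lambda>i j. res A i (Uc (mm i)) V (xi (mm i) i j)) w)"
proof -
  let ?xi = "\<lambda>i j. res A i (Uc (mm i)) V (xi (mm i) i j)"
  have "?xi i j \<in> S i V" if "i \<in> {1..n}" "j < q i" for i j
    using res_lin(1)[OF Uc V _ xi(1)[OF that]] mm that by blast
  moreover have "rep i y (word [(i, \<lambda>v\<in>seq_space (q i). \<Phi> i y v j)]) V (?xi i j)" if ij: "i \<in> {1..n}" "j < q i" for i j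
  proof -
    have yi: "y \<in> Uc (mm i)" "V \<subseteq> Uc (mm i)" "\<Phi> i = phi (mm i) i" using mm[OF ij(1)] y by auto
    show ?thesis unfolding yi(3)
      by (rule rep_res[OF Uc yi(1) xi(1)[OF ij] rep_frame[OF ij yi(1)] V yi(2) y])
  qed
  ultimately have "rep (wdeg w) y (word (map (\<lambda>(i, j). (i, \<lambda>v\<in>seq_space (q i). \<Phi> i y v j)) w)) V (gword A V ?xi w)"
    by (rule rep_gword[OF V y]) (use gmonomialsD(1)[OF w] in auto)
  then show ?thesis unfolding frame_word_split_bundle gmonomialsD(2)[OF w] .
qed

text \<open>Over \<open>Uc m\<close> the coefficients of \<open>a\<close> in the monomials of
  \<open>xi m\<close> are smooth, and these monomials are represented by the frame words of the
  trivializations of chart m. So the same functions are the coefficients of \<open>Psi k U a\<close>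
  in a local frame.\<close>

lemma Psi_smooth:
  assumes U: "openin X U" and a: "a \<in> S k U"
  shows "Psi k U a \<in> Bs k U"
proof -
  have vr: "gmonomials n (\<lambda>i. vrank (split_bundle i)) k = mons k" by (simp add: split_bundle_def)
  have "Psi k U a \<in> (\<Pi>\<^sub>E x\<in>U. carrier (gsym n (dual_fibre split_bundle x) k))"
  proof (rule PiE_I)
    fix x assume x: "x \<in> U"
    obtain f where "rep k x f U a" "Psi k U a x = gsym_class n W f"
      by (rule Psi_rep[OF U x a]) (rule that, assumption+)
    then show "Psi k U a x \<in> carrier (gsym n (dual_fibre split_bundle x) k)"
      unfolding dual_fibre_split_bundle gsym_carrier by (auto simp: rep_def)
  qed (simp add: Psi_def)
  moreover have "\<exists>V T \<Phi> f. openin X V \<and> x \<in> V \<and> V \<subseteq> U \<and>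
          (\<forall>i\<in>{1..n}. (T i, \<Phi> i) \<in> vtriv (split_bundle i) \<and> V \<subseteq> T i) \<and>
          (\<forall>w\<in>mons k. smooth_fun M V (f w)) \<and>
          (\<forall>y\<in>V. Psi k U a y = gsym_class n (dual_fibre split_bundle y)
             (\<Sum>w\<in>mons k. f w y *\<^sub>R word (frame_word split_bundle \<Phi> y w)))" if x: "x \<in> U" for x
  proof -
    define m where "m = ch x"
    have xm: "x \<in> Uc m" using point_in_chart(2)[OF U x] by (simp add: m_def)
    obtain f where f: "\<And>w. w \<in> mons k \<Longrightarrow> smooth_fun M (U \<inter> Uc m) (f w)"
      "\<And>y u. y \<in> U \<Longrightarrow> y \<in> Uc m \<Longrightarrow> u \<in> mons k \<Longrightarrow>
        val m U k a u y = (\<Sum>w\<in>mons k. f w y * val m (Uc m) k (xword m w) u y)"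
      by (rule xwords_generate[OF U a, of m]) (rule that, assumption+)
    have "Psi k U a y = gsym_class n W (\<Sum>w\<in>mons k. f w y *\<^sub>R word (frame_word split_bundle (\<lambda>i. phi m i) y w))"
      if y: "y \<in> U" "y \<in> Uc m" for y
    proof (rule Psi_eq[OF U y(1)], rule rep_lincomb)
      show "rep k y (word (frame_word split_bundle (\<lambda>i. phi m i) y w)) (Uc m) (xword m w)" if w: "w \<in> mons k" for w
      proof -
        have "rep (wdeg w) y (word (map (\<lambda>(i, j). (i, \<lambda>v\<in>seq_space (q i). phi m i y v j)) w)) (Uc m) (xword m w)"
          by (rule rep_gword[OF Uc y(2) xi(1) rep_frame[OF _ _ y(2)] gmonomialsD(1)[OF w]])
        then show ?thesis unfolding frame_word_split_bundle gmonomialsD(2)[OF w] .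
      qed
      show "val (ch y) U k a u y = (\<Sum>w\<in>mons k. f w y * val (ch y) (Uc m) k (xword m w) u y)" if u: "u \<in> mons k" for u
        \<comment> \<open>The expansion is known in chart m, while \<open>rep\<close> tests in chart
          \<open>ch y\<close>.\<close>
        by (rule val_linear_relation[OF U a y(1,2) point_in_chart(2)[OF U y(1)] Uc xword_mons_closed y(2) f(2)[OF y] u])
    qed
    moreover have "(Uc m, phi m i) \<in> vtriv (split_bundle i)" for i by (simp add: split_bundle_def)
    ultimately show ?thesis
      using x xm U Uc f(1)
      by (intro exI[of _ "U \<inter> Uc m"] exI[of _ "\<lambda>_. Uc m"] exI[of _ "\<lambda>i. phi m i"] exI[of _ f])
        (auto simp: dual_fibre_split_bundle)
  qed
  ultimately show ?thesis unfolding smooth_gsym_sections_def vr by blast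
qed

lemma Psi_inj:
  assumes U: "openin X U" and a: "a \<in> S k U" and b: "b \<in> S k U" and eq: "Psi k U a = Psi k U b"
  shows "a = b"
proof (rule val_inj[OF U a b])
  fix x assume x: "x \<in> U"
  obtain f where f: "rep k x f U a" "Psi k U a x = gsym_class n W f"
    by (rule Psi_rep[OF U x a]) (rule that, assumption+)
  obtain g where g: "rep k x g U b" "Psi k U b x = gsym_class n W g"
    by (rule Psi_rep[OF U x b]) (rule that, assumption+)
  have "\<forall>w\<in>mons k. val (ch x) U k a w x = val (ch x) U k b w x"
    using rep_class_eq_iff[OF f(1) g(1) point_in_chart(1)[OF U x]] f(2) g(2) eq by simp
  then show "\<exists>m. x \<in> Uc m \<and> (\<forall>w\<in>mons k. val m U k a w x = val m U k b w x)"
    using point_in_chart(2)[OF U x] by blast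
qed

text \<open>Locally the frame words are replaced by products of the generators they represent, with
  the same smooth coefficients. The resulting local sections all have the values prescribed by
  \<open>s\<close>, so they glue.\<close>

lemma Psi_surj:
  assumes U: "openin X U" and s: "s \<in> Bs k U"
  shows "\<exists>a\<in>S k U. Psi k U a = s"
proof -
  have vr: "gmonomials n (\<lambda>i. vrank (split_bundle i)) k = mons k" by (simp add: split_bundle_def)
  have sE: "s \<in> (\<Pi>\<^sub>E x\<in>U. gsym_class n W ` deg_words n W k)"
    using s unfolding smooth_gsym_sections_def dual_fibre_split_bundle gsym_carrier by blast
  have loc: "\<forall>x\<in>U. \<exists>V T \<Phi> f. openin X V \<and> x \<in> V \<and> V \<subseteq> U \<and>
          (\<forall>i\<in>{1..n}. (T i, \<Phi> i) \<in> vtriv (split_bundle i) \<and> V \<subseteq> T i) \<and>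
          (\<forall>w\<in>mons k. smooth_fun M V (f w)) \<and>
          (\<forall>y\<in>V. s y = gsym_class n W (\<Sum>w\<in>mons k. f w y *\<^sub>R word (frame_word split_bundle \<Phi> y w)))"
    using s unfolding smooth_gsym_sections_def dual_fibre_split_bundle vr by blast
  have "\<forall>x\<in>U. \<exists>f. f \<in> deg_words n W k \<and> s x = gsym_class n W f" using sE by (auto simp: PiE_def Pi_def)
  then obtain fr where fr: "\<And>x. x \<in> U \<Longrightarrow> fr x \<in> deg_words n W k" "\<And>x. x \<in> U \<Longrightarrow> s x = gsym_class n W (fr x)"
    by metis
  obtain a where a: "a \<in> S k U"
    "\<And>y m w. y \<in> U \<Longrightarrow> m = ch y \<Longrightarrow> y \<in> Uc m \<Longrightarrow> w \<in> mons k \<Longrightarrow> val m U k a w y = ev m k y w (fr y)"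
  \<comment> \<open>Representatives \<open>fr y\<close> are chosen independently at each point, and
    their evaluations are tied to sections only in the chart \<open>ch y\<close>; only this chart is
    tested.\<close>
  proof (rule sections_glue[OF U, where D = "\<lambda>m y. m = ch y" and k = k and v = "\<lambda>m w y. ev m k y w (fr y)"])
    show "\<exists>m. m = ch x \<and> x \<in> Uc m" if "x \<in> U" for x using point_in_chart(2)[OF U that] by blast
    fix x assume x: "x \<in> U"
    obtain V T \<Phi> f where V: "openin X V" "x \<in> V" "V \<subseteq> U"
      and T: "\<forall>i\<in>{1..n}. (T i, \<Phi> i) \<in> vtriv (split_bundle i) \<and> V \<subseteq> T i"
      and f: "\<forall>w\<in>mons k. smooth_fun M V (f w)"
      and sV: "\<forall>y\<in>V. s y = gsym_class n W (\<Sum>w\<in>mons k. f w y *\<^sub>R word (frame_word split_bundle \<Phi> y w))"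
      using bspec[OF loc x] by (elim exE conjE) (rule that)
    have "\<forall>i\<in>{1..n}. \<exists>m. V \<subseteq> Uc m \<and> \<Phi> i = phi m i"
    proof
      fix i assume "i \<in> {1..n}"
      then have "(T i, \<Phi> i) \<in> range (\<lambda>m. (Uc m, phi m i))" "V \<subseteq> T i"
        using T by (auto simp: split_bundle_def)
      then show "\<exists>m. V \<subseteq> Uc m \<and> \<Phi> i = phi m i" by blast
    qed
    then obtain mm where mm: "\<And>i. i \<in> {1..n} \<Longrightarrow> V \<subseteq> Uc (mm i) \<and> \<Phi> i = phi (mm i) i" by metis
    define xi' where "xi' = (\<lambda>i j. res A i (Uc (mm i)) V (xi (mm i) i j))"
    have x'S: "xi' i j \<in> S i V" if "i \<in> {1..n}" "j < q i" for i j
      unfolding xi'_def using res_lin(1)[OF Uc V(1) _ xi(1)[OF that]] mm that by blast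
    have gS: "gword A V xi' w \<in> S k V" if w: "w \<in> mons k" for w
      using gword_closed[where n = n and q = q and \<xi> = xi', OF V(1) x'S gmonomialsD(1)[OF w]] gmonomialsD(2)[OF w] by simp
    define t where "t = finsum (sec A k V) (\<lambda>w. act k V (f w) (gword A V xi' w)) (mons k)"
    have aS: "act k V (f w) (gword A V xi' w) \<in> S k V" if "w \<in> mons k" for w
      using act_closed[OF V(1) _ gS[OF that]] f that by blast
    have t: "t \<in> S k V" unfolding t_def
      by (rule abelian_monoid.finsum_closed[OF abelian_group.axioms(1)[OF sec_abelian[OF V(1)]]]) (use aS in auto)
    have "val (ch y) V k t w y = ev (ch y) k y w (fr y)" if y: "y \<in> V" and w: "w \<in> mons k" for y w
    proof -
      have yU: "y \<in> U" using y V by blast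
      note yt = point_in_chart[OF U yU]
      let ?g = "\<Sum>w\<in>mons k. f w y *\<^sub>R word (frame_word split_bundle \<Phi> y w)"
      have "rep k y ?g V t"
      proof (rule rep_lincomb)
        show "rep k y (word (frame_word split_bundle \<Phi> y w)) V (gword A V xi' w)" if w: "w \<in> mons k" for w
          unfolding xi'_def by (rule rep_frame_word[OF V(1) y mm w])
        show "val (ch y) V k t u y = (\<Sum>w\<in>mons k. f w y * val (ch y) V k (gword A V xi' w) u y)" if u: "u \<in> mons k" for u
        proof -
          have "val (ch y) V k t u y = (\<Sum>w\<in>mons k. val (ch y) V k (act k V (f w) (gword A V xi' w)) u y)"
            unfolding t_def by (rule val_finsum[OF V(1) finite_gmonomials aS u y yt(2)])
          also have "\<dots> = (\<Sum>w\<in>mons k. f w y * val (ch y) V k (gword A V xi' w) u y)"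
            using val_act[OF V(1) gS _ u y yt(2)] f by (intro sum.cong refl) blast
          finally show ?thesis .
        qed
      qed
      then have ev: "ev (ch y) k y w ?g = val (ch y) V k t w y" using w by (simp add: rep_def)
      \<comment> \<open>The chosen representative and the local frame expression have the same
        class, so they evaluate alike.\<close>
      have "fr y - ?g \<in> gsym_ideal n W"
        using fr(2)[OF yU] bspec[OF sV y] by (simp flip: gsym_class_eq_iff)
      then have "ev (ch y) k y w (fr y - ?g) = 0" by (rule ev_ideal[OF yt(2) w])
      then have "ev (ch y) k y w (fr y) = ev (ch y) k y w ?g"
        unfolding linear_diff[OF linear_ev] by (rule eq_iff_diff_eq_0[THEN iffD2])
      then show ?thesis unfolding ev by (rule sym)
    qed
    then show "\<exists>N t. openin X N \<and> x \<in> N \<and> N \<subseteq> U \<and> t \<in> S k N \<and>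
      (\<forall>y\<in>N. \<forall>m. m = ch y \<longrightarrow> y \<in> Uc m \<longrightarrow> (\<forall>w\<in>mons k. val m N k t w y = ev m k y w (fr y)))"
      using V t by (intro exI[of _ V] exI[of _ t]) simp
  qed (rule that, assumption+)
  have "Psi k U a x = s x" if x: "x \<in> U" for x
  proof -
    have "rep k x (fr x) U a" using fr(1)[OF x] a(2)[OF x refl point_in_chart(2)[OF U x]] by (simp add: rep_def)
    then show ?thesis using Psi_eq[OF U x] fr(2)[OF x] by simp
  qed
  then have "Psi k U a = s"
    by (intro extensionalityI[of _ U]) (use sE in \<open>auto simp: Psi_def PiE_def\<close>)
  then show ?thesis using a(1) by blast
qed

lemma Psi_bij: "openin X U \<Longrightarrow> bij_betw (Psi k U) (S k U) (Bs k U)"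
  unfolding bij_betw_def inj_on_def using Psi_inj Psi_smooth Psi_surj by (auto simp: image_iff) metis

lemma Psi_add:
  assumes U: "openin X U" and a: "a \<in> S k U" and b: "b \<in> S k U"
  shows "Psi k U (a \<oplus>\<^bsub>sec A k U\<^esub> b) = (\<lambda>x\<in>U. Psi k U a x \<oplus>\<^bsub>gsym n W k\<^esub> Psi k U b x)"
proof (rule extensionalityI[of _ U])
  fix x assume x: "x \<in> U"
  obtain f where f: "rep k x f U a" "Psi k U a x = gsym_class n W f"
    by (rule Psi_rep[OF U x a]) (rule that, assumption+)
  obtain g where g: "rep k x g U b" "Psi k U b x = gsym_class n W g"
    by (rule Psi_rep[OF U x b]) (rule that, assumption+)
  show "Psi k U (a \<oplus>\<^bsub>sec A k U\<^esub> b) x = (\<lambda>x\<in>U. Psi k U a x \<oplus>\<^bsub>gsym n W k\<^esub> Psi k U b x) x"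
    using Psi_eq[OF U x rep_add[OF U x a b f(1) g(1)]] f(2) g(2) x by (simp add: gsym_add_class)
qed (auto simp: Psi_def)

lemma Psi_smult:
  assumes U: "openin X U" and a: "a \<in> S k U"
  shows "Psi k U (c \<odot>\<^bsub>sec A k U\<^esub> a) = (\<lambda>x\<in>U. c \<odot>\<^bsub>gsym n W k\<^esub> Psi k U a x)"
proof (rule extensionalityI[of _ U])
  fix x assume x: "x \<in> U"
  obtain f where f: "rep k x f U a" "Psi k U a x = gsym_class n W f"
    by (rule Psi_rep[OF U x a]) (rule that, assumption+)
  show "Psi k U (c \<odot>\<^bsub>sec A k U\<^esub> a) x = (\<lambda>x\<in>U. c \<odot>\<^bsub>gsym n W k\<^esub> Psi k U a x) x"
    using Psi_eq[OF U x rep_smult[OF U x a f(1)]] f(2) x by (simp add: gsym_smult_class)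
qed (auto simp: Psi_def)

lemma Psi_gmul:
  assumes U: "openin X U" and a: "a \<in> S k U" and b: "b \<in> S l U"
  shows "Psi (k + l) U (gmul A k l U a b) = (\<lambda>x\<in>U. gsym_mult n W (Psi k U a x) (Psi l U b x))"
proof (rule extensionalityI[of _ U])
  fix x assume x: "x \<in> U"
  obtain f where f: "rep k x f U a" "Psi k U a x = gsym_class n W f"
    by (rule Psi_rep[OF U x a]) (rule that, assumption+)
  obtain g where g: "rep l x g U b" "Psi l U b x = gsym_class n W g"
    by (rule Psi_rep[OF U x b]) (rule that, assumption+)
  have "f \<in> letter_words n W" "g \<in> letter_words n W"
    using f(1) g(1) deg_words_letter_words by (auto simp: rep_def)
  then show "Psi (k + l) U (gmul A k l U a b) x = (\<lambda>x\<in>U. gsym_mult n W (Psi k U a x) (Psi l U b x)) x"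
    using Psi_eq[OF U x rep_mult[OF U x a b f(1) g(1)]] f(2) g(2) x by (simp add: dual_letters.gsym_mult_class)
qed (auto simp: Psi_def)

lemma Psi_one:
  assumes U: "openin X U"
  shows "Psi 0 U (gone A U) = (\<lambda>x\<in>U. gsym_class n W (word []))"
  by (rule extensionalityI[of _ U]) (use Psi_eq[OF U _ rep_one[OF U]] in \<open>auto simp: Psi_def\<close>)

lemma Psi_res:
  assumes U: "openin X U" and a: "a \<in> S k U" and V: "openin X V" "V \<subseteq> U"
  shows "Psi k V (res A k U V a) = restrict (Psi k U a) V"
proof (rule extensionalityI[of _ V])
  fix x assume x: "x \<in> V"
  then have point_in_chart: "x \<in> U" using V by blast
  obtain f where f: "rep k x f U a" "Psi k U a x = gsym_class n W f"
    by (rule Psi_rep[OF U point_in_chart a]) (rule that, assumption+)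
  show "Psi k V (res A k U V a) x = restrict (Psi k U a) V x"
    using Psi_eq[OF V(1) x rep_res[OF U point_in_chart a f(1) V x]] f(2) x by simp
qed (auto simp: Psi_def)

lemma preim_id: "openin X U \<Longrightarrow> preim X (\<lambda>x. x) U = U"
  using openin_subset by (auto simp: preim_def)

abbreviation split_sh where "split_sh \<equiv> split_sheaf n M split_bundle"

lemma split_simps:
  "carrier (sec split_sh k U) = Bs k U"
  "add (sec split_sh k U) = (\<lambda>s t. \<lambda>x\<in>U. s x \<oplus>\<^bsub>gsym n W k\<^esub> t x)"
  "smult (sec split_sh k U) = (\<lambda>c s. \<lambda>x\<in>U. c \<odot>\<^bsub>gsym n W k\<^esub> s x)"
  "res split_sh k U V = (\<lambda>s. restrict s V)"
  "gmul split_sh k l U = (\<lambda>s t. \<lambda>x\<in>U. gsym_mult n W (s x) (t x))"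
  "gone split_sh U = (\<lambda>x\<in>U. gsym_class n W (word []))"
  by (simp_all add: split_sheaf_def dual_fibre_split_bundle)

lemma split_isomorphic: "N_isomorphic (M, A) (split_N_manifold n M split_bundle)"
proof -
  define Phi where "Phi k U = inv_into (S k U) (Psi k U)" for k U
  have Phi: "Phi k U s \<in> S k U" "Psi k U (Phi k U s) = s" if "openin X U" "s \<in> Bs k U" for k U s
    using Psi_bij[OF that(1), of k] that(2) unfolding Phi_def bij_betw_def
    by (auto intro: inv_into_into f_inv_into_f)
  have Phi_Psi: "Phi k U (Psi k U a) = a" if "openin X U" "a \<in> S k U" for k U a
    using Psi_bij[OF that(1), of k] that(2) unfolding Phi_def bij_betw_def by (simp add: inv_into_f_f)
  have cm: "continuous_map X X (\<lambda>x. x)" by simp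
  have Psi_lin: "linear_between (sec A k U) (sec split_sh k U) (Psi k U)" if "openin X U" for k U
    using Psi_smooth[OF that] Psi_add[OF that] Psi_smult[OF that] by (simp add: linear_between_def split_simps)
  have Phi_eqI: "Phi k U s = a" if "openin X U" "a \<in> S k U" "Psi k U a = s" for k U s a
    using Phi_Psi that by blast
  have Phi_lin: "linear_between (sec split_sh k U) (sec A k U) (Phi k U)" if U: "openin X U" for k U
    unfolding linear_between_def split_simps
  proof (intro conjI ballI allI)
    show "Phi k U \<in> Bs k U \<rightarrow> S k U" using Phi(1)[OF U] by blast
    fix s assume s: "s \<in> Bs k U"
    show "Phi k U (\<lambda>x\<in>U. c \<odot>\<^bsub>gsym n W k\<^esub> s x) = c \<odot>\<^bsub>sec A k U\<^esub> Phi k U s" for c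
      by (rule Phi_eqI[OF U smult_closed[OF U Phi(1)[OF U s]]])
        (simp add: Psi_smult[OF U Phi(1)[OF U s]] Phi(2)[OF U s])
    fix t assume t: "t \<in> Bs k U"
    show "Phi k U (\<lambda>x\<in>U. s x \<oplus>\<^bsub>gsym n W k\<^esub> t x) = Phi k U s \<oplus>\<^bsub>sec A k U\<^esub> Phi k U t"
      by (rule Phi_eqI[OF U add_closed[OF U Phi(1)[OF U s] Phi(1)[OF U t]]])
        (simp add: Psi_add[OF U Phi(1)[OF U s] Phi(1)[OF U t]] Phi(2)[OF U s] Phi(2)[OF U t])
  qed
  have Phi_gmul: "Phi (k + l) U (\<lambda>x\<in>U. gsym_mult n W (s x) (t x)) = gmul A k l U (Phi k U s) (Phi l U t)"
    if U: "openin X U" and s: "s \<in> Bs k U" and t: "t \<in> Bs l U" for k l U s t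
    by (rule Phi_eqI[OF U gmul_closed[OF U Phi(1)[OF U s] Phi(1)[OF U t]]])
      (simp add: Psi_gmul[OF U Phi(1)[OF U s] Phi(1)[OF U t]] Phi(2)[OF U s] Phi(2)[OF U t])
  have Phi_one: "Phi 0 U (\<lambda>x\<in>U. gsym_class n W (word [])) = gone A U" if U: "openin X U" for U
    by (rule Phi_eqI[OF U one_closed[OF U] Psi_one[OF U]])
  have Phi_res: "Phi k V (restrict s V) = res A k U V (Phi k U s)"
    if U: "openin X U" and V: "openin X V" "V \<subseteq> U" and s: "s \<in> Bs k U" for k U V s
    by (rule Phi_eqI[OF V(1) res_lin(1)[OF U V Phi(1)[OF U s]]])
      (simp add: Psi_res[OF U Phi(1)[OF U s] V] Phi(2)[OF U s])
  \<comment> \<open>Morphisms pull sections back, so the morphism from the given manifold to the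
    split one has \<open>Phi\<close> as its map of sections, and the reverse morphism has
    \<open>Psi\<close>.\<close>
  have 1: "N_morphism (M, A) (M, split_sh) (\<lambda>x. x) Phi"
    unfolding N_morphism_def prod.case
    using cm Phi_lin Phi_gmul Phi_one Phi_res by (simp add: preim_id split_simps)
  have 2: "N_morphism (M, split_sh) (M, A) (\<lambda>x. x) Psi"
    unfolding N_morphism_def prod.case
    using cm Psi_lin Psi_gmul Psi_one Psi_res by (simp add: preim_id split_simps)
  show ?thesis
    unfolding N_isomorphic_def split_N_manifold_def prod.case
    using 1 2 Phi_Psi Phi(2)
    by (intro exI[of _ "\<lambda>x. x"] exI[of _ Phi] exI[of _ Psi] conjI exI[of _ "\<lambda>x. x"])
      (auto simp: preim_id split_simps)
qed

end

text \<open>The empty set is an admissible chart, as the enumeration of the cover requires. The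
  empty family covers it, so locality leaves a single section in each degree, and existence and
  uniqueness of expansions are trivial.\<close>

lemma freely_generated_empty:
  assumes "graded_comm_sheaf X A"
  shows "\<exists>\<xi>. freely_generated X A n q {} \<xi>"
proof -
  interpret graded_comm_sheaf X A by fact
  have o: "openin X {}" by simp
  have M: "Module.module real_ring (sec A k {})" for k using sec_module[OF o] .
  have eq: "a = b" if "a \<in> carrier (sec A k {})" "b \<in> carrier (sec A k {})" for a b k
    using locality[of "{}" a k b] that by simp
  have z: "\<zero>\<^bsub>sec A k {}\<^esub> \<in> carrier (sec A k {})" for k
    using M[of k] by (meson abelian_group.axioms(1) abelian_monoid.zero_closed module.axioms(2))
  have ag: "abelian_group (sec A k {})" for k using M[of k] by (rule module.axioms(2))
  define \<xi> where "\<xi> = (\<lambda>(i::nat) (j::nat). \<zero>\<^bsub>sec A i {}\<^esub>)"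
  have gw: "gword A {} \<xi> w \<in> carrier (sec A (sum_list (map fst w)) {})" for w
  proof (induction w)
    case Nil
    then show ?case using one_closed[OF o] by simp
  next
    case (Cons x w)
    have "\<xi> (fst x) (snd x) \<in> carrier (sec A (fst x) {})" by (simp add: \<xi>_def z)
    then have "gmul A (fst x) (sum_list (map fst w)) {} (\<xi> (fst x) (snd x)) (gword A {} \<xi> w)
        \<in> carrier (sec A (fst x + sum_list (map fst w)) {})"
      using linear_betweenD(1)[OF mul_left_linear[OF o Cons]] by blast
    then show ?case by (cases x) simp
  qed
  have "\<exists>!c. c \<in> gmonomials n q k \<rightarrow>\<^sub>E carrier (sec A 0 {}) \<and>
       a = finsum (sec A k {}) (\<lambda>w. gmul A 0 k {} (c w) (res A k {} {} (gword A {} \<xi> w))) (gmonomials n q k)"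
    if a: "a \<in> carrier (sec A k {})" for a k
  proof (rule ex1I[of _ "\<lambda>w\<in>gmonomials n q k. \<zero>\<^bsub>sec A 0 {}\<^esub>"])
    let ?c = "\<lambda>w\<in>gmonomials n q k. \<zero>\<^bsub>sec A 0 {}\<^esub>"
    have "gmul A 0 k {} (?c w) (res A k {} {} (gword A {} \<xi> w)) \<in> carrier (sec A k {})"
      if w: "w \<in> gmonomials n q k" for w
    proof -
      have g: "gword A {} \<xi> w \<in> carrier (sec A k {})" using gw[of w] gmonomialsD(2)[OF w] by simp
      then have "res A k {} {} (gword A {} \<xi> w) \<in> carrier (sec A k {})" using res_self[OF o g] by simp
      then show ?thesis using linear_betweenD(1)[OF mul_left_linear[OF o]] z w by (metis add_0 restrict_apply')
    qed
    then have "finsum (sec A k {}) (\<lambda>w. gmul A 0 k {} (?c w) (res A k {} {} (gword A {} \<xi> w))) (gmonomials n q k)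
        \<in> carrier (sec A k {})"
      by (intro abelian_monoid.finsum_closed[OF abelian_group.axioms(1)[OF ag]]) auto
    then show "?c \<in> gmonomials n q k \<rightarrow>\<^sub>E carrier (sec A 0 {}) \<and>
       a = finsum (sec A k {}) (\<lambda>w. gmul A 0 k {} (?c w) (res A k {} {} (gword A {} \<xi> w))) (gmonomials n q k)"
      using eq[OF a] z by auto
    fix c assume "c \<in> gmonomials n q k \<rightarrow>\<^sub>E carrier (sec A 0 {}) \<and>
       a = finsum (sec A k {}) (\<lambda>w. gmul A 0 k {} (c w) (res A k {} {} (gword A {} \<xi> w))) (gmonomials n q k)"
    then have c: "c \<in> gmonomials n q k \<rightarrow>\<^sub>E carrier (sec A 0 {})" by blast
    show "c = ?c"
      by (rule extensionalityI[of _ "gmonomials n q k"]) (use c eq z in \<open>auto simp: PiE_def Pi_def\<close>)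
  qed
  then have "freely_generated X A n q {} \<xi>"
    unfolding freely_generated_def by (auto simp: \<xi>_def z)
  then show ?thesis by blast
qed

theorem theorem1:
  fixes n :: nat and q :: "nat \<Rightarrow> nat"
    and M :: "'a mfd" and A :: "('a, 's) gsheaf"
  assumes "n \<ge> 1"
    and "N_manifold n q (M, A)"
  shows "\<exists>E :: nat \<Rightarrow> ('a, nat \<Rightarrow>\<^sub>0 real) vbundle.
    (\<forall>i\<in>{1..n}. smooth_vector_bundle M (E i)) \<and>
    N_isomorphic (M, A) (split_N_manifold n M E)"
proof -
  have M: "smooth_manifold M" and A: "graded_comm_sheaf (mtop M) A" and deg0: "degree_zero_C_inf M A"
    and free: "\<And>x. x \<in> topspace (mtop M) \<Longrightarrow> \<exists>U \<xi>. openin (mtop M) U \<and> x \<in> U \<and> freely_generated (mtop M) A n q U \<xi>"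
    using assms(2) unfolding N_manifold_def prod.case by blast+
  interpret smooth_mfd M by unfold_locales (rule M)
  interpret sh: graded_comm_sheaf "mtop M" A by (rule A)
  obtain \<kappa> where \<kappa>: "function_sheaf M A \<kappa>"
    using deg0 unfolding degree_zero_C_inf_def
    by (elim exE) (rule that, unfold_locales)
  \<comment> \<open>Generators are hidden in an existential while the cover is refined, and are
    chosen for each index afterwards.\<close>
  let ?P = "\<lambda>U. \<exists>\<xi>. freely_generated (mtop M) A n q U \<xi>"
  have cov: "\<exists>U. openin (mtop M) U \<and> x \<in> U \<and> ?P U" if "x \<in> topspace (mtop M)" for x
    using free[OF that] by blast
  obtain U :: "nat \<Rightarrow> 'a set" and \<rho> :: "nat \<Rightarrow> 'a \<Rightarrow> real" where
    U: "\<And>m. openin (mtop M) (U m)" "\<And>m. ?P (U m)" and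
    \<rho>: "\<And>m. smooth_fun M (topspace (mtop M)) (\<rho> m)"
    "\<And>x. x \<in> topspace (mtop M) \<Longrightarrow> \<exists>N F. openin (mtop M) N \<and> x \<in> N \<and> finite F \<and>
       (\<forall>m\<in>F. N \<subseteq> U m) \<and> (\<forall>m. m \<notin> F \<longrightarrow> (\<forall>y\<in>N. \<rho> m y = 0)) \<and> (\<forall>y\<in>N. (\<Sum>m\<in>F. \<rho> m y) = 1)"
    by (rule partition_of_unity[of ?P, OF cov freely_generated_empty[OF A]]) (assumption, rule that, assumption+)
  obtain \<eta> where \<eta>: "\<And>m. freely_generated (mtop M) A n q (U m) (\<eta> m)"
    using U(2) by metis
  interpret F: function_sheaf M A \<kappa> by (rule \<kappa>)
  interpret N: nmfd M A \<kappa> n q U \<eta> \<rho>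
    by unfold_locales (fact U(1) \<eta> \<rho>)+
  show ?thesis
    using N.split_bundle_smooth N.split_isomorphic by blast
qed

end
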